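(* Let $\omega\in\widehat{\mathcal D}$ and $1<p,q<\infty$. Then the maximal Bergman projection $P^+_\omega$ is bounded from $L^{p,q}_\omega$ to $L^{p,q}_\omega$ if and only if $\omega\in\check{\mathcal D}$ (equivalently, $\omega\in\mathcal D=\widehat{\mathcal D}\cap\check{\mathcal D}$).
   Context: A radial weight is a nonnegative $\omega\in L^1([0,1))$, extended by $\omega(z)=\omega(|z|)$; $\widehat\omega(r)=\int_r^1\omega(s)ds>0$ for all $r\in[0,1)$. $\omega\in\widehat{\mathcal D}$ means $\widehat\omega(r)\le C\widehat\omega(\frac{1+r}2)$ for some $C>0$ and all $0\le r<1$. $\omega\in\check{\mathcal D}$ means there exist $K>1$, $C>1$ with $\widehat\omega(r)\ge C\widehat\omega(1-\frac{1-r}K)$ for all $0\le r<1$. $\omega_x=\int_0^1r^x\omega(r)dr$. $L^{p,q}_\omega$ consists of measurable $f$ on $\mathbb D$ with $\|f\|^q_{L^{p,q}_\omega}=\int_0^1\big(\frac1{2\pi}\int_0^{2\pi}|f(re^{i\theta})|^pd\theta\big)^{q/p}r\omega(r)\,dr<\infty$. $B^\omega_z(\zeta)=\sum_{n\ge0}\frac{(\overline z\zeta)^n}{2\omega_{2n+1}}$ and $P^+_\omega f(z)=\int_{\mathbb D}f(\zeta)|B^\omega_z(\zeta)|\omega(\zeta)\,dA(\zeta)$, with $dA$ normalized area measure. *)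

theory Defs
  imports "HOL-Analysis.Analysis"
begin

text \<open>Radial weights are represented by their profile w :: real => real on [0,1);
  the weight on the disc is w (cmod z).\<close>

definition omega_hat :: "(real \<Rightarrow> real) \<Rightarrow> real \<Rightarrow> real" where
  "omega_hat w r = (LINT s:{r..<1}|lborel. w s)"

definition radial_weight :: "(real \<Rightarrow> real) \<Rightarrow> bool" where
  "radial_weight w \<longleftrightarrow> (\<forall>r\<in>{0..<1}. 0 \<le> w r) \<and> set_integrable lborel {0..<1} w
     \<and> (\<forall>r\<in>{0..<1}. omega_hat w r > 0)"

definition D_hat :: "(real \<Rightarrow> real) \<Rightarrow> bool" where
  "D_hat w \<longleftrightarrow> (\<exists>C>0. \<forall>r\<in>{0..<1}. omega_hat w r \<le> C * omega_hat w ((1 + r) / 2))"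

definition D_check :: "(real \<Rightarrow> real) \<Rightarrow> bool" where
  "D_check w \<longleftrightarrow> (\<exists>K>1. \<exists>C>1. \<forall>r\<in>{0..<1}.
      omega_hat w r \<ge> C * omega_hat w (1 - (1 - r) / K))"

text \<open>Moments omega_x = int_0^1 r^x w(r) dr (only natural exponents are needed).\<close>
definition moment :: "(real \<Rightarrow> real) \<Rightarrow> nat \<Rightarrow> real" where
  "moment w x = (LINT r:{0..<1}|lborel. r ^ x * w r)"

definition bergman_kernel :: "(real \<Rightarrow> real) \<Rightarrow> complex \<Rightarrow> complex \<Rightarrow> complex" where
  "bergman_kernel w z \<zeta> = (\<Sum>n. (cnj z * \<zeta>) ^ n / complex_of_real (2 * moment w (2 * n + 1)))"

text \<open>Maximal Bergman projection; dA = (1/pi) times Lebesgue measure on the plane.\<close>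
definition P_plus_integrand ::
    "(real \<Rightarrow> real) \<Rightarrow> (complex \<Rightarrow> complex) \<Rightarrow> complex \<Rightarrow> complex \<Rightarrow> complex" where
  "P_plus_integrand w f z \<zeta> =
     f \<zeta> * complex_of_real (cmod (bergman_kernel w z \<zeta>) * w (cmod \<zeta>) / pi)"

definition P_plus :: "(real \<Rightarrow> real) \<Rightarrow> (complex \<Rightarrow> complex) \<Rightarrow> complex \<Rightarrow> complex" where
  "P_plus w f z = (LINT \<zeta>:ball 0 1|lborel. P_plus_integrand w f z \<zeta>)"

text \<open>Real power on [0,\<infinity>], x^a with \<infinity>^a = \<infinity> (used only for a > 0).\<close>
definition epowr :: "ennreal \<Rightarrow> real \<Rightarrow> ennreal" where
  "epowr x a = (if x = \<infinity> then \<infinity> else ennreal (enn2real x powr a))"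

definition Lpq_norm_pow :: "real \<Rightarrow> real \<Rightarrow> (real \<Rightarrow> real) \<Rightarrow> (complex \<Rightarrow> complex) \<Rightarrow> ennreal" where
  "Lpq_norm_pow p q w f =
     (\<integral>\<^sup>+ r\<in>{0..<1}.
        epowr ((\<integral>\<^sup>+ \<theta>\<in>{0..2*pi}. ennreal (cmod (f (complex_of_real r * cis \<theta>)) powr p) \<partial>lborel)
                / ennreal (2 * pi)) (q / p)
        * ennreal (r * w r) \<partial>lborel)"

definition in_Lpq :: "real \<Rightarrow> real \<Rightarrow> (real \<Rightarrow> real) \<Rightarrow> (complex \<Rightarrow> complex) \<Rightarrow> bool" where
  "in_Lpq p q w f \<longleftrightarrow> set_borel_measurable lborel (ball 0 1) f \<and> Lpq_norm_pow p q w f < \<infinity>"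

text \<open>Boundedness of P^+ from L^{p,q}_omega to itself: P^+ f is well defined (absolutely
  convergent integral) for every f in the space, lies in the space, and the norm bound holds
  (stated for q-th powers of norms, which is equivalent).\<close>
definition P_plus_bounded :: "real \<Rightarrow> real \<Rightarrow> (real \<Rightarrow> real) \<Rightarrow> bool" where
  "P_plus_bounded p q w \<longleftrightarrow> (\<exists>C::real. \<forall>f. in_Lpq p q w f \<longrightarrow>
      (\<forall>z\<in>ball 0 1. set_integrable lborel (ball 0 1) (P_plus_integrand w f z))
      \<and> in_Lpq p q w (P_plus w f)
      \<and> Lpq_norm_pow p q w (P_plus w f) \<le> ennreal C * Lpq_norm_pow p q w f)"

end

theory Submission
  imports Defs
begin

text \<open>In polar coordinates the angular part of \<open>P\<^sup>+\<close> is a convolution, so Young's and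
  Minkowski's inequalities (and radial test functions for the converse) reduce the problem to the
  operator with kernel \<open>k(r \<rho>)\<close> on \<open>L\<^sup>q(w)\<close>, where \<open>k(x)\<close> is the \<open>L\<^sup>1\<close> norm on the circle of
  radius \<open>x\<close> of \<open>K(s) = \<Sum> s\<^sup>n / (2 w\<^bsub>2n+1\<^esub>)\<close>.  Write \<open>H\<close> for \<open>omega_hat w\<close>.

  If \<open>w\<close> satisfies \<open>D_check\<close>, then \<open>k \<le> A / H\<close>: passing from the radius \<open>x\<close> to
  \<open>y = 1 - (1 - x) / \<kappa>\<close>, with \<open>\<kappa>\<close> the constant of \<open>D_check\<close>, changes the kernel by at most a
  multiple of \<open>1 / H(y)\<close> in \<open>L\<^sup>1\<close>, and these increments form a geometric sum.  With
  \<open>k(r \<rho>) \<le> A / max (H r) (H \<rho>)\<close>, Schur's test with powers of \<open>H\<close> applies, because the image of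
  \<open>w dr\<close> under \<open>H\<close> is Lebesgue measure on \<open>[0, H 0]\<close>.

  Conversely, testing on the indicator of \<open>x \<le> |z| < 1\<close> bounds \<open>H(x) k(x\<^sup>2)\<close>, while Hardy's
  inequality bounds \<open>k(x\<^sup>2)\<close> from below by \<open>\<Sum> x\<^bsup>2n\<^esup> / ((n + 1) w\<^bsub>2n+1\<^esub>)\<close> up to a constant.  The block
  \<open>N \<le> n < 2\<^sup>J N\<close> with \<open>N\<close> about \<open>1 / (1 - r)\<close> and \<open>1 - x = (1 - r) / 2\<^bsup>J+3\<^esup>\<close> contributes about
  \<open>J / H(r)\<close>, whence \<open>H(r) \<ge> 2 H(x)\<close> once \<open>J\<close> is large.\<close>

section \<open>Polar coordinates\<close>

text \<open>The obstacle is that the kernel has no closed form; its coefficients are known only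
  through the moments. \<open>D_hat\<close> makes these comparable with \<open>H\<close> at the
  matching radius: the lower bound \<open>power_mult_H_le_moment\<close> is free, the upper bound
  \<open>moment_le_H\<close> comes from doubling, and together they give
  \<open>a (Suc n) - a n\<close> at most a constant times \<open>a (Suc n) / (n + 1)\<close>. This
  is just enough regularity for one summation by parts, which is what bounds a kernel increment in
  the mean. Each increment costs a full multiple of \<open>1 / H\<close>. Under
  \<open>D_check\<close> these costs grow geometrically, so the last one dominates; if
  \<open>H\<close> hardly decays they may add up to a logarithm, and it is this logarithm that the
  harmonic blocks detect in the converse. The exponent \<open>p\<close> enters only through
  convolution with an integrable kernel on the circle, and \<open>q\<close> only through the powers
  in Schur's test. Since \<open>w\<close> is constrained on [0,1) alone, all integrals are rewritten
  with the cut-off \<open>W\<close> and its measure \<open>\<mu>\<close> before any measurability is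
  used.\<close>

text \<open>The substitution rule works on compact intervals, so the two sides are compared as
  measures: on a fixed Borel set the open interval is exhausted by the images of [-n, n], and
  monotone convergence gives equality. Equal measures then have equal integrals.\<close>

lemma nn_integral_arctan:
  fixes f :: "real \<Rightarrow> ennreal"
  assumes [measurable]: "f \<in> borel_measurable borel"
  shows "(\<integral>\<^sup>+\<theta>\<in>{-pi/2<..<pi/2}. f \<theta> \<partial>lborel) = (\<integral>\<^sup>+t. f (arctan t) * ennreal (1 / (1 + t\<^sup>2)) \<partial>lborel)"
proof -
  let ?M = "density lborel (indicator {-pi/2<..<pi/2} :: real \<Rightarrow> ennreal)"
  let ?D = "density lborel (\<lambda>t::real. ennreal (1 / (1 + t\<^sup>2)))"
  let ?N = "distr ?D borel arctan"
  have meas: "(\<lambda>t::real. ennreal (1 / (1 + t\<^sup>2))) \<in> borel_measurable borel" by measurable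
  have eq: "emeasure ?M A = emeasure ?N A" if [measurable]: "A \<in> sets borel" for A
  proof -
    have step: "(\<integral>\<^sup>+x. indicator A x * indicator {arctan (- real n)..arctan (real n)} x \<partial>lborel) =
        (\<integral>\<^sup>+t. indicator A (arctan t) * ennreal (1 / (1 + t\<^sup>2)) * indicator {- real n..real n} t \<partial>lborel)" for n
    proof -
      have nz: "1 + t\<^sup>2 \<noteq> 0" for t :: real by (smt (verit) zero_le_power2)
      have "(\<integral>\<^sup>+x. ennreal (indicator A x * indicator {arctan (- real n)..arctan (real n)} x) \<partial>lborel) =
          (\<integral>\<^sup>+t. ennreal (indicator A (arctan t) * (1 / (1 + t\<^sup>2)) * indicator {- real n..real n} t) \<partial>lborel)"
        using nz by (intro nn_integral_substitution)
          (auto simp: set_borel_measurable_def inverse_eq_divide intro!: derivative_eq_intros continuous_intros)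
      then show ?thesis
        by (simp add: ennreal_mult'' ennreal_indicator del: mult_divide_mult_cancel_left_if times_divide_eq_right)
    qed
    have U1: "(\<Union>n. {arctan (- real n)..arctan (real n)}) = {-pi/2<..<pi/2}"
    proof safe
      fix x :: real and n assume "x \<in> {arctan (- real n)..arctan (real n)}"
      then show "x \<in> {- pi / 2<..<pi / 2}"
        using arctan_lbound[of "-real n"] arctan_ubound[of "real n"] by auto
    next
      fix x :: real assume x: "x \<in> {- pi / 2<..<pi / 2}"
      obtain n :: nat where n: "\<bar>tan x\<bar> \<le> real n" using real_arch_simple by blast
      have "arctan (tan x) = x" using x by (intro arctan_tan) auto
      moreover have "arctan (- real n) \<le> arctan (tan x)" "arctan (tan x) \<le> arctan (real n)"
        using n by (auto simp only: arctan_le_iff)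
      ultimately show "x \<in> (\<Union>n. {arctan (- real n)..arctan (real n)})" by force
    qed
    have inc1: "incseq (\<lambda>n. {arctan (- real n)..arctan (real n)})"
      by (auto simp: incseq_def arctan_minus intro: order_trans) (smt (verit) arctan_le_iff of_nat_mono)+
    have U2: "(\<Union>n. {- real n..real n}) = UNIV"
    proof safe
      fix x :: real
      obtain n :: nat where n: "\<bar>x\<bar> \<le> real n" using real_arch_simple by blast
      then show "x \<in> (\<Union>n. {- real n..real n})" by (auto intro!: exI[of _ n])
    qed auto
    have inc2: "incseq (\<lambda>n. {- real n..real n})" by (auto simp: incseq_def)
    have "emeasure ?M A = emeasure (density lborel (indicator A)) (\<Union>n. {arctan (- real n)..arctan (real n)})"
      by (simp add: U1 emeasure_density mult.commute)
    also have "\<dots> = (SUP n. emeasure (density lborel (indicator A)) {arctan (- real n)..arctan (real n)})"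
      using inc1 by (intro SUP_emeasure_incseq[symmetric]) auto
    also have "\<dots> = (SUP n. emeasure (density ?D (indicator (arctan -` A))) {- real n..real n})"
      using step by (simp add: emeasure_density nn_integral_density indicator_vimage[abs_def] mult_ac)
    also have "\<dots> = emeasure (density ?D (indicator (arctan -` A))) (\<Union>n. {- real n..real n})"
      using inc2 by (intro SUP_emeasure_incseq) auto
    also have "\<dots> = emeasure ?N A"
    proof -
      have v: "arctan -` A \<in> sets borel" using measurable_sets[of arctan borel borel A] by simp
      show ?thesis using v by (simp add: U2 emeasure_density nn_integral_density emeasure_distr mult_ac)
    qed
    finally show ?thesis .
  qed
  have "?M = ?N" by (rule measure_eqI) (use eq in auto)
  then have "integral\<^sup>N ?M f = integral\<^sup>N ?N f" by simp
  then show ?thesis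
    by (simp add: nn_integral_density nn_integral_distr mult.commute)
qed

text \<open>The image of planar Lebesgue measure under (x, y) to x + iy gives every box its volume,
  hence is Lebesgue measure on the complex plane; Tonelli does the rest.\<close>

lemma nn_integral_complex_Re_Im:
  fixes f :: "complex \<Rightarrow> ennreal"
  assumes [measurable]: "f \<in> borel_measurable borel"
  shows "integral\<^sup>N lborel f = (\<integral>\<^sup>+x. \<integral>\<^sup>+y. f (Complex x y) \<partial>lborel \<partial>lborel)"
proof -
  have [measurable]: "(\<lambda>z::real\<times>real. Complex (fst z) (snd z)) \<in> borel_measurable borel"
    unfolding Complex_eq by (intro borel_measurable_continuous_onI continuous_intros)
  have "lborel = distr (lborel :: (real \<times> real) measure) borel (\<lambda>z. Complex (fst z) (snd z))"
  proof (rule lborel_eqI)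
    fix l u :: complex assume le: "\<And>b. b \<in> Basis \<Longrightarrow> l \<bullet> b \<le> u \<bullet> b"
    have b: "Re l \<le> Re u" "Im l \<le> Im u" using le[of 1] le[of \<i>] by (auto simp: Basis_complex_def)
    have "(\<lambda>z::real\<times>real. Complex (fst z) (snd z)) -` box l u = box (Re l, Im l) (Re u, Im u)"
      by (auto simp: box_def Basis_complex_def Basis_prod_def)
    then have "emeasure (distr lborel borel (\<lambda>z. Complex (fst z) (snd z))) (box l u)
        = emeasure lborel (box (Re l, Im l) (Re u, Im u))"
      by (subst emeasure_distr) auto
    also have "\<dots> = (\<Prod>b\<in>Basis. (u - l) \<bullet> b)"
      using b by (subst emeasure_lborel_box)
        (auto simp: Basis_complex_def Basis_prod_def)
    finally show "emeasure (distr lborel borel (\<lambda>z. Complex (fst z) (snd z))) (box l u) = (\<Prod>b\<in>Basis. (u - l) \<bullet> b)" .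
  qed auto
  then have "integral\<^sup>N lborel f = integral\<^sup>N (distr (lborel :: (real \<times> real) measure) borel (\<lambda>z. Complex (fst z) (snd z))) f"
    by simp
  also have "\<dots> = integral\<^sup>N (lborel \<Otimes>\<^sub>M lborel) (\<lambda>z. f (Complex (fst z) (snd z)))"
    by (subst nn_integral_distr) (simp_all add: lborel_prod)
  also have "\<dots> = (\<integral>\<^sup>+x. \<integral>\<^sup>+y. f (Complex x y) \<partial>lborel \<partial>lborel)"
    by (subst lborel.nn_integral_fst[symmetric]) (simp_all add: lborel_prod)
  finally show ?thesis .
qed

text \<open>Substitute \<open>y = x t\<close>, then \<open>t = tan \<theta>\<close>, then \<open>x = r cos \<theta>\<close>.\<close>

lemma nn_integral_polar_right_half:
  fixes f :: "complex \<Rightarrow> ennreal"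
  assumes [measurable]: "f \<in> borel_measurable borel"
  shows "(\<integral>\<^sup>+z\<in>{z. 0 < Re z}. f z \<partial>lborel)
    = (\<integral>\<^sup>+\<theta>\<in>{-pi/2<..<pi/2}. (\<integral>\<^sup>+r\<in>{0<..}. f (complex_of_real r * cis \<theta>) * ennreal r \<partial>lborel) \<partial>lborel)"
proof -
  have [measurable]: "(\<lambda>z::real\<times>real. Complex (fst z) (snd z)) \<in> borel_measurable (borel \<Otimes>\<^sub>M borel)"
    by (simp add: borel_measurable_complex_iff)
  have [measurable]: "cis \<in> borel_measurable borel"
    by (intro borel_measurable_continuous_onI continuous_intros)
  have [measurable]: "Measurable.pred borel (\<lambda>z. 0 < Re z)" by measurable
  have C: "(\<lambda>p. Complex (g p) (h p)) \<in> borel_measurable M"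
    if [measurable]: "g \<in> borel_measurable M" "h \<in> borel_measurable M" for g h and M :: "'x measure"
    by (simp add: borel_measurable_complex_iff)
  note C[measurable]
  \<comment> \<open>The integral along the ray of slope \<open>t\<close>, with the factor that
    compensates the density introduced by \<open>arctan\<close>.\<close>
  define G where "G t = ennreal (1 + t\<^sup>2) * (\<integral>\<^sup>+x\<in>{0<..}. ennreal x * f (Complex x (x * t)) \<partial>lborel)" for t
  have [measurable]: "G \<in> borel_measurable borel" unfolding G_def by measurable
  have "(\<integral>\<^sup>+z\<in>{z. 0 < Re z}. f z \<partial>lborel)
      = (\<integral>\<^sup>+x. \<integral>\<^sup>+y. f (Complex x y) * indicator {0<..} x \<partial>lborel \<partial>lborel)"
    by (subst nn_integral_complex_Re_Im) (auto intro!: nn_integral_cong simp: indicator_def)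
  also have "\<dots> = (\<integral>\<^sup>+x. \<integral>\<^sup>+t. ennreal x * f (Complex x (x * t)) * indicator {0<..} x \<partial>lborel \<partial>lborel)"
  proof (rule nn_integral_cong)
    fix x :: real
    show "(\<integral>\<^sup>+y. f (Complex x y) * indicator {0<..} x \<partial>lborel) = (\<integral>\<^sup>+t. ennreal x * f (Complex x (x * t)) * indicator {0<..} x \<partial>lborel)"
    proof (cases "0 < x")
      case True
      then show ?thesis
        by (subst nn_integral_real_affine[where c = x and t = 0]) (auto simp: nn_integral_cmult[symmetric] mult_ac)
    qed auto
  qed
  also have "\<dots> = (\<integral>\<^sup>+t. \<integral>\<^sup>+x. ennreal x * f (Complex x (x * t)) * indicator {0<..} x \<partial>lborel \<partial>lborel)"
    by (rule lborel_pair.Fubini') measurable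
  also have "\<dots> = (\<integral>\<^sup>+t. G (tan (arctan t)) * ennreal (1 / (1 + t\<^sup>2)) \<partial>lborel)"
  proof (rule nn_integral_cong)
    fix t :: real
    have p: "0 < 1 + t\<^sup>2" by (simp add: add_pos_nonneg)
    have "ennreal (1 + t\<^sup>2) * ennreal (1 / (1 + t\<^sup>2)) = 1"
      using p by (subst ennreal_mult[symmetric]) auto
    then show "(\<integral>\<^sup>+x. ennreal x * f (Complex x (x * t)) * indicator {0<..} x \<partial>lborel) = G (tan (arctan t)) * ennreal (1 / (1 + t\<^sup>2))"
      unfolding tan_arctan G_def by (metis (no_types, lifting) mult.assoc mult.commute mult.right_neutral)
  qed
  also have "\<dots> = (\<integral>\<^sup>+\<theta>\<in>{-pi/2<..<pi/2}. G (tan \<theta>) \<partial>lborel)"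
    by (rule nn_integral_arctan[symmetric]) (simp add: tan_def[abs_def])
  also have "\<dots> = (\<integral>\<^sup>+\<theta>\<in>{-pi/2<..<pi/2}. (\<integral>\<^sup>+r\<in>{0<..}. f (complex_of_real r * cis \<theta>) * ennreal r \<partial>lborel) \<partial>lborel)"
  proof (rule nn_integral_cong)
    fix \<theta> :: real
    have "G (tan \<theta>) = (\<integral>\<^sup>+r\<in>{0<..}. f (complex_of_real r * cis \<theta>) * ennreal r \<partial>lborel)"
      if "\<theta> \<in> {-pi/2<..<pi/2}"
    proof -
      have c: "cos \<theta> > 0" using that by (intro cos_gt_zero_pi) auto
      \<comment> \<open>This factor cancels the squared cosine left by the substitution x = r cos
        \<theta>.\<close>
      have s: "1 + (tan \<theta>)\<^sup>2 = 1 / (cos \<theta>)\<^sup>2"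
        using c by (simp add: tan_sec power_inverse inverse_eq_divide power_one_over)
      have "(\<integral>\<^sup>+x\<in>{0<..}. ennreal x * f (Complex x (x * tan \<theta>)) \<partial>lborel)
          = ennreal (cos \<theta>) * (\<integral>\<^sup>+r. ennreal (cos \<theta> * r) * f (Complex (cos \<theta> * r) (cos \<theta> * r * tan \<theta>)) * indicator {0<..} (cos \<theta> * r) \<partial>lborel)"
        using c by (subst nn_integral_real_affine[where c = "cos \<theta>" and t = 0]) auto
      also have "\<dots> = ennreal (cos \<theta>) * (\<integral>\<^sup>+r. ennreal (cos \<theta>) * (f (complex_of_real r * cis \<theta>) * ennreal r * indicator {0<..} r) \<partial>lborel)"
      proof (rule arg_cong[where f = "\<lambda>X. ennreal (cos \<theta>) * X"], rule nn_integral_cong)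
        fix r :: real
        have "Complex (cos \<theta> * r) (cos \<theta> * r * tan \<theta>) = complex_of_real r * cis \<theta>"
          using c by (simp add: complex_eq_iff tan_def)
        moreover have "indicator {0<..} (cos \<theta> * r) = (indicator {0<..} r :: ennreal)"
          using c by (auto simp: indicator_def zero_less_mult_iff)
        ultimately show "ennreal (cos \<theta> * r) * f (Complex (cos \<theta> * r) (cos \<theta> * r * tan \<theta>)) * indicator {0<..} (cos \<theta> * r)
          = ennreal (cos \<theta>) * (f (complex_of_real r * cis \<theta>) * ennreal r * indicator {0<..} r)"
          using c by (auto simp: indicator_def ennreal_mult mult_ac zero_less_mult_iff)
      qed
      also have "\<dots> = ennreal ((cos \<theta>)\<^sup>2) * (\<integral>\<^sup>+r\<in>{0<..}. f (complex_of_real r * cis \<theta>) * ennreal r \<partial>lborel)"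
        using c by (subst nn_integral_cmult) (auto simp: power2_eq_square ennreal_mult mult_ac)
      finally have "G (tan \<theta>) = ennreal (1 / (cos \<theta>)\<^sup>2) * (ennreal ((cos \<theta>)\<^sup>2) * (\<integral>\<^sup>+r\<in>{0<..}. f (complex_of_real r * cis \<theta>) * ennreal r \<partial>lborel))"
        unfolding G_def s by simp
      moreover have "ennreal (1 / (cos \<theta>)\<^sup>2) * ennreal ((cos \<theta>)\<^sup>2) = 1"
        using c by (subst ennreal_mult[symmetric]) auto
      ultimately show ?thesis by (metis mult.assoc mult_1)
    qed
    then show "G (tan \<theta>) * indicator {- pi / 2<..<pi / 2} \<theta> =
         (\<integral>\<^sup>+r\<in>{0<..}. f (complex_of_real r * cis \<theta>) * ennreal r \<partial>lborel) * indicator {- pi / 2<..<pi / 2} \<theta>"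
      by (auto simp: indicator_def)
  qed
  finally show ?thesis .
qed

text \<open>Cut the interval at 0 and move the left piece by one period; the range of
  \<open>c\<close> ensures that a single cut suffices.\<close>

lemma nn_integral_period_shift:
  fixes g :: "real \<Rightarrow> ennreal"
  assumes [measurable]: "g \<in> borel_measurable borel"
    and per: "\<And>x. g (x + 2 * pi) = g x" and c: "c \<in> {-2*pi..0}"
  shows "(\<integral>\<^sup>+x\<in>{c..c + 2*pi}. g x \<partial>lborel) = (\<integral>\<^sup>+x\<in>{0..2*pi}. g x \<partial>lborel)"
proof -
  have "(\<integral>\<^sup>+x\<in>{c..c + 2*pi}. g x \<partial>lborel) = (\<integral>\<^sup>+x. g x * indicator {c..0} x + g x * indicator {0..c+2*pi} x \<partial>lborel)"
    by (intro nn_integral_cong_AE eventually_mono[OF AE_lborel_singleton[of 0]]) (use c in \<open>auto simp: indicator_def\<close>)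
  also have "\<dots> = (\<integral>\<^sup>+x\<in>{c..0}. g x \<partial>lborel) + (\<integral>\<^sup>+x\<in>{0..c+2*pi}. g x \<partial>lborel)"
    by (rule nn_integral_add) auto
  also have "(\<integral>\<^sup>+x\<in>{c..0}. g x \<partial>lborel) = (\<integral>\<^sup>+x\<in>{c+2*pi..2*pi}. g x \<partial>lborel)"
    by (subst (2) nn_integral_real_affine[where c = 1 and t = "2*pi"])
       (auto simp: add.commute[of "2*pi"] per indicator_def intro!: nn_integral_cong)
  also have "\<dots> + (\<integral>\<^sup>+x\<in>{0..c+2*pi}. g x \<partial>lborel) = (\<integral>\<^sup>+x. g x * indicator {c+2*pi..2*pi} x + g x * indicator {0..c+2*pi} x \<partial>lborel)"
    by (rule nn_integral_add[symmetric]) auto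
  also have "\<dots> = (\<integral>\<^sup>+x\<in>{0..2*pi}. g x \<partial>lborel)"
    by (intro nn_integral_cong_AE eventually_mono[OF AE_lborel_singleton[of "c+2*pi"]]) (use c in \<open>auto simp: indicator_def\<close>)
  finally show ?thesis .
qed

text \<open>The left half plane is the reflection of the right one, which adds \<pi> to the angle;
  the imaginary axis is a null set. The glued angular range of length 2 \<pi> is then shifted to
  [0, 2 \<pi>] by periodicity.\<close>

lemma nn_integral_polar:
  fixes f :: "complex \<Rightarrow> ennreal"
  assumes [measurable]: "f \<in> borel_measurable borel"
  shows "integral\<^sup>N lborel f
    = (\<integral>\<^sup>+r\<in>{0<..}. (\<integral>\<^sup>+\<theta>\<in>{0..2*pi}. f (complex_of_real r * cis \<theta>) \<partial>lborel) * ennreal r \<partial>lborel)"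
proof -
  have [measurable]: "cis \<in> borel_measurable borel"
    by (intro borel_measurable_continuous_onI continuous_intros)
  define h where "h \<theta> = (\<integral>\<^sup>+r\<in>{0<..}. f (complex_of_real r * cis \<theta>) * ennreal r \<partial>lborel)" for \<theta>
  have [measurable]: "h \<in> borel_measurable borel" unfolding h_def by measurable
  have hper: "h (\<theta> + 2 * pi) = h \<theta>" for \<theta> by (simp add: h_def cis_mult[symmetric])
  have minus: "integral\<^sup>N lborel g = (\<integral>\<^sup>+z. g (- z) \<partial>lborel)"
    if [measurable]: "g \<in> borel_measurable borel" for g :: "complex \<Rightarrow> ennreal"
    by (subst lborel_affine_euclidean[where c = "\<lambda>_. -1" and t = 0])
       (simp_all add: nn_integral_density nn_integral_distr sum_negf euclidean_representation)
  have AE: "AE z in (lborel :: complex measure). Re z \<noteq> 0"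
  proof -
    have "(\<integral>\<^sup>+z. indicator {z. Re z = 0} z \<partial>lborel) = (\<integral>\<^sup>+x. \<integral>\<^sup>+y. (indicator {0} x :: ennreal) \<partial>(lborel :: real measure) \<partial>(lborel :: real measure))"
      by (subst nn_integral_complex_Re_Im) (auto simp: indicator_def intro!: nn_integral_cong)
    also have "\<dots> = (\<integral>\<^sup>+x. 0 \<partial>(lborel :: real measure))"
      by (intro nn_integral_cong_AE eventually_mono[OF AE_lborel_singleton[of 0]]) auto
    finally show ?thesis by (intro AE_I[where N = "{z. Re z = 0}"]) auto
  qed
  have "integral\<^sup>N lborel f = (\<integral>\<^sup>+z. f z * indicator {z. 0 < Re z} z + f z * indicator {z. Re z < 0} z \<partial>lborel)"
    by (intro nn_integral_cong_AE eventually_mono[OF AE]) (auto simp: indicator_def)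
  also have "\<dots> = (\<integral>\<^sup>+z\<in>{z. 0 < Re z}. f z \<partial>lborel) + (\<integral>\<^sup>+z\<in>{z. Re z < 0}. f z \<partial>lborel)"
    by (rule nn_integral_add) auto
  also have "(\<integral>\<^sup>+z\<in>{z. Re z < 0}. f z \<partial>lborel) = (\<integral>\<^sup>+z\<in>{z. 0 < Re z}. f (- z) \<partial>lborel)"
    by (subst minus) (auto simp: indicator_def intro!: nn_integral_cong)
  also have "\<dots> = (\<integral>\<^sup>+\<theta>\<in>{-pi/2<..<pi/2}. h (\<theta> + pi) \<partial>lborel)"
    by (subst nn_integral_polar_right_half) (auto simp: h_def cis_mult[symmetric])
  also have "\<dots> = (\<integral>\<^sup>+\<theta>\<in>{pi/2<..<3*pi/2}. h \<theta> \<partial>lborel)"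
    by (subst (2) nn_integral_real_affine[where c = 1 and t = "pi"])
       (auto simp: add.commute indicator_def intro!: nn_integral_cong)
  also have "(\<integral>\<^sup>+z\<in>{z. 0 < Re z}. f z \<partial>lborel) = (\<integral>\<^sup>+\<theta>\<in>{-pi/2<..<pi/2}. h \<theta> \<partial>lborel)"
    by (subst nn_integral_polar_right_half) (auto simp: h_def)
  also have "\<dots> + (\<integral>\<^sup>+\<theta>\<in>{pi/2<..<3*pi/2}. h \<theta> \<partial>lborel)
      = (\<integral>\<^sup>+\<theta>. h \<theta> * indicator {-pi/2<..<pi/2} \<theta> + h \<theta> * indicator {pi/2<..<3*pi/2} \<theta> \<partial>lborel)"
    by (rule nn_integral_add[symmetric]) auto
  also have "\<dots> = (\<integral>\<^sup>+\<theta>\<in>{-pi/2..-pi/2+2*pi}. h \<theta> \<partial>lborel)"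
  proof (intro nn_integral_cong_AE)
    have "AE x in lborel. x \<noteq> -pi/2" "AE x in lborel. x \<noteq> pi/2" "AE x in lborel. x \<noteq> 3*pi/2"
      by (rule AE_lborel_singleton)+
    then show "AE \<theta> in lborel. h \<theta> * indicator {-pi/2<..<pi/2} \<theta> + h \<theta> * indicator {pi/2<..<3*pi/2} \<theta>
        = h \<theta> * indicator {-pi/2..-pi/2+2*pi} \<theta>"
      by eventually_elim (auto simp: indicator_def)
  qed
  also have "\<dots> = (\<integral>\<^sup>+\<theta>\<in>{0..2*pi}. h \<theta> \<partial>lborel)"
    by (rule nn_integral_period_shift) (auto simp: hper)
  also have "\<dots> = (\<integral>\<^sup>+\<theta>. \<integral>\<^sup>+r. f (complex_of_real r * cis \<theta>) * ennreal r * indicator {0<..} r * indicator {0..2*pi} \<theta> \<partial>lborel \<partial>lborel)"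
    unfolding h_def by (intro nn_integral_cong) (simp add: nn_integral_multc)
  also have "\<dots> = (\<integral>\<^sup>+r. \<integral>\<^sup>+\<theta>. f (complex_of_real r * cis \<theta>) * ennreal r * indicator {0<..} r * indicator {0..2*pi} \<theta> \<partial>lborel \<partial>lborel)"
    by (rule lborel_pair.Fubini') measurable
  also have "\<dots> = (\<integral>\<^sup>+r\<in>{0<..}. (\<integral>\<^sup>+\<theta>\<in>{0..2*pi}. f (complex_of_real r * cis \<theta>) \<partial>lborel) * ennreal r \<partial>lborel)"
  proof (rule nn_integral_cong)
    fix r :: real
    have "(\<integral>\<^sup>+\<theta>. f (complex_of_real r * cis \<theta>) * ennreal r * indicator {0<..} r * indicator {0..2*pi} \<theta> \<partial>lborel)
      = (\<integral>\<^sup>+\<theta>. f (complex_of_real r * cis \<theta>) * indicator {0..2*pi} \<theta> * (ennreal r * indicator {0<..} r) \<partial>lborel)"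
      by (simp add: mult_ac)
    also have "\<dots> = (\<integral>\<^sup>+\<theta>\<in>{0..2*pi}. f (complex_of_real r * cis \<theta>) \<partial>lborel) * (ennreal r * indicator {0<..} r)"
      by (rule nn_integral_multc) measurable
    finally show "(\<integral>\<^sup>+\<theta>. f (complex_of_real r * cis \<theta>) * ennreal r * indicator {0<..} r * indicator {0..2*pi} \<theta> \<partial>lborel)
      = (\<integral>\<^sup>+\<theta>\<in>{0..2*pi}. f (complex_of_real r * cis \<theta>) \<partial>lborel) * ennreal r * indicator {0<..} r"
      by (simp add: mult_ac)
  qed
  finally show ?thesis .
qed

section \<open>A weighted form of Hoelder's inequality\<close>

lemma epowr_ennreal: "0 \<le> x \<Longrightarrow> epowr (ennreal x) a = ennreal (x powr a)"
  by (simp add: epowr_def)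

lemma epowr_mono: "x \<le> y \<Longrightarrow> 0 \<le> a \<Longrightarrow> epowr x a \<le> epowr y a"
  by (cases x; cases y) (auto simp: epowr_def powr_mono2 top_unique)

lemma epowr_0 [simp]: "epowr 0 a = 0"
  by (simp add: epowr_def)

lemma epowr_epowr: "epowr (epowr x a) b = epowr x (a * b)"
  by (cases x) (simp_all add: epowr_def powr_powr)

lemma epowr_mult: "epowr (x * y) a = epowr x a * epowr y a" if "0 < a"
proof (cases "x = 0 \<or> y = 0")
  case False
  then show ?thesis
    by (cases x; cases y) (auto simp: epowr_def ennreal_mult_top ennreal_top_mult powr_mult ennreal_mult[symmetric])
qed auto

lemma epowr_1 [simp]: "epowr x 1 = x"
  by (cases x) (simp_all add: epowr_def)

lemma epowr_add: "epowr x (a + b) = epowr x a * epowr x b" if "0 < a" "0 < b"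
  by (cases x) (use that in \<open>auto simp: epowr_def powr_add ennreal_mult\<close>)

lemma borel_measurable_epowr [measurable (raw)]:
  assumes [measurable]: "f \<in> borel_measurable M"
  shows "(\<lambda>x. epowr (f x) a) \<in> borel_measurable M"
  unfolding epowr_def by measurable

text \<open>Young's inequality with a free parameter: equality holds at \<open>l = u\<close>, so a
  suitable constant \<open>l\<close> recovers Hoelder's inequality without loss.\<close>

lemma weighted_Young:
  fixes p u l :: real
  assumes "1 < p" "0 \<le> u" "0 < l"
  shows "u \<le> u powr p * (l powr (1 - p) / p) + l * (1 - 1 / p)"
proof (cases "u = 0")
  case False
  then have u: "0 < u" using assms by simp
  have "(u powr p * l powr (1 - p)) powr (1 / p) * l powr (1 - 1 / p) \<le> 1 / p * (u powr p * l powr (1 - p)) + (1 - 1 / p) * l"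
    using assms u by (intro Youngs_inequality_0) auto
  moreover have "(u powr p * l powr (1 - p)) powr (1 / p) * l powr (1 - 1 / p) = u"
    using assms u by (simp add: powr_mult powr_powr mult.assoc powr_add[symmetric] field_simps)
  ultimately show ?thesis by (simp add: mult_ac)
qed (use assms in auto)

text \<open>Hoelder's inequality for the measure W dM, with 1 as the second function and raised to
  the power \<open>p\<close>. In this form no conjugate exponent appears and infinite integrals are
  allowed, so that it can be applied before finiteness is known.\<close>

lemma nn_integral_Holder_weight:
  fixes F W :: "'a \<Rightarrow> real"
  assumes [measurable]: "F \<in> borel_measurable M" "W \<in> borel_measurable M"
    and nn: "\<And>x. 0 \<le> F x" "\<And>x. 0 \<le> W x" and p: "1 < p"
  shows "epowr (\<integral>\<^sup>+x. ennreal (F x * W x) \<partial>M) p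
    \<le> epowr (\<integral>\<^sup>+x. ennreal (W x) \<partial>M) (p - 1) * (\<integral>\<^sup>+x. ennreal (F x powr p * W x) \<partial>M)"
proof -
  define I where "I = (\<integral>\<^sup>+x. ennreal (F x powr p * W x) \<partial>M)"
  define B where "B = (\<integral>\<^sup>+x. ennreal (W x) \<partial>M)"
  define J where "J = (\<integral>\<^sup>+x. ennreal (F x * W x) \<partial>M)"
  have "epowr J p \<le> epowr B (p - 1) * I"
  proof (cases "I = 0 \<or> B = 0")
    case True
    \<comment> \<open>If one of the integrals on the right vanishes, so does the left side. With
      both nonzero, an infinite one makes the right side infinite.\<close>
    have "AE x in M. F x * W x = 0"
    proof (cases "I = 0")
      case True
      then have "AE x in M. ennreal (F x powr p * W x) = 0" unfolding I_def by (subst (asm) nn_integral_0_iff_AE) auto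
      then show ?thesis by eventually_elim (use nn in \<open>auto simp: mult_le_0_iff antisym\<close>)
    next
      case False
      then have "AE x in M. ennreal (W x) = 0" using True unfolding B_def by (subst (asm) nn_integral_0_iff_AE) auto
      then show ?thesis by eventually_elim (use nn in \<open>auto simp: antisym\<close>)
    qed
    then have "J = (\<integral>\<^sup>+x. 0 \<partial>M)" unfolding J_def by (intro nn_integral_cong_AE) auto
    then show ?thesis by simp
  next
    case False
    show ?thesis
    proof (cases "I = \<infinity> \<or> B = \<infinity>")
      case True
      then have "epowr B (p - 1) * I = \<infinity>"
        using False p by (cases B; cases I) (auto simp: epowr_def ennreal_mult_top ennreal_top_mult)
      then show ?thesis by simp
    next
      case fin: False
      obtain i where i: "I = ennreal i" "0 < i" using fin False by (cases I) (auto simp: less_le)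
      obtain b where b: "B = ennreal b" "0 < b" using fin False by (cases B) (auto simp: less_le)
      \<comment> \<open>The choice for which \<open>l powr p = i / b\<close>: the two terms of
        Young's inequality then combine to \<open>l * b\<close>.\<close>
      define l where "l = (i / b) powr (1 / p)"
      have l: "0 < l" using i b by (simp add: l_def)
      have "J \<le> (\<integral>\<^sup>+x. ennreal (l powr (1 - p) / p) * ennreal (F x powr p * W x) + ennreal (l * (1 - 1 / p)) * ennreal (W x) \<partial>M)"
        unfolding J_def
      proof (rule nn_integral_mono)
        fix x
        have "F x * W x \<le> (F x powr p * (l powr (1 - p) / p) + l * (1 - 1 / p)) * W x"
          using nn p l by (intro mult_right_mono weighted_Young)
        also have "\<dots> = l powr (1 - p) / p * (F x powr p * W x) + l * (1 - 1 / p) * W x"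
          by (simp add: algebra_simps)
        finally show "ennreal (F x * W x) \<le> ennreal (l powr (1 - p) / p) * ennreal (F x powr p * W x) + ennreal (l * (1 - 1 / p)) * ennreal (W x)"
          using nn p l by (simp add: ennreal_mult[symmetric] ennreal_plus[symmetric] del: ennreal_plus)
      qed
      also have "\<dots> = ennreal (l powr (1 - p) / p) * I + ennreal (l * (1 - 1 / p)) * B"
        by (simp add: nn_integral_add nn_integral_cmult I_def B_def)
      also have "\<dots> = ennreal (l powr (1 - p) / p * i + l * (1 - 1 / p) * b)"
        using i b l p by (simp add: ennreal_mult[symmetric] ennreal_plus[symmetric] del: ennreal_plus)
      also have "l powr (1 - p) / p * i + l * (1 - 1 / p) * b = l * b"
      proof -
        have "l powr p = i / b" using i b p by (simp add: l_def powr_powr)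
        then have "l powr (1 - p) * i = l * b" using l i b by (simp add: powr_diff)
        then show ?thesis using p by (simp add: field_simps)
      qed
      finally have "epowr J p \<le> epowr (ennreal (l * b)) p" using p by (intro epowr_mono) auto
      also have "\<dots> = ennreal ((l * b) powr p)" using l b by (simp add: epowr_ennreal)
      also have "(l * b) powr p = b powr (p - 1) * i"
        using l i b p by (simp add: powr_mult l_def powr_powr powr_diff)
      finally show ?thesis using i b by (simp add: epowr_ennreal ennreal_mult)
    qed
  qed
  then show ?thesis by (simp only: I_def B_def J_def)
qed

section \<open>Fourier series with summable coefficients\<close>

lemma borel_measurable_cis [measurable]: "cis \<in> borel_measurable borel"
  by (intro borel_measurable_continuous_onI continuous_intros)

definition fourier :: "(nat \<Rightarrow> complex) \<Rightarrow> real \<Rightarrow> complex" where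
  "fourier c \<theta> = (\<Sum>n. c n * cis \<theta> ^ n)"

lemma borel_measurable_fourier [measurable]: "fourier c \<in> borel_measurable borel"
  unfolding fourier_def[abs_def] by measurable

lemma summable_fourier: "summable (\<lambda>n. norm (c n)) \<Longrightarrow> summable (\<lambda>n. c n * cis \<theta> ^ n)"
  by (rule summable_norm_cancel) (simp add: norm_mult norm_power)

lemma norm_fourier_le: "summable (\<lambda>n. norm (c n)) \<Longrightarrow> norm (fourier c \<theta>) \<le> (\<Sum>n. norm (c n))"
  unfolding fourier_def using summable_norm[of "\<lambda>n. c n * cis \<theta> ^ n"]
  by (simp add: norm_mult norm_power)

lemma set_integrable_bounded_Icc:
  fixes g :: "real \<Rightarrow> 'b :: {banach, second_countable_topology}"
  assumes [measurable]: "g \<in> borel_measurable borel" and "\<And>x. x \<in> {a..b} \<Longrightarrow> norm (g x) \<le> B"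
  shows "set_integrable lborel {a..b} g"
  unfolding set_integrable_def
proof (rule Bochner_Integration.integrable_bound)
  show "integrable lborel (\<lambda>x::real. indicator {a..b} x * \<bar>B\<bar>)"
    by (intro integrable_mult_left integrable_real_indicator) (auto simp: emeasure_lborel_Icc_eq)
qed (use assms in \<open>auto simp: indicator_def intro!: AE_I2 order_trans[OF _ abs_ge_self]\<close>)

text \<open>Term-by-term integration, justified by the absolute summability of the coefficients.
  Kernels are always evaluated inside the unit disc, so this summability is available
  throughout.\<close>

lemma set_integral_fourier_times:
  fixes g :: "real \<Rightarrow> complex"
  assumes c: "summable (\<lambda>n. norm (c n))"
    and [measurable]: "g \<in> borel_measurable borel" and B: "\<And>x. x \<in> {a..b} \<Longrightarrow> norm (g x) \<le> B"
  shows "(LINT \<theta>:{a..b}|lborel. fourier c \<theta> * g \<theta>) = (\<Sum>n. c n * (LINT \<theta>:{a..b}|lborel. cis \<theta> ^ n * g \<theta>))"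
proof -
  let ?f = "\<lambda>n \<theta>. indicator {a..b} \<theta> *\<^sub>R (c n * cis \<theta> ^ n * g \<theta>)"
  have le: "norm (?f n \<theta>) \<le> indicator {a..b} \<theta> * (norm (c n) * \<bar>B\<bar>)" for n \<theta>
    using B[of \<theta>] by (auto simp: norm_mult norm_power indicator_def intro!: mult_left_mono)
  have s: "summable (\<lambda>n. norm (c n) * \<bar>B\<bar> * \<bar>b - a\<bar>)"
    using c by (intro summable_mult2)
  have int: "integrable lborel (?f n)" for n
    using set_integrable_bounded_Icc[of "\<lambda>\<theta>. c n * cis \<theta> ^ n * g \<theta>" a b "norm (c n) * \<bar>B\<bar>"] B
    by (force simp: set_integrable_def norm_mult norm_power intro!: mult_left_mono)
  have "(LINT \<theta>:{a..b}|lborel. fourier c \<theta> * g \<theta>) = (LINT \<theta>|lborel. (\<Sum>n. ?f n \<theta>))"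
    unfolding set_lebesgue_integral_def fourier_def
    using summable_fourier[OF c]
    by (intro Bochner_Integration.integral_cong refl) (simp add: suminf_mult2 suminf_scaleR_right summable_mult2)
  also have "\<dots> = (\<Sum>n. integral\<^sup>L lborel (?f n))"
  proof (rule integral_suminf)
    show "AE x in lborel. summable (\<lambda>n. norm (?f n x))"
    proof (rule AE_I2)
      fix x
      show "summable (\<lambda>n. norm (?f n x))"
        by (rule summable_comparison_test'[where N = 0, OF summable_mult[OF summable_mult2[OF c]]])
           (use le in \<open>simp only: real_norm_def abs_norm_cancel\<close>)
    qed
    show "summable (\<lambda>n. LINT x|lborel. norm (?f n x))"
    proof (rule summable_comparison_test'[where N = 0, OF s])
      fix n
      have "(LINT x|lborel. norm (?f n x)) \<le> (LINT x:{a..b}|lborel. norm (c n) * \<bar>B\<bar>)"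
        unfolding set_lebesgue_integral_def
        using integrable_norm[OF int] le
        by (intro integral_mono) (auto intro!: integrable_mult_left integrable_real_indicator simp: emeasure_lborel_Icc_eq simp del: norm_scaleR)
      also have "\<dots> \<le> norm (c n) * \<bar>B\<bar> * \<bar>b - a\<bar>"
        by (subst set_integral_const)
           (auto simp: emeasure_lborel_Icc_eq measure_def mult_ac intro!: mult_left_mono)
      finally show "norm (LINT x|lborel. norm (?f n x)) \<le> norm (c n) * \<bar>B\<bar> * \<bar>b - a\<bar>"
        by simp
    qed
  qed (rule int)
  also have "\<dots> = (\<Sum>n. c n * (LINT \<theta>:{a..b}|lborel. cis \<theta> ^ n * g \<theta>))"
  proof (rule suminf_cong)
    fix n
    have "?f n = (\<lambda>\<theta>. c n * (indicator {a..b} \<theta> *\<^sub>R (cis \<theta> ^ n * g \<theta>)))"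
      by (rule ext) (simp only: mult_scaleR_right mult.assoc)
    then show "integral\<^sup>L lborel (?f n) = c n * (LINT \<theta>:{a..b}|lborel. cis \<theta> ^ n * g \<theta>)"
      unfolding set_lebesgue_integral_def by (simp only: integral_mult_right_zero)
  qed
  finally show ?thesis .
qed

lemma set_integral_cis_int:
  "(LINT \<theta>:{0..2*pi}|lborel. cis (real_of_int k * \<theta>)) = (if k = 0 then complex_of_real (2 * pi) else 0)"
proof (cases "k = 0")
  case False
  have "((\<lambda>\<theta>. cis (real_of_int k * \<theta>)) has_integral
      (cis (real_of_int k * (2*pi)) / (\<i> * of_int k) - cis (real_of_int k * 0) / (\<i> * of_int k))) {0..2*pi}"
    using False
  proof (intro fundamental_theorem_of_calculus)
    fix \<theta> :: real
    have "((\<lambda>z. exp (\<i> * of_int k * z) / (\<i> * of_int k)) has_field_derivative exp (\<i> * of_int k * z)) (at z)" for z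
      by (rule derivative_eq_intros refl | use False in simp)+
    from has_vector_derivative_real_field[OF this]
    show "((\<lambda>\<theta>. cis (real_of_int k * \<theta>) / (\<i> * of_int k)) has_vector_derivative cis (real_of_int k * \<theta>)) (at \<theta> within {0..2*pi})"
      by (simp only: cis_conv_exp of_real_mult of_real_of_int_eq mult.assoc)
  qed simp
  moreover have "cis (real_of_int k * (2*pi)) = 1"
    by (metis cis_multiple_2pi Ints_of_int mult.commute mult.assoc mult_2)
  ultimately have "integral {0..2*pi} (\<lambda>\<theta>. cis (real_of_int k * \<theta>)) = 0"
    by (simp add: integral_unique)
  moreover have "set_integrable lborel {0..2*pi} (\<lambda>\<theta>. cis (real_of_int k * \<theta>))"
    by (rule set_integrable_bounded_Icc[where B = 1]) auto
  ultimately show ?thesis using False by (simp add: set_borel_integral_eq_integral(2))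
qed (simp add: set_lebesgue_integral_def scaleR_conv_of_real)

text \<open>Parseval: only one of the two factors is expanded, and the conjugate of the other serves
  as the bounded test function. Its coefficients follow from the same termwise integration and
  orthogonality.\<close>

lemma set_integral_norm_fourier_sq:
  assumes c: "summable (\<lambda>n. norm (c n))"
  shows "(LINT \<theta>:{0..2*pi}|lborel. (cmod (fourier c \<theta>))\<^sup>2) = 2 * pi * (\<Sum>n. (cmod (c n))\<^sup>2)"
proof -
  let ?S = "\<Sum>n. norm (c n)"
  have b: "norm (c n) \<le> ?S" for n using sum_le_suminf[OF c, of "{n}"] by simp
  have sq: "summable (\<lambda>n. (cmod (c n))\<^sup>2)"
    by (rule summable_comparison_test'[where N = 0, OF summable_mult[OF c, of ?S]])
       (use b in \<open>simp add: power2_eq_square mult_right_mono\<close>)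
  have coef: "(LINT \<theta>:{0..2*pi}|lborel. cis \<theta> ^ n * cnj (fourier c \<theta>)) = complex_of_real (2 * pi) * cnj (c n)" for n
  proof -
    have "(LINT \<theta>:{0..2*pi}|lborel. fourier c \<theta> * cnj (cis \<theta> ^ n))
       = (\<Sum>m. c m * (LINT \<theta>:{0..2*pi}|lborel. cis \<theta> ^ m * cnj (cis \<theta> ^ n)))"
      by (rule set_integral_fourier_times[where B = 1]) (simp_all add: c norm_power borel_measurable_continuous_onI continuous_intros)
    also have "\<dots> = (\<Sum>m. c m * (if m = n then complex_of_real (2 * pi) else 0))"
    proof -
      have "cis \<theta> ^ m * cnj (cis \<theta> ^ n) = cis (real_of_int (int m - int n) * \<theta>)" for m \<theta>
        by (simp add: Complex.DeMoivre cis_cnj cis_mult algebra_simps)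
      then show ?thesis by (simp only: set_integral_cis_int) simp
    qed
    also have "\<dots> = c n * complex_of_real (2 * pi)"
      by (subst suminf_finite[where N = "{n}"]) auto
    finally have eq: "(LINT \<theta>:{0..2*pi}|lborel. fourier c \<theta> * cnj (cis \<theta> ^ n)) = c n * complex_of_real (2 * pi)" .
    have "(LINT \<theta>:{0..2*pi}|lborel. cis \<theta> ^ n * cnj (fourier c \<theta>))
        = cnj (LINT \<theta>:{0..2*pi}|lborel. fourier c \<theta> * cnj (cis \<theta> ^ n))"
      unfolding set_lebesgue_integral_def by (subst Bochner_Integration.integral_cnj[symmetric]) (simp add: mult.commute)
    then show ?thesis unfolding eq by simp
  qed
  have "complex_of_real (LINT \<theta>:{0..2*pi}|lborel. (cmod (fourier c \<theta>))\<^sup>2)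
      = (LINT \<theta>:{0..2*pi}|lborel. fourier c \<theta> * cnj (fourier c \<theta>))"
    by (simp only: complex_norm_square[symmetric] set_integral_complex_of_real)
  also have "\<dots> = (\<Sum>n. c n * (LINT \<theta>:{0..2*pi}|lborel. cis \<theta> ^ n * cnj (fourier c \<theta>)))"
    by (rule set_integral_fourier_times[where B = ?S])
       (auto simp: c norm_fourier_le intro!: measurable_compose[OF borel_measurable_fourier
         borel_measurable_continuous_onI[OF continuous_on_cnj[OF continuous_on_id]], simplified])
  also have "\<dots> = (\<Sum>n. complex_of_real (2 * pi * (cmod (c n))\<^sup>2))"
    unfolding coef by (simp only: of_real_mult complex_norm_square mult_ac)
  also have "\<dots> = complex_of_real (\<Sum>n. 2 * pi * (cmod (c n))\<^sup>2)"
    by (rule suminf_of_real[symmetric], rule summable_mult, rule sq)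
  finally have "(LINT \<theta>:{0..2*pi}|lborel. (cmod (fourier c \<theta>))\<^sup>2) = (\<Sum>n. 2 * pi * (cmod (c n))\<^sup>2)"
    by (simp only: of_real_eq_iff)
  also have "\<dots> = 2 * pi * (\<Sum>n. (cmod (c n))\<^sup>2)"
    by (rule suminf_mult) (rule sq)
  finally show ?thesis .
qed

text \<open>For nonnegative coefficients, Hardy's inequality follows by pairing with the function
  \<open>\<pi> - \<theta>\<close>, whose Fourier coefficients are \<open>1 / (\<i> n)\<close> up to sign.\<close>

lemma Hardy_inequality_nonneg:
  fixes c :: "nat \<Rightarrow> real"
  assumes c: "summable c" and nn: "\<And>n. 0 \<le> c n"
  shows "2 * (\<Sum>n. c n / real (n + 1)) \<le> (LINT \<theta>:{0..2*pi}|lborel. cmod (fourier (\<lambda>n. complex_of_real (c n)) \<theta>))"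
proof -
  \<comment> \<open>The factor \<open>cis \<theta>\<close> raises the frequency from
    \<open>n\<close> to \<open>n + 1\<close>. This avoids the vanishing zeroth coefficient of the
    sawtooth and yields the denominators \<open>n + 1\<close>, while the modulus stays at most
    \<pi>.\<close>
  let ?f = "fourier (\<lambda>n. complex_of_real (c n))" and ?h = "\<lambda>\<theta>. cis \<theta> * complex_of_real (pi - \<theta>)"
  have sc: "summable (\<lambda>n. norm (complex_of_real (c n)))" using c nn by simp
  have coef: "(LINT \<theta>:{0..2*pi}|lborel. cis \<theta> ^ n * ?h \<theta>) = complex_of_real (2 * pi / real (n + 1)) * \<i>" for n
  proof -
    define k where "k = of_nat (n + 1) * \<i>"
    have k: "k \<noteq> 0" unfolding k_def by (simp del: of_nat_Suc of_nat_add)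
    have e: "cis \<theta> ^ n * ?h \<theta> = exp (k * of_real \<theta>) * (of_real pi - of_real \<theta>)" for \<theta>
    proof -
      have "cis \<theta> ^ n * cis \<theta> = cis (real (n + 1) * \<theta>)" by (simp only: Complex.DeMoivre cis_mult) (simp add: algebra_simps)
      also have "\<dots> = exp (k * of_real \<theta>)" by (simp only: k_def cis_conv_exp of_real_mult of_real_of_nat_eq mult_ac)
      finally show ?thesis by (simp only: mult.assoc[symmetric] of_real_diff)
    qed
    have D: "((\<lambda>z. exp (k * z) * (of_real pi - z) / k + exp (k * z) / k\<^sup>2) has_field_derivative
        exp (k * z) * (of_real pi - z)) (at z)" for z
    proof -
      have 1: "((\<lambda>z. exp (k * z)) has_field_derivative exp (k * z) * k) (at z)"
        by (auto intro!: derivative_eq_intros)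
      have 2: "((\<lambda>z. of_real pi - z) has_field_derivative - 1) (at z)"
        by (auto intro!: derivative_eq_intros)
      show ?thesis
        by (rule DERIV_cong[OF DERIV_add[OF DERIV_cdivide[OF DERIV_mult[OF 1 2]] DERIV_cdivide[OF 1]]])
           (use k in \<open>simp add: field_simps power2_eq_square\<close>)
    qed
    have d: "((\<lambda>\<theta>::real. exp (k * of_real \<theta>) * (of_real pi - of_real \<theta>) / k + exp (k * of_real \<theta>) / k\<^sup>2)
        has_vector_derivative exp (k * of_real \<theta>) * (of_real pi - of_real \<theta>)) (at \<theta> within {0..2*pi})" for \<theta> :: real
      using has_vector_derivative_real_field[OF D[of "of_real \<theta>"]] .
    have p: "exp (k * of_real (2 * pi)) = 1"
      using exp_integer_2pi[of "of_nat (n + 1)"] by (simp add: k_def mult_ac del: of_nat_Suc of_nat_add)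
    have "((\<lambda>\<theta>::real. exp (k * of_real \<theta>) * (of_real pi - of_real \<theta>)) has_integral
       ((exp (k * of_real (2*pi)) * (of_real pi - of_real (2*pi)) / k + exp (k * of_real (2*pi)) / k\<^sup>2)
        - (exp (k * of_real 0) * (of_real pi - of_real 0) / k + exp (k * of_real 0) / k\<^sup>2))) {0..2*pi}"
      by (rule fundamental_theorem_of_calculus) (use d in auto)
    then have "integral {0..2*pi} (\<lambda>\<theta>::real. exp (k * of_real \<theta>) * (of_real pi - of_real \<theta>)) = - (2 * of_real pi) / k"
      unfolding p by (intro integral_unique) (simp add: diff_divide_distrib)
    also have "\<dots> = complex_of_real (2 * pi / real (n + 1)) * \<i>"
    proof -
      have "- (2 * of_real pi) / (of_nat (n + 1) * \<i>) = complex_of_real (2 * pi) / of_nat (n + 1) * \<i>"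
        by (simp add: divide_inverse mult_ac del: of_nat_Suc of_nat_add)
      then show ?thesis by (simp add: k_def del: of_nat_Suc of_nat_add)
    qed
    finally have "integral {0..2*pi} (\<lambda>\<theta>. cis \<theta> ^ n * ?h \<theta>) = complex_of_real (2 * pi / real (n + 1)) * \<i>"
      unfolding e .
    moreover have "set_integrable lborel {0..2*pi} (\<lambda>\<theta>. cis \<theta> ^ n * ?h \<theta>)"
      by (rule set_integrable_bounded_Icc[where B = pi]) (auto simp: norm_mult norm_power abs_le_iff simp flip: of_real_diff)
    ultimately show ?thesis by (simp only: set_borel_integral_eq_integral(2))
  qed
  have sd: "summable (\<lambda>n. c n / real (n + 1))"
    by (rule summable_comparison_test'[where N = 0, OF c]) (use nn in \<open>simp add: divide_le_eq ring_distribs\<close>)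
  have hb: "norm (?h \<theta>) \<le> pi" if "\<theta> \<in> {0..2*pi}" for \<theta>
    using that by (auto simp: norm_mult abs_le_iff simp flip: of_real_diff)
  have "(LINT \<theta>:{0..2*pi}|lborel. ?f \<theta> * ?h \<theta>) = (\<Sum>n. complex_of_real (c n) * (complex_of_real (2 * pi / real (n + 1)) * \<i>))"
    unfolding coef[symmetric] by (rule set_integral_fourier_times[where B = pi]) (use sc hb in auto)
  also have "\<dots> = (\<Sum>n. (2 * pi * \<i>) * complex_of_real (c n / real (n + 1)))"
    by (intro suminf_cong) (simp add: mult_ac del: of_nat_Suc of_nat_add)
  also have "\<dots> = 2 * pi * \<i> * complex_of_real (\<Sum>n. c n / real (n + 1))"
    unfolding suminf_of_real[OF sd] by (rule suminf_mult) (rule summable_of_real[OF sd])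
  finally have eq: "(LINT \<theta>:{0..2*pi}|lborel. ?f \<theta> * ?h \<theta>) = 2 * pi * \<i> * complex_of_real (\<Sum>n. c n / real (n + 1))" .
  have fb: "norm (?f \<theta>) \<le> (\<Sum>n. norm (complex_of_real (c n)))" for \<theta> by (rule norm_fourier_le[OF sc])
  have mf: "?f \<in> borel_measurable borel" and mh: "?h \<in> borel_measurable borel"
    by measurable
  have i1: "set_integrable lborel {0..2*pi} (\<lambda>\<theta>. ?f \<theta> * ?h \<theta>)"
  proof (rule set_integrable_bounded_Icc)
    fix \<theta> :: real assume "\<theta> \<in> {0..2*pi}"
    then show "norm (?f \<theta> * ?h \<theta>) \<le> (\<Sum>n. norm (complex_of_real (c n))) * pi"
      unfolding norm_mult[of "?f \<theta>"] by (intro mult_mono fb hb suminf_nonneg sc norm_ge_zero)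
  qed (intro borel_measurable_times mf mh)
  have i2: "set_integrable lborel {0..2*pi} (\<lambda>\<theta>. pi * cmod (?f \<theta>))"
    by (rule set_integrable_bounded_Icc[where B = "pi * (\<Sum>n. norm (complex_of_real (c n)))"])
       (use fb in \<open>auto intro!: mult_left_mono\<close>)
  have "2 * pi * (\<Sum>n. c n / real (n + 1)) = cmod (LINT \<theta>:{0..2*pi}|lborel. ?f \<theta> * ?h \<theta>)"
    unfolding eq using suminf_nonneg[OF sd] nn by (simp add: norm_mult)
  also have "\<dots> \<le> (LINT \<theta>:{0..2*pi}|lborel. cmod (?f \<theta> * ?h \<theta>))"
    using set_integral_norm_bound[OF i1] .
  also have "\<dots> \<le> (LINT \<theta>:{0..2*pi}|lborel. pi * cmod (?f \<theta>))"
  proof (rule set_integral_mono[OF set_integrable_norm[OF i1] i2])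
    fix \<theta> :: real assume "\<theta> \<in> {0..2*pi}"
    then show "cmod (?f \<theta> * ?h \<theta>) \<le> pi * cmod (?f \<theta>)"
      using mult_right_mono[OF hb, of \<theta> "cmod (?f \<theta>)"] by (simp only: norm_mult[of "?f \<theta>"] mult.commute norm_ge_zero)
  qed
  also have "\<dots> = pi * (LINT \<theta>:{0..2*pi}|lborel. cmod (?f \<theta>))"
    by simp
  finally show ?thesis by (simp add: mult_ac)
qed

section \<open>Moments of doubling weights\<close>

locale radial =
  fixes w :: "real \<Rightarrow> real"
  assumes radial_weight: "radial_weight w"
begin

abbreviation H :: "real \<Rightarrow> real" where "H \<equiv> omega_hat w"

text \<open>Only the product of \<open>w\<close> with the indicator is known to be measurable on the
  line; outside [0,1) the profile \<open>w\<close> is arbitrary.\<close>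

definition W :: "real \<Rightarrow> real" where
  "W s = indicator {0..<1} s * w s"

definition \<mu> :: "real measure" where
  "\<mu> = density lborel (\<lambda>s. ennreal (W s))"

lemma borel_measurable_W [measurable]: "W \<in> borel_measurable borel"
  using radial_weight
  by (auto simp: W_def[abs_def] radial_weight_def set_integrable_def dest: borel_measurable_integrable)

lemma W_nonneg: "0 \<le> W s"
  using radial_weight by (auto simp: W_def radial_weight_def indicator_def)

lemma integrable_W: "integrable lborel W"
  using radial_weight by (simp add: W_def[abs_def] radial_weight_def set_integrable_def)

lemma sets_mu [simp, measurable_cong]: "sets \<mu> = sets borel" and space_mu [simp]: "space \<mu> = UNIV"
  by (simp_all add: \<mu>_def)

lemma nn_integral_mu:
  "f \<in> borel_measurable borel \<Longrightarrow> integral\<^sup>N \<mu> f = (\<integral>\<^sup>+s. f s * ennreal (W s) \<partial>lborel)"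
  unfolding \<mu>_def by (subst nn_integral_density) (auto simp: mult.commute)

lemma integral_mu:
  fixes f :: "real \<Rightarrow> real"
  assumes "f \<in> borel_measurable borel"
  shows "integral\<^sup>L \<mu> f = (LINT s:{0..<1}|lborel. f s * w s)"
  unfolding \<mu>_def using assms
  by (subst integral_density) (auto simp: W_nonneg set_lebesgue_integral_def, simp add: W_def mult_ac)

lemma AE_mu: "AE s in \<mu>. 0 \<le> s \<and> s < 1"
proof -
  have "0 < ennreal (W s) \<longrightarrow> 0 \<le> s \<and> s < 1" for s
    by (auto simp: W_def indicator_def split: if_splits)
  then show ?thesis unfolding \<mu>_def by (subst AE_density) auto
qed

lemma finite_measure_mu: "finite_measure \<mu>"
proof
  have "(\<integral>\<^sup>+s. ennreal (W s) \<partial>lborel) < \<infinity>"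
    using integrable_W W_nonneg by (simp add: integrable_iff_bounded)
  then show "emeasure \<mu> (space \<mu>) \<noteq> \<infinity>"
    by (simp add: \<mu>_def emeasure_density)
qed

sublocale mu: finite_measure \<mu> by (rule finite_measure_mu)

lemma integrable_mu:
  fixes f :: "real \<Rightarrow> real"
  assumes "f \<in> borel_measurable borel" "\<And>s. 0 \<le> s \<Longrightarrow> s < 1 \<Longrightarrow> \<bar>f s\<bar> \<le> B"
  shows "integrable \<mu> f"
  by (rule mu.integrable_const_bound[where B = B]) (use assms AE_mu in auto)

lemma H_eq: "0 \<le> r \<Longrightarrow> H r = measure \<mu> {r..}"
proof -
  assume r: "0 \<le> r"
  have "measure \<mu> {r..} = (LINT s|\<mu>. indicator {r..} s)" by simp
  also have "\<dots> = H r"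
    using r unfolding omega_hat_def
    by (subst integral_mu)
       (auto simp: set_lebesgue_integral_def indicator_def intro!: Bochner_Integration.integral_cong)
  finally show ?thesis by simp
qed

lemma H_antimono: "0 \<le> r \<Longrightarrow> r \<le> s \<Longrightarrow> H s \<le> H r"
  by (auto simp: H_eq intro!: mu.finite_measure_mono)

lemma H_pos: "0 \<le> r \<Longrightarrow> r < 1 \<Longrightarrow> 0 < H r"
  using radial_weight by (auto simp: radial_weight_def)

lemma moment_eq: "moment w m = (LINT s|\<mu>. s ^ m)"
  unfolding moment_def by (subst integral_mu) auto

lemma integrable_power_mu: "integrable \<mu> (\<lambda>s. s ^ m)"
  by (rule integrable_mu[where B = 1]) (auto simp: power_le_one)

lemma moment_antimono: "m \<le> n \<Longrightarrow> moment w n \<le> moment w m"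
  unfolding moment_eq
  by (rule integral_mono_AE[OF integrable_power_mu integrable_power_mu])
     (use AE_mu in eventually_elim, auto intro: power_decreasing)

text \<open>The mass on [u, 1) alone already contributes this much to the moment. No doubling is
  involved, so this half of the comparison holds for every radial weight.\<close>

lemma power_mult_H_le_moment: "0 \<le> u \<Longrightarrow> u ^ m * H u \<le> moment w m"
proof -
  assume u: "0 \<le> u"
  have "u ^ m * H u = (LINT s|\<mu>. u ^ m * indicator {u..} s)" using u by (simp add: H_eq)
  also have "\<dots> \<le> moment w m" unfolding moment_eq
  proof (rule integral_mono_AE[OF _ integrable_power_mu])
    show "integrable \<mu> (\<lambda>s. u ^ m * indicator {u..} s)"
      by (rule integrable_mu[where B = "u ^ m"]) (use u in \<open>auto simp: indicator_def\<close>)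
    show "AE s in \<mu>. u ^ m * indicator {u..} s \<le> s ^ m"
      using AE_mu by eventually_elim (use u in \<open>auto simp: indicator_def power_mono\<close>)
  qed
  finally show ?thesis .
qed

lemma moment_pos: "0 < moment w m"
proof -
  have "0 < (1/2) ^ m * H (1/2)" using H_pos[of "1/2"] by simp
  also have "\<dots> \<le> moment w m" by (rule power_mult_H_le_moment) simp
  finally show ?thesis .
qed

text \<open>The points \<open>u ^ (2 ^ j)\<close> divide (0,1) into layers. Where \<open>s\<close>
  lies between two consecutive points, its power is at most the corresponding power of
  \<open>u ^ m\<close>, which decays doubly exponentially in \<open>j\<close>.\<close>

lemma power_le_layers:
  fixes u s :: real
  assumes "0 < u" "u < 1" "0 \<le> s" "s < 1"
  shows "s ^ m \<le> indicator {u..} s + (\<Sum>j<J. (u ^ m) ^ (2 ^ j) * indicator {u ^ (2 ^ Suc j)..} s) + (u ^ m) ^ (2 ^ J)"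
proof (induction J)
  case 0
  then show ?case using assms
    by (cases "u \<le> s") (auto simp: indicator_def power_le_one add_increasing2 intro: power_mono)
next
  case (Suc J)
  show ?case
  proof (cases "u ^ 2 ^ Suc J \<le> s")
    case True
    have "0 \<le> (u ^ m) ^ 2 ^ Suc J" using assms by simp
    then show ?thesis using True Suc by (simp only: sum.lessThan_Suc indicator_simps atLeast_iff mult_1_right)
  next
    case False
    then have "s ^ m \<le> (u ^ 2 ^ Suc J) ^ m" using assms by (intro power_mono) auto
    also have "\<dots> = (u ^ m) ^ 2 ^ Suc J" by (simp add: power_mult[symmetric] mult.commute)
    finally show ?thesis using assms by (intro add_increasing) (auto intro!: sum_nonneg add_nonneg_nonneg)
  qed
qed

end

text \<open>Doubling loses a factor \<open>C\<close> per layer, which the doubly exponential decay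
  of the layers absorbs: consecutive terms have ratio \<open>C * (1/2) ^ (2 ^ n)\<close>.\<close>

lemma summable_power_half_double_power:
  fixes C :: real
  assumes "0 \<le> C"
  shows "summable (\<lambda>j. C ^ Suc j * (1/2) ^ (2 ^ j))"
proof -
  \<comment> \<open>From this index on, \<open>2 * C \<le> 2 ^ N \<le> 2 ^ (2 ^ n)\<close>, so the
    ratio of consecutive terms is at most 1/2.\<close>
  obtain N :: nat where N: "2 * C \<le> 2 ^ N"
    using real_arch_pow[of 2 "2 * C"] by (auto intro: less_imp_le)
  show ?thesis
  proof (rule summable_ratio_test[where c = "1/2" and N = N])
    fix n assume "N \<le> n"
    then have "N \<le> 2 ^ n" by (meson less_exp less_imp_le order_trans)
    then have "2 * C \<le> 2 ^ (2 ^ n)" using N by (meson one_le_numeral order_trans power_increasing)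
    then have "C * (1/2) ^ (2 ^ n) \<le> 1/2" by (simp add: field_simps)
    then have "C ^ Suc n * (1/2) ^ 2 ^ n * (C * (1/2) ^ (2 ^ n)) \<le> C ^ Suc n * (1/2) ^ 2 ^ n * (1/2)"
      using assms by (intro mult_left_mono) auto
    moreover have "C ^ Suc (Suc n) * (1/2) ^ 2 ^ Suc n = C ^ Suc n * (1/2) ^ 2 ^ n * (C * (1/2) ^ (2 ^ n))"
      by (simp add: power_add mult_2 mult_ac)
    ultimately have "C ^ Suc (Suc n) * (1/2) ^ 2 ^ Suc n \<le> 1/2 * (C ^ Suc n * (1/2) ^ 2 ^ n)"
      by (simp only: mult.commute[of "1/2"])
    moreover have nn: "norm (C ^ Suc m * (1/2) ^ 2 ^ m) = C ^ Suc m * (1/2) ^ 2 ^ m" for m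
      using assms unfolding real_norm_def by (intro abs_of_nonneg) simp
    ultimately show "norm (C ^ Suc (Suc n) * (1/2) ^ 2 ^ Suc n) \<le> 1/2 * norm (C ^ Suc n * (1/2) ^ 2 ^ n)"
      by (simp only: nn)
  qed simp
qed

section \<open>Upper moment bounds under the doubling condition\<close>

locale doubling = radial +
  fixes C :: real
  assumes C_ge_1: "1 \<le> C"
    and doubling: "\<And>r. 0 \<le> r \<Longrightarrow> r < 1 \<Longrightarrow> H r \<le> C * H ((1 + r) / 2)"
begin

text \<open>Squaring a point of [0,1) at most doubles its distance from 1, so one doubling step
  covers it.\<close>

lemma H_square_le: "0 \<le> u \<Longrightarrow> u < 1 \<Longrightarrow> H (u\<^sup>2) \<le> C * H u"
proof -
  assume u: "0 \<le> u" "u < 1"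
  have "u \<le> (1 + u\<^sup>2) / 2" using sum_squares_bound[of 1 u] by simp
  then have "H ((1 + u\<^sup>2) / 2) \<le> H u" using u by (intro H_antimono)
  moreover have "H (u\<^sup>2) \<le> C * H ((1 + u\<^sup>2) / 2)" using u by (intro doubling) (auto simp: power_less_one_iff)
  ultimately show ?thesis using C_ge_1 by (meson mult_left_mono order_trans zero_le_one)
qed

lemma H_power_le: "0 \<le> u \<Longrightarrow> u < 1 \<Longrightarrow> H (u ^ (2 ^ j)) \<le> C ^ j * H u"
proof (induction j)
  case (Suc j)
  have "H (u ^ 2 ^ Suc j) = H ((u ^ 2 ^ j)\<^sup>2)" by (simp add: power_mult[symmetric] mult.commute)
  also have "\<dots> \<le> C * H (u ^ 2 ^ j)" using Suc by (intro H_square_le) (auto simp: power_less_one_iff)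
  also have "\<dots> \<le> C * (C ^ j * H u)" using Suc C_ge_1 by (intro mult_left_mono) auto
  finally show ?case by simp
qed simp

text \<open>The converse of \<open>power_mult_H_le_moment\<close>. Integrate the layer bound:
  \<open>u ^ m \<le> 1/2\<close> makes the weight of layer \<open>j\<close> at most
  \<open>(1/2) ^ (2 ^ j)\<close>, doubling bounds its mass by \<open>C ^ Suc j * H u\<close>, and
  the remainder tends to 0 with the number of layers.\<close>

lemma moment_le_H: "\<exists>C'>0. \<forall>u m. 0 < u \<longrightarrow> u < 1 \<longrightarrow> u ^ m \<le> 1/2 \<longrightarrow> moment w m \<le> C' * H u"
proof -
  let ?t = "\<lambda>j. C ^ Suc j * (1/2 :: real) ^ (2 ^ j)"
  have sm: "summable ?t" using C_ge_1 by (intro summable_power_half_double_power) simp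
  have t0: "0 \<le> ?t j" for j using C_ge_1 by simp
  have "moment w m \<le> (1 + suminf ?t) * H u" if u: "0 < u" "u < 1" and um: "u ^ m \<le> 1/2" for u m
  proof -
    have "moment w m \<le> (1 + suminf ?t) * H u + (1/2) ^ (2 ^ J) * measure \<mu> UNIV" for J
    proof -
      let ?i = "\<lambda>s. indicator {u..} s + (\<Sum>j<J. (1/2) ^ (2 ^ j) * indicator {u ^ (2 ^ Suc j)..} s) + (1/2 :: real) ^ (2 ^ J)"
      have pw: "(u ^ m) ^ n \<le> (1/2) ^ n" for n using u um by (intro power_mono) auto
      have ind: "integrable \<mu> (indicator A :: real \<Rightarrow> real)" if "A \<in> sets borel" for A
        by (rule mu.integrable_const_bound[where B = 1]) (use that in auto)
      have "moment w m \<le> (LINT s|\<mu>. ?i s)" unfolding moment_eq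
      proof (rule integral_mono_AE[OF integrable_power_mu])
        show "AE s in \<mu>. s ^ m \<le> ?i s" using AE_mu
        proof eventually_elim
          case (elim s)
          have "s ^ m \<le> indicator {u..} s + (\<Sum>j<J. (u ^ m) ^ (2 ^ j) * indicator {u ^ (2 ^ Suc j)..} s) + (u ^ m) ^ (2 ^ J)"
            using elim u by (intro power_le_layers) auto
          also have "\<dots> \<le> ?i s"
            using pw by (intro add_mono order_refl sum_mono mult_right_mono) auto
          finally show ?case .
        qed
        show "integrable \<mu> ?i" using ind
          by (intro Bochner_Integration.integrable_add Bochner_Integration.integrable_sum integrable_mult_right) auto
      qed
      also have "\<dots> = H u + (\<Sum>j<J. (1/2) ^ (2 ^ j) * H (u ^ (2 ^ Suc j))) + (1/2) ^ (2 ^ J) * measure \<mu> UNIV"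
      proof -
        have "(LINT s|\<mu>. (\<Sum>j<J. (1/2) ^ (2 ^ j) * indicator {u ^ (2 ^ Suc j)..} s)) = (\<Sum>j<J. (1/2) ^ (2 ^ j) * H (u ^ (2 ^ Suc j)))"
          using u ind by (subst Bochner_Integration.integral_sum) (auto simp: H_eq simp del: power_Suc)
        moreover have "(LINT s|\<mu>. ?i s) = (LINT s|\<mu>. indicator {u..} s)
            + (LINT s|\<mu>. (\<Sum>j<J. (1/2) ^ (2 ^ j) * indicator {u ^ (2 ^ Suc j)..} s)) + (LINT s|\<mu>. (1/2) ^ (2 ^ J))"
        proof -
          have sum: "integrable \<mu> (\<lambda>s. \<Sum>j<J. (1/2 :: real) ^ (2 ^ j) * indicator {u ^ (2 ^ Suc j)..} s)"
            by (intro Bochner_Integration.integrable_sum integrable_mult_right ind) auto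
          have "integrable \<mu> (indicator {u..} :: real \<Rightarrow> real)" by (rule ind) simp
          note 1 = this sum
          show ?thesis
            by (subst Bochner_Integration.integral_add[OF Bochner_Integration.integrable_add[OF 1]], simp,
                subst Bochner_Integration.integral_add[OF 1], rule refl)
        qed
        ultimately show ?thesis using u by (simp add: H_eq mult.commute del: power_Suc)
      qed
      also have "(\<Sum>j<J. (1/2) ^ (2 ^ j) * H (u ^ (2 ^ Suc j))) \<le> (\<Sum>j<J. ?t j * H u)"
      proof (rule sum_mono)
        fix j
        have "(1/2) ^ (2 ^ j) * H (u ^ (2 ^ Suc j)) \<le> (1/2) ^ (2 ^ j) * (C ^ Suc j * H u)"
          using u H_power_le[of u "Suc j"] by (intro mult_left_mono) auto
        then show "(1/2) ^ (2 ^ j) * H (u ^ (2 ^ Suc j)) \<le> ?t j * H u" by (simp add: mult_ac)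
      qed
      also have "(\<Sum>j<J. ?t j * H u) \<le> suminf ?t * H u"
        unfolding sum_distrib_right[symmetric] using u t0 sm H_pos[of u]
        by (intro mult_right_mono sum_le_suminf) auto
      finally show ?thesis by (simp add: algebra_simps)
    qed
    moreover have "(\<lambda>J. (1 + suminf ?t) * H u + (1/2) ^ (2 ^ J) * measure \<mu> UNIV) \<longlonglongrightarrow> (1 + suminf ?t) * H u + 0 * measure \<mu> UNIV"
    proof (intro tendsto_intros)
      have "filterlim (\<lambda>J. 2 ^ J :: nat) sequentially sequentially"
        by (rule filterlim_subseq) (auto simp: strict_mono_def)
      then show "(\<lambda>J. (1/2 :: real) ^ (2 ^ J)) \<longlonglongrightarrow> 0"
        by (rule filterlim_compose[rotated]) (auto intro: LIMSEQ_realpow_zero)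
    qed
    ultimately show ?thesis by (intro LIMSEQ_le_const[where a = "moment w m"]) auto
  qed
  moreover have "0 < 1 + suminf ?t" using suminf_nonneg[OF sm t0] by simp
  ultimately show ?thesis by blast
qed

text \<open>Both moment bounds are compared at the point \<open>u\<close> with
  \<open>u ^ m = 1/2\<close>, where \<open>u ^ (4 * m)\<close> is still 1/16. The summand 1 in the
  constant serves the case \<open>m = 0\<close>, in which no such point exists but the two moments
  coincide.\<close>

lemma moment_doubling: "\<exists>D>0. \<forall>m. moment w m \<le> D * moment w (4 * m)"
proof -
  obtain C' where C': "C' > 0" "\<And>u m. 0 < u \<Longrightarrow> u < 1 \<Longrightarrow> u ^ m \<le> 1/2 \<Longrightarrow> moment w m \<le> C' * H u"
    using moment_le_H by blast
  have "moment w m \<le> (16 * C' + 1) * moment w (4 * m)" for m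
  proof (cases "m = 0")
    case False
    define u :: real where "u = (1/2) powr (1 / m)"
    have u: "0 < u" "u < 1" using False by (auto simp: u_def powr01_less_one)
    have um: "u ^ m = 1/2" using False u by (simp add: u_def powr_realpow[symmetric] powr_powr)
    have u4: "u ^ (4 * m) = 1/16" by (simp add: power_mult mult.commute[of 4] um) (simp add: power_divide)
    have "H u \<le> 16 * moment w (4 * m)" using power_mult_H_le_moment[of u "4 * m"] u unfolding u4 by simp
    moreover have "moment w m \<le> C' * H u" using u um by (intro C') auto
    ultimately have "moment w m \<le> C' * (16 * moment w (4 * m))"
      using C'(1) by (meson mult_left_mono less_imp_le order_trans)
    then show ?thesis using moment_pos[of "4 * m"] by (simp add: algebra_simps)
  qed (use C' moment_pos[of 0] in \<open>simp add: algebra_simps\<close>)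
  then show ?thesis using C' by (intro exI[of _ "16 * C' + 1"]) auto
qed

end

section \<open>Integral means of the kernel\<close>

lemma sqrt_sqrt_power4: "0 \<le> y \<Longrightarrow> sqrt (sqrt y) ^ 4 = y"
  using power_mult[of "sqrt (sqrt y)" 2 2] by simp

context radial
begin

definition a :: "nat \<Rightarrow> real" where
  "a n = 1 / (2 * moment w (2 * n + 1))"

definition K :: "complex \<Rightarrow> complex" where
  "K s = (\<Sum>n. complex_of_real (a n) * s ^ n)"

lemma bergman_kernel_eq: "bergman_kernel w z \<zeta> = K (cnj z * \<zeta>)"
  by (simp add: bergman_kernel_def K_def a_def)

lemma borel_measurable_K [measurable]: "K \<in> borel_measurable borel"
  unfolding K_def[abs_def] by measurable

lemma a_pos: "0 < a n"
  by (simp add: a_def moment_pos)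

lemma a_mono: "m \<le> n \<Longrightarrow> a m \<le> a n"
  unfolding a_def by (intro divide_left_mono mult_left_mono moment_antimono mult_pos_pos moment_pos) auto

lemma power_mult_a_le: "0 < u \<Longrightarrow> u < 1 \<Longrightarrow> a n * u ^ (2 * n + 1) \<le> 1 / (2 * H u)"
  using power_mult_H_le_moment[of u "2 * n + 1"] H_pos[of u] moment_pos[of "2 * n + 1"]
  by (simp add: a_def field_simps)

lemma summable_a: "0 \<le> x \<Longrightarrow> x < 1 \<Longrightarrow> summable (\<lambda>n. a n * x ^ n)"
proof -
  assume x: "0 \<le> x" "x < 1"
  \<comment> \<open>With \<open>x\<close> at most \<open>u ^ 4\<close>, half of the power of
    \<open>u\<close> absorbs the growth of \<open>a n\<close> and the other half leaves a geometric
    series of ratio \<open>u\<^sup>2\<close>. The maximum with 1/2 keeps \<open>u\<close>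
    positive.\<close>
  define u where "u = sqrt (sqrt (max x (1/2)))"
  have u: "0 < u" "u < 1" using x by (auto simp: u_def max_def)
  have u4: "u ^ 4 = max x (1/2)" unfolding u_def using x by (intro sqrt_sqrt_power4) auto
  have "summable (\<lambda>n. (1 / (2 * H u) / u) * (u\<^sup>2) ^ n)"
    using u by (intro summable_mult summable_geometric) (auto simp: power_less_one_iff)
  then show ?thesis
  proof (rule summable_comparison_test')
    fix n
    have "a n * x ^ n \<le> a n * (u ^ 4) ^ n"
      unfolding u4 using x a_pos[of n] by (intro mult_left_mono power_mono) auto
    also have "\<dots> = (a n * u ^ (2 * n + 1)) * ((u\<^sup>2) ^ n / u)"
      using u by (simp add: power_mult[symmetric] power_add[symmetric] divide_simps)
    also have "\<dots> \<le> 1 / (2 * H u) * ((u\<^sup>2) ^ n / u)"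
      using u by (intro mult_right_mono power_mult_a_le) auto
    finally show "norm (a n * x ^ n) \<le> (1 / (2 * H u) / u) * (u\<^sup>2) ^ n"
      using x a_pos[of n] by simp
  qed
qed

lemma K_cis: "0 \<le> x \<Longrightarrow> K (complex_of_real x * cis \<theta>) = fourier (\<lambda>n. complex_of_real (a n * x ^ n)) \<theta>"
  by (simp add: K_def fourier_def power_mult_distrib mult_ac)

lemma summable_a_complex:
  "0 \<le> x \<Longrightarrow> x < 1 \<Longrightarrow> summable (\<lambda>n. norm (complex_of_real (a n * x ^ n)))"
  using summable_a[of x] a_pos by (simp only: norm_of_real) (simp add: abs_mult less_imp_le)

lemma norm_K_le: "cmod z \<le> x \<Longrightarrow> x < 1 \<Longrightarrow> cmod (K z) \<le> (\<Sum>n. a n * x ^ n)"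
proof -
  assume z: "cmod z \<le> x" "x < 1"
  have s: "summable (\<lambda>n. a n * x ^ n)" using z by (intro summable_a) (auto intro: order_trans[OF norm_ge_zero])
  have le: "norm (complex_of_real (a n) * z ^ n) \<le> a n * x ^ n" for n
    using z a_pos[of n] by (auto simp: norm_mult norm_power intro!: mult_left_mono power_mono)
  have sn: "summable (\<lambda>n. norm (complex_of_real (a n) * z ^ n))"
    by (rule summable_comparison_test'[OF s, of 0]) (simp only: real_norm_def abs_norm_cancel le)
  show ?thesis unfolding K_def
    by (rule order_trans[OF summable_norm suminf_le]) (use le s sn in auto)
qed

text \<open>The angular measure is not normalised; the factor 1 / \<pi> of the area measure is
  carried separately by the operator.\<close>

definition kmean :: "real \<Rightarrow> real" where
  "kmean x = (LINT \<theta>:{0..2*pi}|lborel. cmod (K (complex_of_real x * cis \<theta>)))"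

lemma set_integrable_K: "0 \<le> x \<Longrightarrow> x < 1 \<Longrightarrow> set_integrable lborel {0..2*pi} (\<lambda>\<theta>. cmod (K (complex_of_real x * cis \<theta>)))"
  by (rule set_integrable_bounded_Icc[where B = "\<Sum>n. a n * x ^ n"]) (auto intro!: norm_K_le simp: norm_mult)

lemma kmean_ge: "0 \<le> x \<Longrightarrow> x < 1 \<Longrightarrow> 2 * (\<Sum>n. a n * x ^ n / real (n + 1)) \<le> kmean x"
proof -
  assume x: "0 \<le> x" "x < 1"
  have "2 * (\<Sum>n. (a n * x ^ n) / real (n + 1)) \<le> (LINT \<theta>:{0..2*pi}|lborel. cmod (fourier (\<lambda>n. complex_of_real (a n * x ^ n)) \<theta>))"
    using x a_pos by (intro Hardy_inequality_nonneg summable_a) (auto simp: less_imp_le)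
  then show ?thesis unfolding kmean_def K_cis[OF x(1)] .
qed

text \<open>A crude bound by the sum of all coefficients, good enough for radii bounded away from
  1.\<close>

lemma kmean_le: "0 \<le> x \<Longrightarrow> x \<le> y \<Longrightarrow> y < 1 \<Longrightarrow> kmean x \<le> 2 * pi * (\<Sum>n. a n * y ^ n)"
proof -
  assume x: "0 \<le> x" "x \<le> y" "y < 1"
  have "kmean x \<le> (LINT \<theta>:{0..2*pi}|lborel. (\<Sum>n. a n * y ^ n))"
    unfolding kmean_def using x
    by (intro set_integral_mono set_integrable_K norm_K_le)
       (auto simp: norm_mult set_integrable_def intro!: integrable_mult_left integrable_real_indicator)
  also have "\<dots> = 2 * pi * (\<Sum>n. a n * y ^ n)"
    by (subst set_integral_const) (auto simp: measure_def)
  finally show ?thesis .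
qed

end

lemma power_diff_le:
  fixes x y :: real
  assumes "0 \<le> x" "x \<le> y"
  shows "y ^ Suc n - x ^ Suc n \<le> real (Suc n) * (y - x) * y ^ n"
proof (induction n)
  case (Suc n)
  have "y ^ Suc (Suc n) - x ^ Suc (Suc n) = y * (y ^ Suc n - x ^ Suc n) + (y - x) * x ^ Suc n"
    by (simp add: algebra_simps)
  also have "\<dots> \<le> y * (real (Suc n) * (y - x) * y ^ n) + (y - x) * y ^ Suc n"
    using Suc assms by (intro add_mono mult_left_mono power_mono) auto
  also have "\<dots> = real (Suc (Suc n)) * (y - x) * y ^ Suc n"
    by (simp add: algebra_simps)
  finally show ?case .
qed simp

section \<open>Growth of the integral means of the kernel\<close>

context doubling
begin

text \<open>The difference of consecutive odd moments has integrand s^(2n+1) (1 - s^2). Here (1 - s)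
  s^n is at most 1 / (n+1), and the remaining factor s^(n+1) integrates to a moment which doubling
  compares with the original one. So the coefficients grow like a power at most: relative increments
  are O(1/n).\<close>

lemma a_diff_le: "\<exists>D>0. \<forall>n. a (Suc n) - a n \<le> D / real (Suc n) * a (Suc n)"
proof -
  obtain D where D: "D > 0" "\<And>m. moment w m \<le> D * moment w (4 * m)"
    using moment_doubling by blast
  have "a (Suc n) - a n \<le> (2 * D) / real (Suc n) * a (Suc n)" for n
  proof -
    let ?M = "moment w (2 * n + 1)" and ?N = "moment w (2 * Suc n + 1)"
    have "?M - ?N = (LINT s|\<mu>. s ^ (2 * n + 1) - s ^ (2 * Suc n + 1))"
      unfolding moment_eq by (rule Bochner_Integration.integral_diff[symmetric]) (rule integrable_power_mu)+
    also have "\<dots> \<le> (LINT s|\<mu>. 2 / real (Suc n) * s ^ Suc n)"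
    proof (rule integral_mono_AE)
      show "AE s in \<mu>. s ^ (2 * n + 1) - s ^ (2 * Suc n + 1) \<le> 2 / real (Suc n) * s ^ Suc n"
        using AE_mu
      proof eventually_elim
        case (elim s)
        \<comment> \<open>The geometric sum has \<open>n + 1\<close> terms, each at least
          \<open>s ^ n\<close>.\<close>
        have "real (Suc n) * (1 - s) * s ^ n \<le> (\<Sum>k<Suc n. s ^ k) * (1 - s)"
        proof -
          have "(\<Sum>k<Suc n. s ^ n) \<le> (\<Sum>k<Suc n. s ^ k)"
            using elim by (intro sum_mono power_decreasing) auto
          then have "(\<Sum>k<Suc n. s ^ n) * (1 - s) \<le> (\<Sum>k<Suc n. s ^ k) * (1 - s)"
            using elim by (intro mult_right_mono) auto
          then show ?thesis by (simp only: sum_constant card_lessThan mult_ac)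
        qed
        also have "\<dots> = 1 - s ^ Suc n" using one_diff_power_eq[of s "Suc n"] by (simp add: mult.commute)
        also have "\<dots> \<le> 1" using elim by simp
        finally have 1: "(1 - s) * s ^ n \<le> 1 / real (Suc n)" by (simp add: field_simps)
        have "(1 - s\<^sup>2) * s ^ n = (1 + s) * ((1 - s) * s ^ n)" by (simp add: power2_eq_square algebra_simps)
        also have "\<dots> \<le> 2 * (1 / real (Suc n))" using elim 1 by (intro mult_mono) auto
        finally have "(1 - s\<^sup>2) * s ^ n * s ^ Suc n \<le> 2 / real (Suc n) * s ^ Suc n"
          using elim by (intro mult_right_mono) auto
        moreover have "s ^ (2 * n + 1) - s ^ (2 * Suc n + 1) = (1 - s\<^sup>2) * s ^ n * s ^ Suc n"
        proof -
          have "s ^ (2 * n) = s ^ n * s ^ n" by (simp add: mult_2 power_add)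
          then have e: "s ^ (2 * n + 1) = s * (s ^ n * s ^ n)" "s ^ (2 * Suc n + 1) = s * s * s * (s ^ n * s ^ n)"
            by simp_all
          have "s * (t * t) - s * s * s * (t * t) = (1 - s\<^sup>2) * t * (s * t)" for t
            by (simp add: algebra_simps power2_eq_square)
          then show ?thesis unfolding e power_Suc .
        qed
        ultimately show ?case by simp
      qed
    qed (intro Bochner_Integration.integrable_diff integrable_mult_right integrable_power_mu)+
    also have "\<dots> = 2 / real (Suc n) * moment w (Suc n)" by (simp add: moment_eq)
    also have "\<dots> \<le> 2 / real (Suc n) * (D * ?M)"
    proof (intro mult_left_mono)
      have "moment w (4 * Suc n) \<le> ?M" by (rule moment_antimono) simp
      then show "moment w (Suc n) \<le> D * ?M" using D(2)[of "Suc n"] D(1) by (meson mult_left_mono less_imp_le order_trans)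
    qed simp
    finally have "?M - ?N \<le> 2 / real (Suc n) * (D * ?M)" .
    then have "(?M - ?N) / (2 * ?M * ?N) \<le> 2 / real (Suc n) * (D * ?M) / (2 * ?M * ?N)"
      using moment_pos by (intro divide_right_mono) (auto simp: less_imp_le)
    moreover have "(?M - ?N) / (2 * ?M * ?N) = a (Suc n) - a n"
      using moment_pos[of "2 * n + 1"] moment_pos[of "2 * Suc n + 1"] unfolding a_def by (simp add: diff_divide_distrib)
    moreover have "2 / real (Suc n) * (D * ?M) / (2 * ?M * ?N) = (2 * D) / real (Suc n) * a (Suc n)"
      using moment_pos[of "2 * n + 1"] unfolding a_def by simp
    ultimately show ?thesis by simp
  qed
  then show ?thesis using D(1) by (intro exI[of _ "2 * D"]) auto
qed

text \<open>With \<open>e = 1 - y cis \<theta>\<close>, the increment \<open>g = K (y cis \<theta>) - K (x cis \<theta>)\<close> is the product of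
  \<open>e g\<close> and \<open>1 / e\<close>.  Multiplication by \<open>e\<close> takes differences of the coefficients, so both factors
  are controlled in \<open>L\<^sup>2\<close> by Parseval.\<close>

lemma kmean_step:
  "\<exists>B>0. \<forall>x y. 0 \<le> x \<longrightarrow> x \<le> y \<longrightarrow> y < 1 \<longrightarrow> 0 < y \<longrightarrow>
     kmean y \<le> kmean x + (B / y ^ 6 * ((y - x) / (1 - y))\<^sup>2 + pi) / H y"
proof -
  obtain D where D: "D > 0" "\<And>n. a (Suc n) - a n \<le> D / real (Suc n) * a (Suc n)"
    using a_diff_le by blast
  \<comment> \<open>The squared constant of the bound on the coefficients \<open>d\<close> below:
    \<open>D + 1\<close> comes from differencing, the square of \<open>C\<close> from comparing
    \<open>H y\<close> with \<open>H u\<close>.\<close>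
  define B where "B = pi * ((D + 1) * C\<^sup>2)\<^sup>2"
  have "kmean y \<le> kmean x + (B / y ^ 6 * ((y - x) / (1 - y))\<^sup>2 + pi) / H y"
    if x: "0 \<le> x" "x \<le> y" "y < 1" "0 < y" for x y
  proof -
    define b where "b n = a n * (y ^ n - x ^ n)" for n
    \<comment> \<open>The coefficients of the increment multiplied by
      \<open>1 - y cis \<theta>\<close>; the zeroth one vanishes because
      \<open>b 0 = 0\<close>.\<close>
    define d where "d n = (case n of 0 \<Rightarrow> 0 | Suc m \<Rightarrow> b (Suc m) - y * b m)" for n
    \<comment> \<open>The fourth root splits \<open>y ^ n\<close> into two equal halves: one
      controls \<open>a (Suc n)\<close> by \<open>1 / H u\<close>, the other has squares summing to
      \<open>1 / (1 - y)\<close>. Passing from \<open>y\<close> to \<open>u\<close> costs two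
      doublings, and the \<open>y ^ 6\<close> of the statement is a lower bound for the
      \<open>u ^ 6\<close> that arises.\<close>
    define u where "u = sqrt (sqrt y)"
    have u: "0 < u" "u < 1" "y \<le> u" "u ^ 4 = y"
    proof -
      show "0 < u" "u < 1" using x by (auto simp: u_def)
      show u4: "u ^ 4 = y" unfolding u_def using x by (intro sqrt_sqrt_power4) auto
      have "u ^ 4 \<le> u ^ 1" using \<open>0 < u\<close> \<open>u < 1\<close> by (intro power_decreasing) auto
      then show "y \<le> u" using u4 by simp
    qed
    have Hy: "0 < H y" using H_pos x by simp
    have Huy: "H y \<le> C\<^sup>2 * H u" using H_power_le[of u 2] u by simp
    have Hu: "0 < H u" using H_pos u by simp
    have b0: "0 \<le> b n" for n unfolding b_def using x a_pos[of n] by (intro mult_nonneg_nonneg) (auto intro: power_mono)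
    \<comment> \<open>A discrete product rule: one part differences the coefficients, the other the
      powers. Both are nonnegative and of the size
      \<open>(y - x) * a (Suc n) * y ^ n\<close>.\<close>
    have dS: "d (Suc n) = (a (Suc n) - a n) * (y ^ Suc n - x ^ Suc n) + a n * (y - x) * x ^ n" for n
      by (simp add: d_def b_def algebra_simps)
    have d_nonneg: "0 \<le> d n" for n
    proof (cases n)
      case (Suc m)
      have "x ^ Suc m \<le> y ^ Suc m" using x by (intro power_mono) auto
      then show ?thesis unfolding Suc dS using x a_pos[of m] a_mono[of m "Suc m"]
        by (intro add_nonneg_nonneg mult_nonneg_nonneg) auto
    qed (simp add: d_def)
    have d_le: "d (Suc n) \<le> (D + 1) * (y - x) * (a (Suc n) * y ^ n)" for n
    proof -
      have "(a (Suc n) - a n) * (y ^ Suc n - x ^ Suc n) \<le> (D / real (Suc n) * a (Suc n)) * (real (Suc n) * (y - x) * y ^ n)"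
        using D x a_pos[of "Suc n"] by (intro mult_mono power_diff_le) (auto intro!: power_mono mult_nonneg_nonneg simp del: power_Suc)
      moreover have "a n * (y - x) * x ^ n \<le> a (Suc n) * (y - x) * y ^ n"
        using x a_pos[of n] a_mono[of n "Suc n"] by (intro mult_mono power_mono) auto
      moreover have "(D / real (Suc n) * a (Suc n)) * (real (Suc n) * (y - x) * y ^ n) = D * (a (Suc n) * (y - x) * y ^ n)"
        by simp
      ultimately have "d (Suc n) \<le> D * (a (Suc n) * (y - x) * y ^ n) + a (Suc n) * (y - x) * y ^ n" unfolding dS by linarith
      then show ?thesis by (simp add: algebra_simps)
    qed
    define q where "q = (D + 1) * (y - x) * C\<^sup>2 / H y / u ^ 3"
    have q0: "0 \<le> q" unfolding q_def using D x Hy u by auto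
    have d_le': "d (Suc n) \<le> q * (u\<^sup>2) ^ n" for n
    proof -
      have "a (Suc n) * y ^ n = a (Suc n) * u ^ (2 * Suc n + 1) * ((u\<^sup>2) ^ n / u ^ 3)"
      proof -
        have "u ^ (2 * Suc n + 1) = (u\<^sup>2) ^ n * u ^ 3"
        proof -
          have "2 * Suc n + 1 = 2 * n + 3" by simp
          then show ?thesis by (simp only: power_add power_mult)
        qed
        moreover have "y ^ n = (u\<^sup>2) ^ n * (u\<^sup>2) ^ n"
          unfolding u(4)[symmetric] by (simp add: power_mult[symmetric] power_add[symmetric])
        ultimately show ?thesis using u(1) by simp
      qed
      also have "\<dots> \<le> 1 / (2 * H u) * ((u\<^sup>2) ^ n / u ^ 3)"
        using u by (intro mult_right_mono power_mult_a_le) auto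
      also have "\<dots> \<le> C\<^sup>2 / H y * ((u\<^sup>2) ^ n / u ^ 3)"
        using Huy Hu Hy u by (intro mult_right_mono) (auto simp: field_simps)
      finally have "a (Suc n) * y ^ n \<le> C\<^sup>2 / H y * ((u\<^sup>2) ^ n / u ^ 3)" .
      then have "(D + 1) * (y - x) * (a (Suc n) * y ^ n) \<le> (D + 1) * (y - x) * (C\<^sup>2 / H y * ((u\<^sup>2) ^ n / u ^ 3))"
        using D x by (intro mult_left_mono) auto
      then show ?thesis using d_le[of n] unfolding q_def by (simp add: mult_ac)
    qed
    have sgeo: "summable (\<lambda>n. (u\<^sup>2) ^ n)" "summable (\<lambda>n. ((u\<^sup>2) ^ n)\<^sup>2)"
    proof -
      have "summable (\<lambda>n. (u ^ 4) ^ n)" using u(1,2) by (intro summable_geometric) (auto simp: power_less_one_iff)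
      then show "summable (\<lambda>n. ((u\<^sup>2) ^ n)\<^sup>2)"
        by (simp add: power_mult[symmetric] mult.commute mult.left_commute)
      show "summable (\<lambda>n. (u\<^sup>2) ^ n)" using u(1,2) by (intro summable_geometric) (auto simp: power_less_one_iff)
    qed
    have sd: "summable d"
      by (subst summable_Suc_iff[symmetric], rule summable_comparison_test'[OF summable_mult[OF sgeo(1), of q], of 0])
         (use d_le' d_nonneg in auto)
    have sb: "summable b" unfolding b_def right_diff_distrib
      using x by (intro summable_diff summable_a) auto
    have sy: "summable (\<lambda>n. y ^ n)" using x by (intro summable_geometric) auto
    have scb: "summable (\<lambda>n. norm (complex_of_real (b n)))" unfolding norm_of_real using sb b0 by simp
    have scd: "summable (\<lambda>n. norm (complex_of_real (d n)))" unfolding norm_of_real using sd d_nonneg by simp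
    have scy: "summable (\<lambda>n. norm (complex_of_real (y ^ n)))" unfolding norm_of_real using sy x by simp
    let ?f = "\<lambda>c. fourier (\<lambda>n. complex_of_real (c n))"
    have fb: "?f b \<theta> = K (complex_of_real y * cis \<theta>) - K (complex_of_real x * cis \<theta>)" for \<theta>
      using x summable_fourier[OF summable_a_complex[of x]] summable_fourier[OF summable_a_complex[of y]]
      by (simp add: K_cis fourier_def b_def suminf_diff[symmetric] ring_distribs)
    have fd: "?f d \<theta> = (1 - complex_of_real y * cis \<theta>) * ?f b \<theta>" for \<theta>
    proof -
      let ?t = "\<lambda>n. complex_of_real (b n) * cis \<theta> ^ n"
      have st: "summable ?t" by (rule summable_fourier[OF scb])
      have st': "summable (\<lambda>n. ?t (Suc n))" using st summable_Suc_iff[of ?t] by blast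
      have "?f d \<theta> = (\<Sum>n. complex_of_real (d (Suc n)) * cis \<theta> ^ Suc n)"
        unfolding fourier_def using suminf_split_head[OF summable_fourier[OF scd, of \<theta>]] by (simp add: d_def)
      also have "\<dots> = (\<Sum>n. ?t (Suc n) - complex_of_real y * cis \<theta> * ?t n)"
        by (simp add: d_def algebra_simps)
      also have "\<dots> = (\<Sum>n. ?t (Suc n)) - complex_of_real y * cis \<theta> * suminf ?t"
        unfolding suminf_diff[OF st' summable_mult[OF st], symmetric] suminf_mult[OF st, symmetric] by (rule refl)
      also have "(\<Sum>n. ?t (Suc n)) = suminf ?t"
        using suminf_split_head[OF st] by (simp add: b_def)
      finally show ?thesis unfolding fourier_def by (simp add: algebra_simps)
    qed
    have fy: "?f (\<lambda>n. y ^ n) \<theta> * (1 - complex_of_real y * cis \<theta>) = 1" for \<theta>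
    proof -
      have "norm (complex_of_real y * cis \<theta>) < 1" using x by (simp add: norm_mult)
      moreover from this have "1 - complex_of_real y * cis \<theta> \<noteq> 0" by auto
      moreover have "?f (\<lambda>n. y ^ n) \<theta> = (\<Sum>n. (complex_of_real y * cis \<theta>) ^ n)"
        by (simp add: fourier_def power_mult_distrib)
      ultimately show ?thesis by (simp add: suminf_geometric)
    qed
    \<comment> \<open>The weight of the arithmetic-geometric mean inequality that replaces
      Cauchy-Schwarz. It is tuned so that the factor \<open>1 / (1 - y cis \<theta>)\<close>
      contributes at most \<open>pi / H y\<close>.\<close>
    define l where "l = H y / (1 - y)"
    have l: "0 < l" using Hy x by (simp add: l_def)
    have amgm: "cmod (?f b \<theta>) \<le> l / 2 * (cmod (?f d \<theta>))\<^sup>2 + 1 / (2 * l) * (cmod (?f (\<lambda>n. y ^ n) \<theta>))\<^sup>2" for \<theta>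
    proof -
      have "?f b \<theta> = ?f d \<theta> * ?f (\<lambda>n. y ^ n) \<theta>" unfolding fd using fy[of \<theta>] by (simp add: mult_ac)
      then have "cmod (?f b \<theta>) = cmod (?f d \<theta>) * cmod (?f (\<lambda>n. y ^ n) \<theta>)" by (simp add: norm_mult)
      moreover have "2 * (cmod (?f d \<theta>) * cmod (?f (\<lambda>n. y ^ n) \<theta>)) \<le> l * (cmod (?f d \<theta>))\<^sup>2 + 1 / l * (cmod (?f (\<lambda>n. y ^ n) \<theta>))\<^sup>2"
      proof -
        have "0 \<le> (l * cmod (?f d \<theta>) - cmod (?f (\<lambda>n. y ^ n) \<theta>))\<^sup>2 / l" using l by simp
        also have "\<dots> = l * (cmod (?f d \<theta>))\<^sup>2 + 1 / l * (cmod (?f (\<lambda>n. y ^ n) \<theta>))\<^sup>2 - 2 * (cmod (?f d \<theta>) * cmod (?f (\<lambda>n. y ^ n) \<theta>))"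
          using l by (simp add: power2_eq_square field_simps)
        finally show ?thesis by simp
      qed
      ultimately show ?thesis by simp
    qed
    have si: "set_integrable lborel {0..2*pi} (\<lambda>\<theta>. k * (cmod (?f c \<theta>))\<^sup>2)"
      if "summable (\<lambda>n. norm (complex_of_real (c n)))" for c and k :: real
    proof -
      have "set_integrable lborel {0..2*pi} (\<lambda>\<theta>. (cmod (?f c \<theta>))\<^sup>2)"
        by (rule set_integrable_bounded_Icc[where B = "(\<Sum>n. norm (complex_of_real (c n)))\<^sup>2"])
           (use norm_fourier_le[OF that] in \<open>auto intro!: power_mono\<close>)
      then show ?thesis by (rule set_integrable_mult_right)
    qed
    have ib: "set_integrable lborel {0..2*pi} (\<lambda>\<theta>. cmod (?f b \<theta>))"
      by (rule set_integrable_bounded_Icc[where B = "\<Sum>n. norm (complex_of_real (b n))"])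
         (use norm_fourier_le[OF scb] in auto)
    have "(LINT \<theta>:{0..2*pi}|lborel. cmod (?f b \<theta>))
        \<le> (LINT \<theta>:{0..2*pi}|lborel. l / 2 * (cmod (?f d \<theta>))\<^sup>2 + 1 / (2 * l) * (cmod (?f (\<lambda>n. y ^ n) \<theta>))\<^sup>2)"
      using amgm by (intro set_integral_mono set_integral_add si scd scy ib)
    also have "\<dots> = l / 2 * (2 * pi * (\<Sum>n. (d n)\<^sup>2)) + 1 / (2 * l) * (2 * pi * (\<Sum>n. (y ^ n)\<^sup>2))"
      using set_integral_norm_fourier_sq[OF scd] set_integral_norm_fourier_sq[OF scy] x
      by (subst set_integral_add[OF si[OF scd] si[OF scy]]) (simp add: norm_power)
    finally have bd: "(LINT \<theta>:{0..2*pi}|lborel. cmod (?f b \<theta>))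
        \<le> l / 2 * (2 * pi * (\<Sum>n. (d n)\<^sup>2)) + 1 / (2 * l) * (2 * pi * (\<Sum>n. (y ^ n)\<^sup>2))" .
    have "(\<Sum>n. (y ^ n)\<^sup>2) = 1 / (1 - y\<^sup>2)"
    proof -
      have "(y ^ n)\<^sup>2 = (y\<^sup>2) ^ n" for n by (simp only: power_mult[symmetric] mult.commute)
      moreover have "norm (y\<^sup>2) < 1" using x by (simp add: power_less_one_iff)
      ultimately show ?thesis by (simp only: suminf_geometric)
    qed
    also have "1 / (1 - y\<^sup>2) \<le> 1 / (1 - y)"
    proof (intro divide_left_mono mult_pos_pos)
      show "1 - y \<le> 1 - y\<^sup>2" using x mult_right_mono[of y 1 y] by (simp add: power2_eq_square)
    qed (use x in \<open>auto simp: power_less_one_iff\<close>)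
    finally have e1: "(\<Sum>n. (y ^ n)\<^sup>2) \<le> 1 / (1 - y)" .
    have e2: "(\<Sum>n. (d n)\<^sup>2) \<le> q\<^sup>2 / (1 - y)"
    proof -
      have le: "(d (Suc n))\<^sup>2 \<le> q\<^sup>2 * ((u\<^sup>2) ^ n)\<^sup>2" for n
        using power_mono[OF d_le'[of n] d_nonneg, of 2] by (simp add: power_mult_distrib)
      have s2: "summable (\<lambda>n. (d (Suc n))\<^sup>2)"
        by (rule summable_comparison_test'[OF summable_mult[OF sgeo(2), of "q\<^sup>2"], of 0]) (use le in auto)
      have "(\<Sum>n. (d n)\<^sup>2) = (\<Sum>n. (d (Suc n))\<^sup>2)"
        using suminf_split_head[of "\<lambda>n. (d n)\<^sup>2"] s2 summable_Suc_iff[of "\<lambda>n. (d n)\<^sup>2"] by (simp add: d_def)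
      also have "\<dots> \<le> (\<Sum>n. q\<^sup>2 * ((u\<^sup>2) ^ n)\<^sup>2)"
        by (rule suminf_le[OF le s2]) (intro summable_mult sgeo)
      also have "\<dots> = q\<^sup>2 * (\<Sum>n. (u ^ 4) ^ n)"
      proof -
        have "(u ^ 4) ^ n = ((u\<^sup>2) ^ n)\<^sup>2" for n by (simp add: power_mult[symmetric] mult.commute mult.left_commute)
        then show ?thesis by (simp only: suminf_mult[OF sgeo(2)])
      qed
      also have "\<dots> = q\<^sup>2 / (1 - y)" unfolding u(4) using x by (simp add: suminf_geometric)
      finally show ?thesis .
    qed
    have "l / 2 * (2 * pi * (\<Sum>n. (d n)\<^sup>2)) + 1 / (2 * l) * (2 * pi * (\<Sum>n. (y ^ n)\<^sup>2))
        \<le> l / 2 * (2 * pi * (q\<^sup>2 / (1 - y))) + 1 / (2 * l) * (2 * pi * (1 / (1 - y)))"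
      using l by (intro add_mono mult_left_mono e1 e2) auto
    note order_trans[OF bd this]
    also have "1 / (2 * l) * (2 * pi * (1 / (1 - y))) = pi / H y"
      using x Hy by (simp add: l_def)
    also have "l / 2 * (2 * pi * (q\<^sup>2 / (1 - y))) = pi * ((D + 1) * C\<^sup>2)\<^sup>2 * ((y - x) / (1 - y))\<^sup>2 / (u ^ 3)\<^sup>2 / H y"
    proof -
      have gen: "h / e / 2 * (2 * pi * ((k * t / h / v)\<^sup>2 / e)) = pi * k\<^sup>2 * (t / e)\<^sup>2 / v\<^sup>2 / h"
        if "h \<noteq> 0" "e \<noteq> 0" "v \<noteq> 0" for h e k t v :: real
        using that by (simp add: power2_eq_square mult_ac)
      have "q = ((D + 1) * C\<^sup>2) * (y - x) / H y / u ^ 3" by (simp add: q_def)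
      then show ?thesis using x Hy u(1) gen[of "H y" "1 - y" "u ^ 3" "(D + 1) * C\<^sup>2" "y - x"] by (simp only: l_def) simp
    qed
    also have "\<dots> = B * ((y - x) / (1 - y))\<^sup>2 / u ^ 6 / H y"
      by (simp add: B_def flip: power_mult)
    also have "\<dots> \<le> B * ((y - x) / (1 - y))\<^sup>2 / y ^ 6 / H y"
      using u x Hy D by (intro divide_right_mono divide_left_mono power_mono) (auto simp: B_def)
    finally have "(LINT \<theta>:{0..2*pi}|lborel. cmod (?f b \<theta>)) \<le> (B / y ^ 6 * ((y - x) / (1 - y))\<^sup>2 + pi) / H y"
      by (simp add: add_divide_distrib)
    moreover have "kmean y \<le> (LINT \<theta>:{0..2*pi}|lborel. cmod (K (complex_of_real x * cis \<theta>)) + cmod (?f b \<theta>))"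
      unfolding kmean_def
    proof (intro set_integral_mono set_integral_add ib set_integrable_K)
      fix \<theta> show "cmod (K (complex_of_real y * cis \<theta>)) \<le> cmod (K (complex_of_real x * cis \<theta>)) + cmod (?f b \<theta>)"
        unfolding fb by (rule norm_triangle_sub)
    qed (use x in auto)
    moreover have "\<dots> = kmean x + (LINT \<theta>:{0..2*pi}|lborel. cmod (?f b \<theta>))"
      unfolding kmean_def using x by (intro set_integral_add ib set_integrable_K) auto
    ultimately show ?thesis by simp
  qed
  moreover have "0 < B" using D C_ge_1 by (simp add: B_def)
  ultimately show ?thesis by blast
qed

theorem kmean_le_inverse_H:
  assumes "D_check w"
  shows "\<exists>A>0. \<forall>x. 0 \<le> x \<longrightarrow> x < 1 \<longrightarrow> kmean x \<le> A / H x"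
proof -
  obtain k c where k: "k > 1" and c: "c > 1"
    and dc: "\<And>r. 0 \<le> r \<Longrightarrow> r < 1 \<Longrightarrow> c * H (1 - (1 - r) / k) \<le> H r"
    using assms unfolding D_check_def by force
  obtain B where B: "B > 0" "\<And>x y. 0 \<le> x \<Longrightarrow> x \<le> y \<Longrightarrow> y < 1 \<Longrightarrow> 0 < y \<Longrightarrow>
     kmean y \<le> kmean x + (B / y ^ 6 * ((y - x) / (1 - y))\<^sup>2 + pi) / H y"
    using kmean_step by blast
  \<comment> \<open>Beyond \<open>x0\<close> the preceding radius \<open>1 - k * (1 - x)\<close> is
    still nonnegative, so a step back is possible exactly there.\<close>
  define x0 where "x0 = 1 - 1 / k"
  have x0: "0 < x0" "x0 < 1" using k by (auto simp: x0_def)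
  define B' where "B' = B / x0 ^ 6 * k\<^sup>2 + pi"
  have B': "0 < B'" unfolding B'_def using B x0 k by (intro add_nonneg_pos) auto
  define A0 where "A0 = 2 * pi * (\<Sum>n. a n * x0 ^ n)"
  \<comment> \<open>The first entry covers radii up to \<open>x0\<close>. The second makes
    \<open>A / c + B'\<close> at most \<open>A\<close>, so the bound reproduces itself in the
    induction step.\<close>
  define A where "A = max (A0 * H 0) (B' / (1 - 1 / c))"
  have A: "A0 * H 0 \<le> A" "B' / (1 - 1 / c) \<le> A" by (auto simp: A_def)
  have A_B: "A / c + B' \<le> A" using A(2) c by (simp add: field_simps)
  have A_pos: "0 < A" using A(2) B' c by (smt (verit) divide_pos_pos divide_less_eq_1)
  have base: "kmean x \<le> A / H x" if "0 \<le> x" "x \<le> x0" for x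
  proof -
    have "kmean x \<le> A0" unfolding A0_def using that x0 by (intro kmean_le) auto
    moreover have "0 \<le> A0" unfolding A0_def using less_imp_le[OF a_pos] x0
      by (intro mult_nonneg_nonneg[OF _ suminf_nonneg] summable_a) auto
    moreover have Hx: "0 < H x" "H x \<le> H 0" using that x0 by (auto intro: H_pos H_antimono)
    ultimately have "kmean x * H x \<le> A0 * H 0" by (intro mult_mono) auto
    then show ?thesis using A(1) Hx by (simp add: pos_le_divide_eq)
  qed
  \<comment> \<open>Induction on a bound \<open>n\<close> for the number of backward steps: each
    multiplies \<open>1 - x\<close> by \<open>k\<close>, and the hypothesis says that
    \<open>n\<close> of them would reach or pass radius 0.\<close>
  have ind: "0 \<le> x \<Longrightarrow> x < 1 \<Longrightarrow> 1 \<le> k ^ n * (1 - x) \<Longrightarrow> kmean x \<le> A / H x" for n x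
  proof (induction n arbitrary: x)
    case 0
    then show ?case using x0 by (intro base) auto
  next
    case (Suc n)
    show ?case
    proof (cases "x \<le> x0")
      case True
      then show ?thesis using Suc by (intro base) auto
    next
      case False
      define x' where "x' = 1 - k * (1 - x)"
      have kx: "k * (1 - x) < 1" using False k by (simp add: x0_def field_simps)
      have x': "0 \<le> x'" "x' < 1" using kx Suc.prems k by (auto simp: x'_def)
      have xx': "1 - (1 - x') / k = x" using k by (simp add: x'_def)
      have "1 - x \<le> k * (1 - x)" using k Suc.prems by simp
      then have le: "x' \<le> x" by (simp add: x'_def)
      have IH: "kmean x' \<le> A / H x'" using Suc.prems x' by (intro Suc.IH) (auto simp: x'_def mult_ac)
      have Hx: "0 < H x" "0 < H x'" using Suc.prems x' H_pos by auto
      have "c * H x \<le> H x'" using dc[OF x'] unfolding xx' .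
      then have "A / H x' \<le> A / (c * H x)" using A_pos Hx c by (intro divide_left_mono) auto
      also have "\<dots> = (A / c) / H x" by simp
      finally have 1: "kmean x' \<le> (A / c) / H x" using IH by simp
      have "(x - x') / (1 - x) \<le> k" using Suc.prems k by (simp add: x'_def field_simps)
      then have "((x - x') / (1 - x))\<^sup>2 \<le> k\<^sup>2" using le Suc.prems by (intro power_mono) auto
      moreover have "B / x ^ 6 \<le> B / x0 ^ 6" using B x0 False by (intro divide_left_mono power_mono) auto
      ultimately have "B / x ^ 6 * ((x - x') / (1 - x))\<^sup>2 + pi \<le> B'"
        unfolding B'_def using B x0 by (intro add_mono mult_mono) auto
      then have "(B / x ^ 6 * ((x - x') / (1 - x))\<^sup>2 + pi) / H x \<le> B' / H x"
        using Hx by (intro divide_right_mono) auto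
      moreover have "kmean x \<le> kmean x' + (B / x ^ 6 * ((x - x') / (1 - x))\<^sup>2 + pi) / H x"
        using x' le Suc.prems False x0 by (intro B(2)) auto
      ultimately have "kmean x \<le> (A / c + B') / H x" using 1 by (simp add: add_divide_distrib)
      also have "\<dots> \<le> A / H x" using A_B Hx by (intro divide_right_mono) auto
      finally show ?thesis .
    qed
  qed
  have "kmean x \<le> A / H x" if "0 \<le> x" "x < 1" for x
  proof -
    obtain n where "1 / (1 - x) < k ^ n" using real_arch_pow[OF k] by blast
    then have "1 \<le> k ^ n * (1 - x)" using that by (simp add: field_simps)
    then show ?thesis using that by (intro ind)
  qed
  then show ?thesis using A_pos by blast
qed

end

section \<open>A Hardy type operator\<close>

text \<open>Split at \<open>t = h\<close>. The part near 0 converges because \<open>b < 1\<close>,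
  the part at infinity because \<open>0 < b\<close>; the power of \<open>h\<close> is forced by
  homogeneity.\<close>

lemma nn_integral_powr_div_max_le:
  fixes h b :: real
  assumes "0 < h" "0 < b" "b < 1"
  shows "(\<integral>\<^sup>+t\<in>{0..}. ennreal (t powr (- b) / max h t) \<partial>lborel) \<le> ennreal ((1 / (1 - b) + 1 / b) * h powr (- b))"
proof -
  have 1: "((\<lambda>t. t powr (- b)) has_integral h powr (1 - b) / (1 - b)) {0..h}"
    using has_integral_powr_from_0[of "- b" h] assms by simp
  have 2: "((\<lambda>t. t powr (- b - 1)) has_integral h powr (- b) / b) {h..}"
    using has_integral_powr_to_inf[of "- b - 1" h] assms by simp
  have "(\<integral>\<^sup>+t\<in>{0..}. ennreal (t powr (- b) / max h t) \<partial>lborel)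
     \<le> (\<integral>\<^sup>+t. ennreal (1 / h) * (ennreal (t powr (- b)) * indicator {0..h} t) + ennreal (t powr (- b - 1)) * indicator {h..} t \<partial>lborel)"
  proof (rule nn_integral_mono)
    fix t :: real
    show "ennreal (t powr (- b) / max h t) * indicator {0..} t
        \<le> ennreal (1 / h) * (ennreal (t powr (- b)) * indicator {0..h} t) + ennreal (t powr (- b - 1)) * indicator {h..} t"
      using assms by (auto simp: indicator_def max_def ennreal_mult[symmetric] powr_diff mult.commute not_le)
  qed
  also have "\<dots> = ennreal (1 / h) * ennreal (h powr (1 - b) / (1 - b)) + ennreal (h powr (- b) / b)"
    using nn_integral_has_integral_lebesgue'[OF _ 1] nn_integral_has_integral_lebesgue'[OF _ 2]
    by (subst nn_integral_add) (auto simp: nn_integral_cmult)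
  also have "\<dots> = ennreal ((1 / (1 - b) + 1 / b) * h powr (- b))"
  proof -
    have "1 / h * (h powr (1 - b) / (1 - b)) = 1 / (1 - b) * h powr (- b)"
      using assms powr_add[of h 1 "- b"] by simp
    then have "ennreal (1 / h) * ennreal (h powr (1 - b) / (1 - b)) = ennreal (1 / (1 - b) * h powr (- b))"
      using assms by (subst ennreal_mult[symmetric]) auto
    moreover have "ennreal (1 / (1 - b) * h powr (- b)) + ennreal (h powr (- b) / b) = ennreal (1 / (1 - b) * h powr (- b) + h powr (- b) / b)"
      using assms by (intro ennreal_plus[symmetric]) auto
    ultimately show ?thesis by (simp only: distrib_right times_divide_eq_left mult_1_left)
  qed
  finally show ?thesis .
qed

context radial
begin

text \<open>Unlike \<open>omega_hat w\<close>, the function \<open>G\<close> does not see the values of \<open>w\<close> on the negative axis,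
  hence is monotone and measurable on the whole line.\<close>

definition G :: "real \<Rightarrow> real" where
  "G r = measure \<mu> {r..}"

lemma G_eq_H: "0 \<le> r \<Longrightarrow> G r = H r"
  by (simp add: G_def H_eq)

lemma G_antimono: "r \<le> s \<Longrightarrow> G s \<le> G r"
  by (auto simp: G_def intro!: mu.finite_measure_mono)

lemma G_nonneg: "0 \<le> G r"
  by (simp add: G_def)

lemma G_pos: "r < 1 \<Longrightarrow> 0 < G r"
  using G_antimono[of r 0] H_pos[of 0] H_pos[of r] by (cases "0 \<le> r") (auto simp: G_eq_H)

lemma borel_measurable_G [measurable]: "G \<in> borel_measurable borel"
proof -
  have "(\<lambda>r. - G r) \<in> borel_measurable borel"
    by (intro borel_measurable_mono) (auto simp: mono_def G_antimono)
  then show ?thesis by simp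
qed

lemma G_eq_integral: "G r = integral {r..1} W"
proof -
  have "G r = (LINT s|\<mu>. indicator {r..} s)" by (simp add: G_def)
  also have "\<dots> = (LINT s:{r..1}|lborel. W s)"
  proof -
    have "W s * indicator {r..} s = indicator {r..1} s * W s" for s by (auto simp: W_def indicator_def)
    then show ?thesis
      unfolding \<mu>_def set_lebesgue_integral_def real_scaleR_def
      by (subst integral_density) (simp_all only: W_nonneg real_scaleR_def AE_I2 measurable_lborel1 borel_measurable_W, auto)
  qed
  also have "\<dots> = integral {r..1} W"
    by (intro set_borel_integral_eq_integral(2)) (unfold set_integrable_def, rule integrable_mult_indicator[OF _ integrable_W], simp)
  finally show ?thesis .
qed

lemma continuous_on_G: "continuous_on {0..1} G"
proof -
  have "set_integrable lborel {0..1} W"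
    unfolding set_integrable_def by (rule integrable_mult_indicator[OF _ integrable_W]) simp
  then show ?thesis unfolding G_eq_integral[abs_def]
    by (intro indefinite_integral_continuous_1' set_borel_integral_eq_integral(1))
qed

lemma G_1: "G 1 = 0"
  by (simp add: G_eq_integral)

lemma measure_mu_lessThan: "measure \<mu> {..<r} = measure \<mu> UNIV - G r"
  using mu.finite_measure_compl[of "{r..}"] by (simp add: G_def Compl_eq_Diff_UNIV[symmetric])

lemma measure_mu_UNIV: "measure \<mu> UNIV = G 0"
  unfolding G_def by (intro mu.finite_measure_eq_AE) (use AE_mu in auto)

text \<open>The substitution t = G(s), for which no smoothness of \<open>w\<close> is available.
  Since \<open>G\<close> is continuous and decreases to 0 at 1, the set where \<open>G\<close>
  exceeds \<open>x\<close> is a half-line ending at a point of value \<open>x\<close>, and its mass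
  is \<open>G 0 - x\<close>.\<close>

lemma distr_mu_G: "distr \<mu> borel G = density lborel (indicator {0..G 0})"
proof (rule measure_eqI_lessThan)
  show "emeasure (distr \<mu> borel G) {x<..} < \<infinity>" for x
    by (subst emeasure_distr) (auto simp: less_top[symmetric] mu.emeasure_finite)
  show "emeasure (distr \<mu> borel G) {x<..} = emeasure (density lborel (indicator {0..G 0})) {x<..}" for x
  proof -
    have L: "emeasure (distr \<mu> borel G) {x<..} = ennreal (measure \<mu> {s. x < G s})"
      by (subst emeasure_distr) (auto simp: mu.emeasure_eq_measure vimage_def)
    have R: "emeasure (density lborel (indicator {0..G 0})) {x<..} = emeasure lborel ({0..G 0} \<inter> {x<..})"
      by (subst emeasure_density) (auto simp: nn_integral_indicator[symmetric] indicator_inter_arith[symmetric] simp del: nn_integral_indicator)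
    consider "x < 0" | "0 \<le> x" "x < G 0" | "G 0 \<le> x" by linarith
    then show ?thesis
    proof cases
      case 1
      then have "{s. x < G s} = UNIV" using G_nonneg by (auto intro: less_le_trans)
      moreover have "{0..G 0} \<inter> {x<..} = {0..G 0}" using 1 by auto
      ultimately show ?thesis unfolding L R by (simp add: measure_mu_UNIV G_nonneg)
    next
      case 3
      have "measure \<mu> {s. x < G s} = measure \<mu> {}"
      proof (rule mu.finite_measure_eq_AE)
        have "\<not> x < G s" if "0 \<le> s" for s using 3 G_antimono[OF that] by linarith
        then show "AE s in \<mu>. s \<in> {s. x < G s} \<longleftrightarrow> s \<in> {}"
          by (intro eventually_mono[OF AE_mu]) auto
      qed auto
      moreover have "{0..G 0} \<inter> {x<..} = {}" using 3 by auto
      ultimately show ?thesis unfolding L R by simp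
    next
      case 2
      \<comment> \<open>\<open>G\<close> may be constant on intervals, so the least point of this
        set is taken: then everything to its left has values above \<open>x\<close>.\<close>
      define S where "S = {r \<in> {0..1}. G r \<le> x}"
      have S: "S = {0..1} \<inter> G -` {..x}" by (auto simp: S_def)
      have "closed S" unfolding S by (intro continuous_closed_preimage continuous_on_G) auto
      moreover have "bounded S" by (rule bounded_subset[of "{0..1}"]) (auto simp: S_def)
      ultimately have "compact S" by (simp add: compact_eq_bounded_closed)
      moreover have "1 \<in> S" using 2 by (simp add: S_def G_1)
      ultimately obtain r where r: "r \<in> S" "\<And>s. s \<in> S \<Longrightarrow> r \<le> s"
        using compact_attains_inf[of S] by blast
      have r01: "0 \<le> r" "r \<le> 1" "G r \<le> x" using r by (auto simp: S_def)
      have lt: "x < G s" if "s < r" for s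
      proof (cases "0 \<le> s")
        case True
        then have "s \<notin> S" using that r(2)[of s] by auto
        then show ?thesis using True that r01 by (simp add: S_def)
      next
        case False
        then show ?thesis using 2 G_antimono[of s 0] by simp
      qed
      have "G r = x"
      proof (rule antisym)
        obtain s where "0 \<le> s" "s \<le> r" "G s = x"
          using IVT2'[of G r x 0] r01 2 continuous_on_subset[OF continuous_on_G, of "{0..r}"] by auto
        then show "x \<le> G r" using lt[of s] by (cases "s = r") auto
      qed (use r01 in auto)
      have "{s. x < G s} = {..<r}"
      proof safe
        fix s assume "x < G s"
        then show "s < r" using G_antimono[of r s] \<open>G r = x\<close> by (cases "s < r") auto
      qed (rule lt)
      then have "measure \<mu> {s. x < G s} = G 0 - x"
        using \<open>G r = x\<close> by (simp add: measure_mu_lessThan measure_mu_UNIV)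
      moreover have "{0..G 0} \<inter> {x<..} = {x<..G 0}" using 2 by auto
      ultimately show ?thesis unfolding L R using 2 by simp
    qed
  qed
qed auto

text \<open>Extending the range to the whole half-line loses something but makes the resulting
  integrals scale-invariant.\<close>

lemma nn_integral_mu_G_le:
  fixes \<phi> :: "real \<Rightarrow> ennreal"
  assumes [measurable]: "\<phi> \<in> borel_measurable borel"
  shows "(\<integral>\<^sup>+s. \<phi> (G s) \<partial>\<mu>) \<le> (\<integral>\<^sup>+t\<in>{0..}. \<phi> t \<partial>lborel)"
proof -
  have "(\<integral>\<^sup>+s. \<phi> (G s) \<partial>\<mu>) = integral\<^sup>N (distr \<mu> borel G) \<phi>"
    by (subst nn_integral_distr) auto
  also have "\<dots> = (\<integral>\<^sup>+t. indicator {0..G 0} t * \<phi> t \<partial>lborel)"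
    unfolding distr_mu_G by (subst nn_integral_density) auto
  also have "\<dots> \<le> (\<integral>\<^sup>+t\<in>{0..}. \<phi> t \<partial>lborel)"
    by (intro nn_integral_mono) (auto simp: indicator_def)
  finally show ?thesis .
qed

lemma Schur_test_mu:
  assumes "r < 1" "0 < b" "b < 1"
  shows "(\<integral>\<^sup>+s. ennreal (G s powr (- b) / max (G r) (G s)) \<partial>\<mu>) \<le> ennreal ((1 / (1 - b) + 1 / b) * G r powr (- b))"
  by (rule order_trans[OF nn_integral_mu_G_le nn_integral_powr_div_max_le]) (use assms G_pos in auto)

text \<open>Schur's test: Hoelder's inequality with the weight G^(-1/q) / max, then Tonelli. The
  inner integral uses the power 1/q and the outer one 1 - 1/q. Both lie in (0,1) and give the same
  constant q + q/(q-1), so its powers multiply to the exponent \<open>q\<close>.\<close>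

lemma Hardy_operator_bound:
  fixes N :: "real \<Rightarrow> real" and q :: real
  assumes [measurable]: "N \<in> borel_measurable borel" and N: "\<And>s. 0 \<le> N s" and q: "1 < q"
  shows "(\<integral>\<^sup>+r. epowr (\<integral>\<^sup>+s. ennreal (N s / max (G r) (G s)) \<partial>\<mu>) q \<partial>\<mu>)
    \<le> ennreal ((q + q / (q - 1)) powr q) * (\<integral>\<^sup>+s. ennreal (N s powr q) \<partial>\<mu>)"
proof -
  interpret pair_sigma_finite \<mu> \<mu> ..
  define c where "c = q + q / (q - 1)"
  have c: "c > 0" using q by (simp add: c_def add_pos_pos)
  have c1: "1 / (1 - 1 / q) + 1 / (1 / q) = c" using q by (simp add: c_def field_simps)
  have c2: "1 / (1 - (1 - 1 / q)) + 1 / (1 - 1 / q) = c" using q by (simp add: c_def field_simps)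
  let ?k = "\<lambda>r s. max (G r) (G s)"
  have "(\<integral>\<^sup>+r. epowr (\<integral>\<^sup>+s. ennreal (N s / ?k r s) \<partial>\<mu>) q \<partial>\<mu>)
     \<le> (\<integral>\<^sup>+r. \<integral>\<^sup>+s. ennreal (c powr (q - 1) * G r powr (- (1 - 1 / q)) * (N s powr q * G s powr (1 - 1 / q) / ?k r s)) \<partial>\<mu> \<partial>\<mu>)"
  proof (rule nn_integral_mono_AE, use AE_mu in eventually_elim)
    fix r :: real assume r: "0 \<le> r \<and> r < 1"
    let ?F = "\<lambda>s. N s * G s powr (1 / q)" and ?V = "\<lambda>s. G s powr (- (1 / q)) / ?k r s"
    have kpos: "0 < ?k r s" for s using r G_pos by (simp add: less_max_iff_disj)
    have "(\<integral>\<^sup>+s. ennreal (N s / ?k r s) \<partial>\<mu>) = (\<integral>\<^sup>+s. ennreal (?F s * ?V s) \<partial>\<mu>)"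
    proof (intro nn_integral_cong_AE, use AE_mu in eventually_elim)
      fix s :: real assume "0 \<le> s \<and> s < 1"
      then have "0 < G s" using G_pos by simp
      then have "G s powr (1 / q) * G s powr (- (1 / q)) = 1" by (simp flip: powr_add)
      then show "ennreal (N s / ?k r s) = ennreal (?F s * ?V s)" by (simp add: mult.assoc)
    qed
    then have "epowr (\<integral>\<^sup>+s. ennreal (N s / ?k r s) \<partial>\<mu>) q
        \<le> epowr (\<integral>\<^sup>+s. ennreal (?V s) \<partial>\<mu>) (q - 1) * (\<integral>\<^sup>+s. ennreal (?F s powr q * ?V s) \<partial>\<mu>)"
      using nn_integral_Holder_weight[of ?F \<mu> ?V q] N q kpos by (simp add: less_imp_le)
    also have "\<dots> \<le> ennreal (c powr (q - 1) * G r powr (- (1 - 1 / q))) * (\<integral>\<^sup>+s. ennreal (N s powr q * G s powr (1 - 1 / q) / ?k r s) \<partial>\<mu>)"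
    proof (rule mult_mono)
      have "(\<integral>\<^sup>+s. ennreal (?V s) \<partial>\<mu>) \<le> ennreal (c * G r powr (- (1 / q)))"
        using Schur_test_mu[of r "1 / q"] q r c1 by simp
      then have "epowr (\<integral>\<^sup>+s. ennreal (?V s) \<partial>\<mu>) (q - 1) \<le> epowr (ennreal (c * G r powr (- (1 / q)))) (q - 1)"
        using q by (intro epowr_mono) auto
      also have "\<dots> = ennreal (c powr (q - 1) * G r powr (- (1 - 1 / q)))"
      proof -
        have "- (1 / q) * (q - 1) = - (1 - 1 / q)" using q by (simp add: field_simps)
        then show ?thesis using c G_nonneg by (simp add: epowr_ennreal powr_mult powr_powr)
      qed
      finally show "epowr (\<integral>\<^sup>+s. ennreal (?V s) \<partial>\<mu>) (q - 1) \<le> ennreal (c powr (q - 1) * G r powr (- (1 - 1 / q)))" .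
      show "(\<integral>\<^sup>+s. ennreal (?F s powr q * ?V s) \<partial>\<mu>) \<le> (\<integral>\<^sup>+s. ennreal (N s powr q * G s powr (1 - 1 / q) / ?k r s) \<partial>\<mu>)"
      proof (intro nn_integral_mono ennreal_leI)
        fix s
        have "?F s powr q * ?V s = N s powr q * (G s * G s powr (- (1 / q))) / ?k r s"
          using N[of s] G_nonneg[of s] q by (simp add: powr_mult powr_powr)
        also have "G s * G s powr (- (1 / q)) = G s powr (1 - 1 / q)"
          using G_nonneg[of s] q by (cases "G s = 0") (auto simp: powr_diff powr_minus divide_inverse)
        finally show "?F s powr q * ?V s \<le> N s powr q * G s powr (1 - 1 / q) / ?k r s" by (rule order_eq_refl)
      qed
    qed auto
    also have "\<dots> = (\<integral>\<^sup>+s. ennreal (c powr (q - 1) * G r powr (- (1 - 1 / q)) * (N s powr q * G s powr (1 - 1 / q) / ?k r s)) \<partial>\<mu>)"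
      using kpos by (subst nn_integral_cmult[symmetric]) (auto simp: less_imp_le ennreal_mult[symmetric])
    finally show "epowr (\<integral>\<^sup>+s. ennreal (N s / ?k r s) \<partial>\<mu>) q
      \<le> (\<integral>\<^sup>+s. ennreal (c powr (q - 1) * G r powr (- (1 - 1 / q)) * (N s powr q * G s powr (1 - 1 / q) / ?k r s)) \<partial>\<mu>)" .
  qed
  also have "\<dots> = (\<integral>\<^sup>+s. \<integral>\<^sup>+r. ennreal (c powr (q - 1) * G r powr (- (1 - 1 / q)) * (N s powr q * G s powr (1 - 1 / q) / ?k r s)) \<partial>\<mu> \<partial>\<mu>)"
    by (rule Fubini') measurable
  also have "\<dots> \<le> (\<integral>\<^sup>+s. ennreal (c powr q) * ennreal (N s powr q) \<partial>\<mu>)"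
  proof (rule nn_integral_mono_AE, use AE_mu in eventually_elim)
    fix s :: real assume s: "0 \<le> s \<and> s < 1"
    have Gs: "0 < G s" using s G_pos by simp
    have "(\<integral>\<^sup>+r. ennreal (c powr (q - 1) * G r powr (- (1 - 1 / q)) * (N s powr q * G s powr (1 - 1 / q) / ?k r s)) \<partial>\<mu>)
        = (\<integral>\<^sup>+r. ennreal (c powr (q - 1) * N s powr q * G s powr (1 - 1 / q)) * ennreal (G r powr (- (1 - 1 / q)) / max (G s) (G r)) \<partial>\<mu>)"
      using Gs by (intro nn_integral_cong) (auto simp: ennreal_mult[symmetric] mult_ac max.commute le_max_iff_disj less_imp_le)
    also have "\<dots> = ennreal (c powr (q - 1) * N s powr q * G s powr (1 - 1 / q)) * (\<integral>\<^sup>+r. ennreal (G r powr (- (1 - 1 / q)) / max (G s) (G r)) \<partial>\<mu>)"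
      by (rule nn_integral_cmult) measurable
    also have "\<dots> \<le> ennreal (c powr (q - 1) * N s powr q * G s powr (1 - 1 / q)) * ennreal (c * G s powr (- (1 - 1 / q)))"
      using Schur_test_mu[of s "1 - 1 / q"] q s c2 by (intro mult_left_mono) auto
    also have "\<dots> = ennreal (c powr (q - 1) * c * N s powr q * (G s powr (1 - 1 / q) * G s powr (- (1 - 1 / q))))"
      using c by (simp add: ennreal_mult[symmetric] mult_ac)
    also have "G s powr (1 - 1 / q) * G s powr (- (1 - 1 / q)) = 1" using Gs by (simp flip: powr_add)
    also have "c powr (q - 1) * c = c powr q" using c by (simp add: powr_diff)
    finally show "(\<integral>\<^sup>+r. ennreal (c powr (q - 1) * G r powr (- (1 - 1 / q)) * (N s powr q * G s powr (1 - 1 / q) / ?k r s)) \<partial>\<mu>)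
        \<le> ennreal (c powr q) * ennreal (N s powr q)" by (simp add: ennreal_mult)
  qed
  also have "\<dots> = ennreal (c powr q) * (\<integral>\<^sup>+s. ennreal (N s powr q) \<partial>\<mu>)"
    by (rule nn_integral_cmult) measurable
  finally show ?thesis unfolding c_def .
qed

end

section \<open>Reduction to the radial operator\<close>

lemma ennreal_powr_eq_epowr: "0 \<le> x \<Longrightarrow> ennreal (x powr a) = epowr (ennreal x) a"
  by (simp add: epowr_ennreal)

context radial
begin

lemma nn_integral_disc_polar:
  fixes g :: "complex \<Rightarrow> real"
  assumes [measurable]: "g \<in> borel_measurable borel" and g: "\<And>\<zeta>. 0 \<le> g \<zeta>"
  shows "(\<integral>\<^sup>+\<zeta>. ennreal (g \<zeta> * W (cmod \<zeta>)) \<partial>lborel)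
    = (\<integral>\<^sup>+\<rho>. (\<integral>\<^sup>+\<phi>\<in>{0..2*pi}. ennreal (g (complex_of_real \<rho> * cis \<phi>)) \<partial>lborel) * ennreal \<rho> \<partial>\<mu>)"
proof -
  have "(\<integral>\<^sup>+\<zeta>. ennreal (g \<zeta> * W (cmod \<zeta>)) \<partial>lborel)
    = (\<integral>\<^sup>+r\<in>{0<..}. (\<integral>\<^sup>+\<phi>\<in>{0..2*pi}. ennreal (g (complex_of_real r * cis \<phi>) * W (cmod (complex_of_real r * cis \<phi>))) \<partial>lborel) * ennreal r \<partial>lborel)"
    by (rule nn_integral_polar) measurable
  also have "\<dots> = (\<integral>\<^sup>+r. ((\<integral>\<^sup>+\<phi>\<in>{0..2*pi}. ennreal (g (complex_of_real r * cis \<phi>)) \<partial>lborel) * ennreal r) * ennreal (W r) \<partial>lborel)"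
  proof (rule nn_integral_cong)
    fix r :: real
    show "(\<integral>\<^sup>+\<phi>\<in>{0..2*pi}. ennreal (g (complex_of_real r * cis \<phi>) * W (cmod (complex_of_real r * cis \<phi>))) \<partial>lborel) * ennreal r * indicator {0<..} r
      = (\<integral>\<^sup>+\<phi>\<in>{0..2*pi}. ennreal (g (complex_of_real r * cis \<phi>)) \<partial>lborel) * ennreal r * ennreal (W r)"
    proof (cases "0 < r")
      case True
      then have "(\<integral>\<^sup>+\<phi>\<in>{0..2*pi}. ennreal (g (complex_of_real r * cis \<phi>) * W (cmod (complex_of_real r * cis \<phi>))) \<partial>lborel)
        = (\<integral>\<^sup>+\<phi>. (ennreal (g (complex_of_real r * cis \<phi>)) * indicator {0..2*pi} \<phi>) * ennreal (W r) \<partial>lborel)"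
        using g W_nonneg by (intro nn_integral_cong) (simp add: norm_mult ennreal_mult mult_ac)
      also have "\<dots> = (\<integral>\<^sup>+\<phi>\<in>{0..2*pi}. ennreal (g (complex_of_real r * cis \<phi>)) \<partial>lborel) * ennreal (W r)"
        by (rule nn_integral_multc) measurable
      finally show ?thesis using True by (simp add: mult_ac)
    qed (simp add: ennreal_neg)
  qed
  also have "\<dots> = (\<integral>\<^sup>+\<rho>. (\<integral>\<^sup>+\<phi>\<in>{0..2*pi}. ennreal (g (complex_of_real \<rho> * cis \<phi>)) \<partial>lborel) * ennreal \<rho> \<partial>\<mu>)"
    by (rule nn_integral_mu[symmetric]) measurable
  finally show ?thesis .
qed

text \<open>The coefficients are real, so the modulus of the kernel is even in the angle.\<close>

lemma norm_K_cnj: "cmod z < 1 \<Longrightarrow> cmod (K (cnj z)) = cmod (K z)"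
proof -
  assume z: "cmod z < 1"
  have "summable (\<lambda>n. complex_of_real (a n) * z ^ n)"
    by (rule summable_norm_cancel) (use z a_pos in \<open>simp add: norm_mult norm_power summable_a less_imp_le\<close>)
  then have "cnj (K z) = K (cnj z)"
    unfolding K_def by (subst bounded_linear.suminf[OF bounded_linear_cnj]) simp_all
  then show ?thesis by (metis complex_mod_cnj)
qed

lemma nn_integral_K: "0 \<le> x \<Longrightarrow> x < 1 \<Longrightarrow>
    (\<integral>\<^sup>+\<phi>\<in>{0..2*pi}. ennreal (cmod (K (complex_of_real x * cis \<phi>))) \<partial>lborel) = ennreal (kmean x)"
proof -
  assume x: "0 \<le> x" "x < 1"
  have "(\<integral>\<^sup>+\<phi>. ennreal (indicator {0..2*pi} \<phi> * cmod (K (complex_of_real x * cis \<phi>))) \<partial>lborel) = ennreal (kmean x)"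
    using set_integrable_K[OF x] unfolding kmean_def set_lebesgue_integral_def set_integrable_def real_scaleR_def
    by (intro nn_integral_eq_integral) auto
  then show ?thesis by (simp add: ennreal_mult'' ennreal_indicator mult.commute)
qed

text \<open>Periodicity, and evenness for the second form. Both are required because the kernel is
  integrated in the variable of the function when its total mass is found, and in the variable of
  the image after Tonelli.\<close>

lemma nn_integral_K_shift:
  assumes x: "0 \<le> x" "x < 1" and \<theta>: "\<theta> \<in> {0..2*pi}"
  shows "(\<integral>\<^sup>+\<phi>\<in>{0..2*pi}. ennreal (cmod (K (complex_of_real x * cis (\<phi> - \<theta>)))) \<partial>lborel) = ennreal (kmean x)"
    and "(\<integral>\<^sup>+\<phi>\<in>{0..2*pi}. ennreal (cmod (K (complex_of_real x * cis (\<theta> - \<phi>)))) \<partial>lborel) = ennreal (kmean x)"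
proof -
  let ?g = "\<lambda>u. ennreal (cmod (K (complex_of_real x * cis u)))"
  have "(\<integral>\<^sup>+\<phi>\<in>{0..2*pi}. ?g (\<phi> - \<theta>) \<partial>lborel) = (\<integral>\<^sup>+u\<in>{- \<theta>..- \<theta> + 2*pi}. ?g u \<partial>lborel)"
    by (subst nn_integral_real_affine[where c = 1 and t = \<theta>])
       (auto simp: indicator_def intro!: nn_integral_cong)
  also have "\<dots> = (\<integral>\<^sup>+u\<in>{0..2*pi}. ?g u \<partial>lborel)"
    using \<theta> by (intro nn_integral_period_shift) (auto simp flip: cis_mult)
  finally show 1: "(\<integral>\<^sup>+\<phi>\<in>{0..2*pi}. ?g (\<phi> - \<theta>) \<partial>lborel) = ennreal (kmean x)"
    using nn_integral_K[OF x] by simp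
  have "?g (\<theta> - \<phi>) = ?g (\<phi> - \<theta>)" for \<phi>
    using norm_K_cnj[of "complex_of_real x * cis (\<phi> - \<theta>)"] x by (simp add: norm_mult cis_cnj)
  then show "(\<integral>\<^sup>+\<phi>\<in>{0..2*pi}. ?g (\<theta> - \<phi>) \<partial>lborel) = ennreal (kmean x)" using 1 by simp
qed

lemma kmean_nonneg: "0 \<le> kmean x"
  unfolding kmean_def set_lebesgue_integral_def by (intro Bochner_Integration.integral_nonneg) simp

lemma borel_measurable_kmean [measurable]: "kmean \<in> borel_measurable borel"
  unfolding kmean_def[abs_def] set_lebesgue_integral_def by measurable

text \<open>The operator on nonnegative functions with values in [0,\<infinity>], so that estimates
  can precede any proof of convergence.\<close>

definition T :: "(complex \<Rightarrow> real) \<Rightarrow> complex \<Rightarrow> ennreal" where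
  "T F z = (\<integral>\<^sup>+\<zeta>. ennreal (F \<zeta> * cmod (K (cnj z * \<zeta>)) / pi * W (cmod \<zeta>)) \<partial>lborel)"

lemma borel_measurable_cnj [measurable]: "cnj \<in> borel_measurable borel"
  by (intro borel_measurable_continuous_onI continuous_intros)

lemma T_polar:
  assumes [measurable]: "F \<in> borel_measurable borel" and F: "\<And>\<zeta>. 0 \<le> F \<zeta>"
  shows "T F (complex_of_real r * cis \<theta>) = (\<integral>\<^sup>+\<rho>. (\<integral>\<^sup>+\<phi>\<in>{0..2*pi}.
    ennreal (F (complex_of_real \<rho> * cis \<phi>) * cmod (K (complex_of_real (r * \<rho>) * cis (\<phi> - \<theta>))) / pi) \<partial>lborel) * ennreal \<rho> \<partial>\<mu>)"
proof -
  have e: "cnj (complex_of_real r * cis \<theta>) * (complex_of_real \<rho> * cis \<phi>) = complex_of_real (r * \<rho>) * cis (\<phi> - \<theta>)" for \<rho> \<phi>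
  proof -
    have "cis (\<phi> - \<theta>) = cis \<phi> * cnj (cis \<theta>)" by (simp add: cis_cnj cis_mult)
    then show ?thesis by simp
  qed
  have "T F (complex_of_real r * cis \<theta>) = (\<integral>\<^sup>+\<rho>. (\<integral>\<^sup>+\<phi>\<in>{0..2*pi}.
    ennreal (F (complex_of_real \<rho> * cis \<phi>) * cmod (K (cnj (complex_of_real r * cis \<theta>) * (complex_of_real \<rho> * cis \<phi>))) / pi) \<partial>lborel) * ennreal \<rho> \<partial>\<mu>)"
    unfolding T_def using F by (intro nn_integral_disc_polar) auto
  then show ?thesis unfolding e .
qed

text \<open>Hoelder's inequality on the disc with weight \<open>M(\<rho>) |K|\<close> gives Young's and Minkowski's
  inequalities in one step.\<close>

lemma angular_norm_T_le:
  fixes F :: "complex \<Rightarrow> real" and M :: "real \<Rightarrow> real"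
  assumes [measurable]: "F \<in> borel_measurable borel" "M \<in> borel_measurable borel"
    and F: "\<And>\<zeta>. 0 \<le> F \<zeta>" and M: "\<And>\<rho>. 0 < M \<rho>" and p: "1 < p" and r: "0 \<le> r" "r < 1"
    and FM: "AE \<rho> in \<mu>. (\<integral>\<^sup>+\<phi>\<in>{0..2*pi}. ennreal (F (complex_of_real \<rho> * cis \<phi>) powr p) \<partial>lborel) \<le> ennreal (2 * pi * M \<rho> powr p)"
  shows "(\<integral>\<^sup>+\<theta>\<in>{0..2*pi}. epowr (T F (complex_of_real r * cis \<theta>)) p \<partial>lborel)
    \<le> ennreal (2 * pi) * epowr (\<integral>\<^sup>+\<rho>. ennreal (M \<rho> * kmean (r * \<rho>) * \<bar>\<rho>\<bar> / pi) \<partial>\<mu>) p"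
proof -
  interpret pair_sigma_finite \<mu> lborel ..
  let ?k = "\<lambda>\<rho> \<alpha>. cmod (K (complex_of_real (r * \<rho>) * cis \<alpha>))"
  define B where "B = (\<integral>\<^sup>+\<rho>. ennreal (M \<rho> * kmean (r * \<rho>) * \<bar>\<rho>\<bar> / pi) \<partial>\<mu>)"
  define Fn where "Fn z = F (complex_of_real (fst z) * cis (snd z)) / M (fst z)" for z :: "real \<times> real"
  \<comment> \<open>Dividing \<open>F\<close> by \<open>M\<close> moves the radial size into the
    weight, whose total mass is then \<open>B\<close> for every \<theta> in the period. The absolute
    value keeps the weight nonnegative on the whole line.\<close>
  define V where "V \<theta> z = M (fst z) * \<bar>fst z\<bar> / pi * (?k (fst z) (snd z - \<theta>) * indicator {0..2*pi} (snd z))" for \<theta> and z :: "real \<times> real"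
  have [measurable]: "Fn \<in> borel_measurable (\<mu> \<Otimes>\<^sub>M lborel)" unfolding Fn_def[abs_def] by measurable
  have [measurable]: "(\<lambda>(\<theta>, z). V \<theta> z) \<in> borel_measurable (borel \<Otimes>\<^sub>M (\<mu> \<Otimes>\<^sub>M lborel))"
    unfolding V_def[abs_def] by measurable
  have [measurable]: "V \<theta> \<in> borel_measurable (\<mu> \<Otimes>\<^sub>M lborel)" for \<theta>
    unfolding V_def[abs_def] by measurable
  have nn: "0 \<le> Fn z" "0 \<le> V \<theta> z" for z \<theta>
    using F less_imp_le[OF M] by (auto simp: Fn_def V_def)
  have rr: "0 \<le> r * \<rho> \<and> r * \<rho> < 1" if "0 \<le> \<rho> \<and> \<rho> < 1" for \<rho>
    using r that mult_strict_mono'[of r 1 \<rho> 1] by auto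
  have TF: "T F (complex_of_real r * cis \<theta>) = (\<integral>\<^sup>+z. ennreal (Fn z * V \<theta> z) \<partial>(\<mu> \<Otimes>\<^sub>M lborel))" for \<theta>
  proof -
    have "T F (complex_of_real r * cis \<theta>) = (\<integral>\<^sup>+\<rho>. \<integral>\<^sup>+\<phi>. ennreal (Fn (\<rho>, \<phi>) * V \<theta> (\<rho>, \<phi>)) \<partial>lborel \<partial>\<mu>)"
      unfolding T_polar[OF assms(1) F]
    proof (intro nn_integral_cong_AE, use AE_mu in eventually_elim)
      fix \<rho> :: real assume \<rho>: "0 \<le> \<rho> \<and> \<rho> < 1"
      have "(\<integral>\<^sup>+\<phi>\<in>{0..2*pi}. ennreal (F (complex_of_real \<rho> * cis \<phi>) * ?k \<rho> (\<phi> - \<theta>) / pi) \<partial>lborel) * ennreal \<rho>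
          = (\<integral>\<^sup>+\<phi>. (ennreal (F (complex_of_real \<rho> * cis \<phi>) * ?k \<rho> (\<phi> - \<theta>) / pi) * indicator {0..2*pi} \<phi>) * ennreal \<rho> \<partial>lborel)"
        by (rule nn_integral_multc[symmetric]) measurable
      also have "\<dots> = (\<integral>\<^sup>+\<phi>. ennreal (Fn (\<rho>, \<phi>) * V \<theta> (\<rho>, \<phi>)) \<partial>lborel)"
      proof (rule nn_integral_cong)
        fix \<phi> :: real
        have "M \<rho> \<noteq> 0" using M[of \<rho>] by simp
        then show "ennreal (F (complex_of_real \<rho> * cis \<phi>) * ?k \<rho> (\<phi> - \<theta>) / pi) * indicator {0..2*pi} \<phi> * ennreal \<rho> = ennreal (Fn (\<rho>, \<phi>) * V \<theta> (\<rho>, \<phi>))"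
          using \<rho> F by (auto simp: Fn_def V_def indicator_def ennreal_mult[symmetric] mult_ac)
      qed
      finally show "(\<integral>\<^sup>+\<phi>\<in>{0..2*pi}. ennreal (F (complex_of_real \<rho> * cis \<phi>) * ?k \<rho> (\<phi> - \<theta>) / pi) \<partial>lborel) * ennreal \<rho>
          = (\<integral>\<^sup>+\<phi>. ennreal (Fn (\<rho>, \<phi>) * V \<theta> (\<rho>, \<phi>)) \<partial>lborel)" .
    qed
    also have "\<dots> = (\<integral>\<^sup>+z. ennreal (Fn z * V \<theta> z) \<partial>(\<mu> \<Otimes>\<^sub>M lborel))"
      by (rule lborel.nn_integral_fst) measurable
    finally show ?thesis .
  qed
  have VB: "(\<integral>\<^sup>+z. ennreal (V \<theta> z) \<partial>(\<mu> \<Otimes>\<^sub>M lborel)) = B" if \<theta>: "\<theta> \<in> {0..2*pi}" for \<theta>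
  proof -
    have "(\<integral>\<^sup>+z. ennreal (V \<theta> z) \<partial>(\<mu> \<Otimes>\<^sub>M lborel)) = (\<integral>\<^sup>+\<rho>. \<integral>\<^sup>+\<phi>. ennreal (V \<theta> (\<rho>, \<phi>)) \<partial>lborel \<partial>\<mu>)"
      by (rule lborel.nn_integral_fst[symmetric]) measurable
    also have "\<dots> = B" unfolding B_def
    proof (intro nn_integral_cong_AE, use AE_mu in eventually_elim)
      fix \<rho> :: real assume \<rho>: "0 \<le> \<rho> \<and> \<rho> < 1"
      have "(\<integral>\<^sup>+\<phi>. ennreal (V \<theta> (\<rho>, \<phi>)) \<partial>lborel) = (\<integral>\<^sup>+\<phi>. ennreal (M \<rho> * \<bar>\<rho>\<bar> / pi) * (ennreal (?k \<rho> (\<phi> - \<theta>)) * indicator {0..2*pi} \<phi>) \<partial>lborel)"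
        using M[of \<rho>] by (intro nn_integral_cong) (auto simp: V_def indicator_def ennreal_mult[symmetric] less_imp_le)
      also have "\<dots> = ennreal (M \<rho> * \<bar>\<rho>\<bar> / pi) * ennreal (kmean (r * \<rho>))"
        using rr[OF \<rho>] \<theta> by (subst nn_integral_cmult) (auto simp: nn_integral_K_shift simp del: of_real_mult)
      also have "\<dots> = ennreal (M \<rho> * kmean (r * \<rho>) * \<bar>\<rho>\<bar> / pi)"
        using M[of \<rho>] kmean_nonneg by (subst ennreal_mult[symmetric]) (auto simp: mult_ac less_imp_le)
      finally show "(\<integral>\<^sup>+\<phi>. ennreal (V \<theta> (\<rho>, \<phi>)) \<partial>lborel) = ennreal (M \<rho> * kmean (r * \<rho>) * \<bar>\<rho>\<bar> / pi)" .
    qed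
    finally show ?thesis .
  qed
  have "(\<integral>\<^sup>+\<theta>\<in>{0..2*pi}. epowr (T F (complex_of_real r * cis \<theta>)) p \<partial>lborel)
     \<le> (\<integral>\<^sup>+\<theta>. epowr B (p - 1) * ((\<integral>\<^sup>+z. ennreal (Fn z powr p * V \<theta> z) \<partial>(\<mu> \<Otimes>\<^sub>M lborel)) * indicator {0..2*pi} \<theta>) \<partial>lborel)"
  proof (rule nn_integral_mono)
    fix \<theta> :: real
    have "\<theta> \<in> {0..2*pi} \<Longrightarrow> epowr (T F (complex_of_real r * cis \<theta>)) p \<le> epowr B (p - 1) * (\<integral>\<^sup>+z. ennreal (Fn z powr p * V \<theta> z) \<partial>(\<mu> \<Otimes>\<^sub>M lborel))"
      unfolding TF using nn_integral_Holder_weight[of Fn "\<mu> \<Otimes>\<^sub>M lborel" "V \<theta>" p] nn p VB by simp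
    then show "epowr (T F (complex_of_real r * cis \<theta>)) p * indicator {0..2*pi} \<theta>
      \<le> epowr B (p - 1) * ((\<integral>\<^sup>+z. ennreal (Fn z powr p * V \<theta> z) \<partial>(\<mu> \<Otimes>\<^sub>M lborel)) * indicator {0..2*pi} \<theta>)"
      by (auto simp: indicator_def)
  qed
  also have "\<dots> = epowr B (p - 1) * (\<integral>\<^sup>+\<theta>. \<integral>\<^sup>+z. ennreal (Fn z powr p * V \<theta> z) * indicator {0..2*pi} \<theta> \<partial>(\<mu> \<Otimes>\<^sub>M lborel) \<partial>lborel)"
    by (simp add: nn_integral_cmult nn_integral_multc)
  also have "(\<integral>\<^sup>+\<theta>. \<integral>\<^sup>+z. ennreal (Fn z powr p * V \<theta> z) * indicator {0..2*pi} \<theta> \<partial>(\<mu> \<Otimes>\<^sub>M lborel) \<partial>lborel)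
      = (\<integral>\<^sup>+z. \<integral>\<^sup>+\<theta>. ennreal (Fn z powr p * V \<theta> z) * indicator {0..2*pi} \<theta> \<partial>lborel \<partial>(\<mu> \<Otimes>\<^sub>M lborel))"
  proof -
    interpret P: pair_sigma_finite "\<mu> \<Otimes>\<^sub>M lborel" lborel ..
    show ?thesis by (rule P.Fubini') measurable
  qed
  also have "\<dots> = (\<integral>\<^sup>+\<rho>. \<integral>\<^sup>+\<phi>. \<integral>\<^sup>+\<theta>. ennreal (Fn (\<rho>, \<phi>) powr p * V \<theta> (\<rho>, \<phi>)) * indicator {0..2*pi} \<theta> \<partial>lborel \<partial>lborel \<partial>\<mu>)"
    by (rule lborel.nn_integral_fst[symmetric]) measurable
  \<comment> \<open>With \<theta> innermost, the kernel integrates to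
    \<open>kmean (r * \<rho>)\<close> regardless of the other angle. The angular integral of
    \<open>F powr p\<close> is then bounded by \<open>FM\<close>, which cancels the power of
    \<open>M\<close> introduced by the normalisation.\<close>
  also have "\<dots> \<le> (\<integral>\<^sup>+\<rho>. ennreal (2 * pi) * ennreal (M \<rho> * kmean (r * \<rho>) * \<bar>\<rho>\<bar> / pi) \<partial>\<mu>)"
  proof (intro nn_integral_mono_AE, use AE_mu FM in eventually_elim)
    fix \<rho> :: real assume \<rho>: "0 \<le> \<rho> \<and> \<rho> < 1"
      and fm: "(\<integral>\<^sup>+\<phi>\<in>{0..2*pi}. ennreal (F (complex_of_real \<rho> * cis \<phi>) powr p) \<partial>lborel) \<le> ennreal (2 * pi * M \<rho> powr p)"
    let ?c = "M \<rho> powr (- p) * (M \<rho> * \<bar>\<rho>\<bar> / pi)"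
    have "(\<integral>\<^sup>+\<phi>. \<integral>\<^sup>+\<theta>. ennreal (Fn (\<rho>, \<phi>) powr p * V \<theta> (\<rho>, \<phi>)) * indicator {0..2*pi} \<theta> \<partial>lborel \<partial>lborel)
      = (\<integral>\<^sup>+\<phi>. ennreal (?c * kmean (r * \<rho>)) * (ennreal (F (complex_of_real \<rho> * cis \<phi>) powr p) * indicator {0..2*pi} \<phi>) \<partial>lborel)"
    proof (rule nn_integral_cong)
      fix \<phi> :: real
      show "(\<integral>\<^sup>+\<theta>. ennreal (Fn (\<rho>, \<phi>) powr p * V \<theta> (\<rho>, \<phi>)) * indicator {0..2*pi} \<theta> \<partial>lborel)
        = ennreal (?c * kmean (r * \<rho>)) * (ennreal (F (complex_of_real \<rho> * cis \<phi>) powr p) * indicator {0..2*pi} \<phi>)"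
      proof (cases "\<phi> \<in> {0..2*pi}")
        case True
        have "(\<integral>\<^sup>+\<theta>. ennreal (Fn (\<rho>, \<phi>) powr p * V \<theta> (\<rho>, \<phi>)) * indicator {0..2*pi} \<theta> \<partial>lborel)
          = (\<integral>\<^sup>+\<theta>. ennreal (?c * F (complex_of_real \<rho> * cis \<phi>) powr p) * (ennreal (?k \<rho> (\<phi> - \<theta>)) * indicator {0..2*pi} \<theta>) \<partial>lborel)"
        proof (rule nn_integral_cong)
          fix \<theta> :: real
          have "Fn (\<rho>, \<phi>) powr p * V \<theta> (\<rho>, \<phi>) = ?c * F (complex_of_real \<rho> * cis \<phi>) powr p * ?k \<rho> (\<phi> - \<theta>)"
          proof -
            have "Fn (\<rho>, \<phi>) powr p = F (complex_of_real \<rho> * cis \<phi>) powr p * M \<rho> powr (- p)"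
              using M[of \<rho>] F by (simp add: Fn_def powr_divide less_imp_le powr_minus_divide)
            then show ?thesis using True by (simp add: V_def mult_ac)
          qed
          then show "ennreal (Fn (\<rho>, \<phi>) powr p * V \<theta> (\<rho>, \<phi>)) * indicator {0..2*pi} \<theta>
            = ennreal (?c * F (complex_of_real \<rho> * cis \<phi>) powr p) * (ennreal (?k \<rho> (\<phi> - \<theta>)) * indicator {0..2*pi} \<theta>)"
            using M[of \<rho>] by (simp only: mult.assoc[symmetric]) (subst ennreal_mult, auto)
        qed
        also have "\<dots> = ennreal (?c * F (complex_of_real \<rho> * cis \<phi>) powr p) * ennreal (kmean (r * \<rho>))"
          using rr[OF \<rho>] True by (subst nn_integral_cmult) (auto simp: nn_integral_K_shift simp del: of_real_mult)
        also have "\<dots> = ennreal (?c * kmean (r * \<rho>)) * ennreal (F (complex_of_real \<rho> * cis \<phi>) powr p)"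
          using M[of \<rho>] kmean_nonneg[of "r * \<rho>"] by (simp add: ennreal_mult[symmetric] mult_ac less_imp_le)
        finally show ?thesis using True by simp
      qed (auto simp: V_def)
    qed
    also have "\<dots> = ennreal (?c * kmean (r * \<rho>)) * (\<integral>\<^sup>+\<phi>\<in>{0..2*pi}. ennreal (F (complex_of_real \<rho> * cis \<phi>) powr p) \<partial>lborel)"
      by (rule nn_integral_cmult) measurable
    also have "\<dots> \<le> ennreal (?c * kmean (r * \<rho>)) * ennreal (2 * pi * M \<rho> powr p)"
      by (intro mult_left_mono fm) simp
    also have "\<dots> = ennreal (2 * pi * (M \<rho> powr (- p) * M \<rho> powr p) * (M \<rho> * kmean (r * \<rho>) * \<bar>\<rho>\<bar> / pi))"
      using M[of \<rho>] kmean_nonneg[of "r * \<rho>"] by (subst ennreal_mult[symmetric]) (auto simp: mult_ac less_imp_le)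
    also have "M \<rho> powr (- p) * M \<rho> powr p = 1" using M[of \<rho>] by (simp flip: powr_add)
    finally show "(\<integral>\<^sup>+\<phi>. \<integral>\<^sup>+\<theta>. ennreal (Fn (\<rho>, \<phi>) powr p * V \<theta> (\<rho>, \<phi>)) * indicator {0..2*pi} \<theta> \<partial>lborel \<partial>lborel)
        \<le> ennreal (2 * pi) * ennreal (M \<rho> * kmean (r * \<rho>) * \<bar>\<rho>\<bar> / pi)"
      using M[of \<rho>] kmean_nonneg[of "r * \<rho>"] by (subst ennreal_mult[symmetric]) (auto simp: mult_ac less_imp_le)
  qed
  also have "\<dots> = ennreal (2 * pi) * B"
    unfolding B_def by (rule nn_integral_cmult) measurable
  finally have "(\<integral>\<^sup>+\<theta>\<in>{0..2*pi}. epowr (T F (complex_of_real r * cis \<theta>)) p \<partial>lborel) \<le> epowr B (p - 1) * (ennreal (2 * pi) * B)"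
    by (simp add: mult_left_mono)
  also have "\<dots> = ennreal (2 * pi) * epowr B (p - 1 + 1)"
    using p by (subst epowr_add) (auto simp: mult_ac)
  finally show ?thesis by (simp add: B_def)
qed

end

section \<open>Sufficiency\<close>

context radial
begin

text \<open>The integrand extended to the whole plane with \<open>W\<close> for \<open>w\<close>,
  which makes it jointly measurable; it is used for functions already cut off to the disc.\<close>

definition Q :: "(complex \<Rightarrow> complex) \<Rightarrow> complex \<Rightarrow> complex \<Rightarrow> complex" where
  "Q g z \<zeta> = g \<zeta> * complex_of_real (cmod (K (cnj z * \<zeta>)) / pi * W (cmod \<zeta>))"

lemma indicator_P_plus_integrand:
  "indicator (ball 0 1) \<zeta> *\<^sub>R P_plus_integrand w f z \<zeta> = Q (\<lambda>\<zeta>. indicator (ball 0 1) \<zeta> *\<^sub>R f \<zeta>) z \<zeta>"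
  by (simp add: P_plus_integrand_def Q_def bergman_kernel_eq W_def indicator_def)

lemma borel_measurable_Q [measurable]:
  assumes [measurable]: "g \<in> borel_measurable borel"
  shows "(\<lambda>(z, \<zeta>). Q g z \<zeta>) \<in> borel_measurable (borel \<Otimes>\<^sub>M borel)"
  unfolding Q_def[abs_def] by measurable

lemma nn_integral_norm_Q: "(\<integral>\<^sup>+\<zeta>. ennreal (norm (Q g z \<zeta>)) \<partial>lborel) = T (\<lambda>\<zeta>. cmod (g \<zeta>)) z"
  unfolding T_def using W_nonneg by (intro nn_integral_cong) (simp add: Q_def norm_mult norm_divide)

text \<open>Integrability is not presupposed: the integral of a non-integrable function is 0 by
  convention, so the bound holds in that case too.\<close>

lemma norm_integral_Q_le: "ennreal (cmod (\<integral>\<zeta>. Q g z \<zeta> \<partial>lborel)) \<le> T (\<lambda>\<zeta>. cmod (g \<zeta>)) z"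
proof (cases "integrable lborel (Q g z)")
  case True
  then show ?thesis using integral_norm_bound_ennreal[OF True] by (simp add: nn_integral_norm_Q)
qed (simp add: not_integrable_integral_eq)

text \<open>For nonnegative functions the integrand is a nonnegative real because the kernel enters
  through its modulus, so no cancellation can occur. This is what makes lower bounds by test
  functions possible.\<close>

lemma norm_integral_Q_eq:
  assumes "integrable lborel (Q (\<lambda>\<zeta>. complex_of_real (g \<zeta>)) z)" and g: "\<And>\<zeta>. 0 \<le> g \<zeta>"
  shows "ennreal (cmod (\<integral>\<zeta>. Q (\<lambda>\<zeta>. complex_of_real (g \<zeta>)) z \<zeta> \<partial>lborel)) = T g z"
proof -
  let ?R = "\<lambda>\<zeta>. g \<zeta> * (cmod (K (cnj z * \<zeta>)) / pi * W (cmod \<zeta>))"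
  have Q: "Q (\<lambda>\<zeta>. complex_of_real (g \<zeta>)) z = (\<lambda>\<zeta>. complex_of_real (?R \<zeta>))"
    by (rule ext) (simp only: Q_def of_real_mult)
  have R: "0 \<le> ?R \<zeta>" for \<zeta> using g W_nonneg by simp
  have int: "integrable lborel ?R"
    using assms(1) unfolding Q by (simp only: complex_of_real_integrable_eq)
  have "ennreal (cmod (\<integral>\<zeta>. Q (\<lambda>\<zeta>. complex_of_real (g \<zeta>)) z \<zeta> \<partial>lborel)) = ennreal (\<integral>\<zeta>. ?R \<zeta> \<partial>lborel)"
    unfolding Q integral_complex_of_real norm_of_real
    using R by (intro arg_cong[where f = ennreal] abs_of_nonneg Bochner_Integration.integral_nonneg)
  also have "\<dots> = (\<integral>\<^sup>+\<zeta>. ennreal (?R \<zeta>) \<partial>lborel)"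
    using int R by (intro nn_integral_eq_integral[symmetric]) auto
  also have "\<dots> = T g z" by (simp add: T_def mult_ac)
  finally show ?thesis .
qed

definition angular_mean :: "real \<Rightarrow> real \<Rightarrow> (complex \<Rightarrow> real) \<Rightarrow> real \<Rightarrow> ennreal" where
  "angular_mean p q F \<rho> = epowr ((\<integral>\<^sup>+\<theta>\<in>{0..2*pi}. ennreal (F (complex_of_real \<rho> * cis \<theta>) powr p) \<partial>lborel) / ennreal (2 * pi)) (q / p)"

lemma borel_measurable_angular_mean [measurable]:
  assumes [measurable]: "F \<in> borel_measurable borel"
  shows "angular_mean p q F \<in> borel_measurable borel"
  unfolding angular_mean_def[abs_def] by measurable

lemma Lpq_norm_pow_eq:
  assumes [measurable]: "F \<in> borel_measurable borel" and F: "\<And>z. cmod z < 1 \<Longrightarrow> F z = cmod (f z)"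
  shows "Lpq_norm_pow p q w f = (\<integral>\<^sup>+\<rho>. angular_mean p q F \<rho> * ennreal \<rho> \<partial>\<mu>)"
proof -
  have "Lpq_norm_pow p q w f = (\<integral>\<^sup>+\<rho>. angular_mean p q F \<rho> * ennreal \<rho> * ennreal (W \<rho>) \<partial>lborel)"
    unfolding Lpq_norm_pow_def
  proof (rule nn_integral_cong)
    fix \<rho> :: real
    show "epowr ((\<integral>\<^sup>+\<theta>\<in>{0..2*pi}. ennreal (cmod (f (complex_of_real \<rho> * cis \<theta>)) powr p) \<partial>lborel) / ennreal (2 * pi)) (q / p)
      * ennreal (\<rho> * w \<rho>) * indicator {0..<1} \<rho> = angular_mean p q F \<rho> * ennreal \<rho> * ennreal (W \<rho>)"
      using W_nonneg[of \<rho>] by (cases "\<rho> \<in> {0..<1}") (auto simp: angular_mean_def F norm_mult W_def ennreal_mult mult_ac)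
  qed
  also have "\<dots> = (\<integral>\<^sup>+\<rho>. angular_mean p q F \<rho> * ennreal \<rho> \<partial>\<mu>)"
    by (rule nn_integral_mu[symmetric]) measurable
  finally show ?thesis .
qed

text \<open>For fixed \<open>z\<close> the kernel is bounded, as its argument never exceeds
  \<open>cmod z\<close> in modulus. It remains to bound the angular integral of \<open>F\<close> by
  its p-mean through Hoelder. Boundedness of the projection includes absolute convergence at each
  point, which this supplies.\<close>

lemma T_less_top:
  fixes F :: "complex \<Rightarrow> real" and M :: "real \<Rightarrow> real"
  assumes [measurable]: "F \<in> borel_measurable borel" "M \<in> borel_measurable borel"
    and F: "\<And>\<zeta>. 0 \<le> F \<zeta>" and M: "\<And>\<rho>. 0 < M \<rho>" and p: "1 < p" and z: "cmod z < 1"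
    and FM: "AE \<rho> in \<mu>. (\<integral>\<^sup>+\<phi>\<in>{0..2*pi}. ennreal (F (complex_of_real \<rho> * cis \<phi>) powr p) \<partial>lborel) \<le> ennreal (2 * pi * M \<rho> powr p)"
    and fin: "(\<integral>\<^sup>+\<rho>. ennreal (M \<rho> * \<bar>\<rho>\<bar>) \<partial>\<mu>) < \<infinity>"
  shows "T F z < \<infinity>"
proof -
  define S where "S = (\<Sum>n. a n * cmod z ^ n)"
  have S: "0 \<le> S" unfolding S_def using z a_pos
    by (intro suminf_nonneg summable_a) (auto simp: less_imp_le)
  have "T F z = (\<integral>\<^sup>+\<rho>. (\<integral>\<^sup>+\<phi>\<in>{0..2*pi}. ennreal (F (complex_of_real \<rho> * cis \<phi>) * cmod (K (cnj z * (complex_of_real \<rho> * cis \<phi>))) / pi) \<partial>lborel) * ennreal \<rho> \<partial>\<mu>)"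
    unfolding T_def using F by (intro nn_integral_disc_polar) auto
  also have "\<dots> \<le> (\<integral>\<^sup>+\<rho>. ennreal (2 * S) * ennreal (M \<rho> * \<bar>\<rho>\<bar>) \<partial>\<mu>)"
  proof (intro nn_integral_mono_AE, use AE_mu FM in eventually_elim)
    fix \<rho> :: real assume \<rho>: "0 \<le> \<rho> \<and> \<rho> < 1"
      and fm: "(\<integral>\<^sup>+\<phi>\<in>{0..2*pi}. ennreal (F (complex_of_real \<rho> * cis \<phi>) powr p) \<partial>lborel) \<le> ennreal (2 * pi * M \<rho> powr p)"
    define J where "J = (\<integral>\<^sup>+\<phi>. ennreal (F (complex_of_real \<rho> * cis \<phi>) * indicator {0..2*pi} \<phi>) \<partial>lborel)"
    have "epowr J p \<le> epowr (\<integral>\<^sup>+\<phi>. ennreal (indicator {0..2*pi} \<phi>) \<partial>lborel) (p - 1)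
       * (\<integral>\<^sup>+\<phi>. ennreal (F (complex_of_real \<rho> * cis \<phi>) powr p * indicator {0..2*pi} \<phi>) \<partial>lborel)"
      unfolding J_def using F p
      by (intro nn_integral_Holder_weight[of "\<lambda>\<phi>. F (complex_of_real \<rho> * cis \<phi>)" lborel "indicator {0..2*pi}"]) auto
    also have "(\<integral>\<^sup>+\<phi>. ennreal (indicator {0..2*pi} \<phi>) \<partial>lborel) = ennreal (2 * pi)"
      by (simp add: ennreal_indicator)
    also have "(\<integral>\<^sup>+\<phi>. ennreal (F (complex_of_real \<rho> * cis \<phi>) powr p * indicator {0..2*pi} \<phi>) \<partial>lborel) \<le> ennreal (2 * pi * M \<rho> powr p)"
      using fm by (simp add: ennreal_mult'' ennreal_indicator)
    finally have "epowr J p \<le> epowr (ennreal (2 * pi)) (p - 1) * ennreal (2 * pi * M \<rho> powr p)"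
      by (simp add: mult_left_mono)
    also have "\<dots> = ennreal ((2 * pi * M \<rho>) powr p)"
      using M[of \<rho>] by (simp add: epowr_ennreal ennreal_mult[symmetric] powr_mult powr_diff)
    finally have "epowr (epowr J p) (1 / p) \<le> epowr (ennreal ((2 * pi * M \<rho>) powr p)) (1 / p)"
      using p by (intro epowr_mono) auto
    then have J: "J \<le> ennreal (2 * pi * M \<rho>)"
      using p M[of \<rho>] by (simp add: epowr_epowr epowr_ennreal powr_powr)
    have "(\<integral>\<^sup>+\<phi>\<in>{0..2*pi}. ennreal (F (complex_of_real \<rho> * cis \<phi>) * cmod (K (cnj z * (complex_of_real \<rho> * cis \<phi>))) / pi) \<partial>lborel)
      \<le> (\<integral>\<^sup>+\<phi>. ennreal (S / pi) * ennreal (F (complex_of_real \<rho> * cis \<phi>) * indicator {0..2*pi} \<phi>) \<partial>lborel)"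
    proof (rule nn_integral_mono)
      fix \<phi> :: real
      have "cmod (cnj z * (complex_of_real \<rho> * cis \<phi>)) \<le> cmod z"
        using \<rho> by (simp add: norm_mult mult_left_le)
      then have "cmod (K (cnj z * (complex_of_real \<rho> * cis \<phi>))) \<le> S"
        unfolding S_def using z by (intro norm_K_le)
      then have "F (complex_of_real \<rho> * cis \<phi>) * cmod (K (cnj z * (complex_of_real \<rho> * cis \<phi>))) / pi \<le> F (complex_of_real \<rho> * cis \<phi>) * S / pi"
        using F by (intro divide_right_mono mult_left_mono) auto
      then have "F (complex_of_real \<rho> * cis \<phi>) * cmod (K (cnj z * (complex_of_real \<rho> * cis \<phi>))) / pi \<le> S / pi * F (complex_of_real \<rho> * cis \<phi>)"
        by (simp only: mult.commute[of _ S] times_divide_eq_left)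
      then show "ennreal (F (complex_of_real \<rho> * cis \<phi>) * cmod (K (cnj z * (complex_of_real \<rho> * cis \<phi>))) / pi) * indicator {0..2*pi} \<phi>
        \<le> ennreal (S / pi) * ennreal (F (complex_of_real \<rho> * cis \<phi>) * indicator {0..2*pi} \<phi>)"
        using S F by (auto simp: indicator_def ennreal_mult[symmetric])
    qed
    also have "\<dots> = ennreal (S / pi) * J" unfolding J_def by (rule nn_integral_cmult) measurable
    also have "\<dots> \<le> ennreal (S / pi) * ennreal (2 * pi * M \<rho>)" by (intro mult_left_mono J) simp
    also have "\<dots> = ennreal (2 * S * M \<rho>)" using S M[of \<rho>] by (simp add: ennreal_mult[symmetric])
    finally have "(\<integral>\<^sup>+\<phi>\<in>{0..2*pi}. ennreal (F (complex_of_real \<rho> * cis \<phi>) * cmod (K (cnj z * (complex_of_real \<rho> * cis \<phi>))) / pi) \<partial>lborel) * ennreal \<rho>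
      \<le> ennreal (2 * S * M \<rho>) * ennreal \<rho>" by (intro mult_right_mono) auto
    also have "\<dots> = ennreal (2 * S) * ennreal (M \<rho> * \<bar>\<rho>\<bar>)"
      using S M[of \<rho>] \<rho> by (simp add: ennreal_mult[symmetric] mult_ac)
    finally show "(\<integral>\<^sup>+\<phi>\<in>{0..2*pi}. ennreal (F (complex_of_real \<rho> * cis \<phi>) * cmod (K (cnj z * (complex_of_real \<rho> * cis \<phi>))) / pi) \<partial>lborel) * ennreal \<rho>
      \<le> ennreal (2 * S) * ennreal (M \<rho> * \<bar>\<rho>\<bar>)" .
  qed
  also have "\<dots> = ennreal (2 * S) * (\<integral>\<^sup>+\<rho>. ennreal (M \<rho> * \<bar>\<rho>\<bar>) \<partial>\<mu>)"
    by (rule nn_integral_cmult) measurable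
  also have "\<dots> < \<infinity>" using fin by (simp add: ennreal_mult_less_top)
  finally show ?thesis .
qed

lemma P_plus_bounded_if_kmean_le:
  assumes A: "0 < A" and kA: "\<And>x. 0 \<le> x \<Longrightarrow> x < 1 \<Longrightarrow> kmean x \<le> A / H x"
    and p: "1 < p" and q: "1 < q"
  shows "P_plus_bounded p q w"
proof -
  define c where "c = (A / pi) powr q * (q + q / (q - 1)) powr q"
  have c: "0 \<le> c" by (simp add: c_def)
  have main: "(\<forall>z\<in>ball 0 1. set_integrable lborel (ball 0 1) (P_plus_integrand w f z))
      \<and> in_Lpq p q w (P_plus w f) \<and> Lpq_norm_pow p q w (P_plus w f) \<le> ennreal c * Lpq_norm_pow p q w f"
    if f: "in_Lpq p q w f" for f
  proof -
    define g where "g \<zeta> = indicator (ball 0 1) \<zeta> *\<^sub>R f \<zeta>" for \<zeta>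
    define F where "F \<zeta> = cmod (g \<zeta>)" for \<zeta>
    define P where "P z = (\<integral>\<zeta>. Q g z \<zeta> \<partial>lborel)" for z
    define E where "E = angular_mean p q F"
    have [measurable]: "g \<in> borel_measurable borel"
      using f by (simp add: in_Lpq_def set_borel_measurable_def g_def[abs_def])
    have [measurable]: "F \<in> borel_measurable borel" unfolding F_def[abs_def] by measurable
    have [measurable]: "E \<in> borel_measurable borel" unfolding E_def by measurable
    have [measurable]: "P \<in> borel_measurable borel"
      unfolding P_def[abs_def] by (rule lborel.borel_measurable_lebesgue_integral) measurable
    have F: "0 \<le> F \<zeta>" for \<zeta> by (simp add: F_def)
    have Pf: "P_plus w f = P"
      by (rule ext) (simp only: P_plus_def set_lebesgue_integral_def indicator_P_plus_integrand P_def g_def[abs_def])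
    have Lf: "Lpq_norm_pow p q w f = (\<integral>\<^sup>+\<rho>. E \<rho> * ennreal \<rho> \<partial>\<mu>)"
      unfolding E_def by (rule Lpq_norm_pow_eq) (auto simp: F_def g_def)
    have LP: "Lpq_norm_pow p q w (P_plus w f) = (\<integral>\<^sup>+r. angular_mean p q (\<lambda>z. cmod (P z)) r * ennreal r \<partial>\<mu>)"
      by (rule Lpq_norm_pow_eq) (auto simp: Pf)
    have Lfin: "Lpq_norm_pow p q w f < \<infinity>" using f by (simp add: in_Lpq_def)
    \<comment> \<open>The norm carries a factor \<rho>, so its finiteness yields finite angular
      means only away from 0.\<close>
    have AE_pos: "AE \<rho> in \<mu>. 0 < \<rho> \<and> \<rho> < 1"
    proof -
      have "AE \<rho> in \<mu>. \<rho> \<noteq> 0"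
        unfolding \<mu>_def by (subst AE_density) (use AE_lborel_singleton[of "0::real"] in auto)
      with AE_mu show ?thesis by eventually_elim auto
    qed
    have Efin: "AE \<rho> in \<mu>. E \<rho> < \<infinity>"
    proof -
      have "AE \<rho> in \<mu>. E \<rho> * ennreal \<rho> \<noteq> \<infinity>"
        using Lfin unfolding Lf by (intro nn_integral_PInf_AE) auto
      with AE_pos show ?thesis
        by eventually_elim (auto simp: less_top ennreal_mult_less_top)
    qed
    \<comment> \<open>the shift by \<open>e\<close> keeps the weight positive where the angular mean vanishes\<close>
    define M where "M e \<rho> = (enn2real (E \<rho>) + e) powr (1 / q)" for e \<rho> :: real
    have [measurable]: "M e \<in> borel_measurable borel" for e unfolding M_def[abs_def] by measurable
    have M_pos: "0 < M e \<rho>" if "0 < e" for e \<rho> using add_nonneg_pos[OF enn2real_nonneg that, of "E \<rho>"] by (simp add: M_def)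
    have M_q: "M e \<rho> powr q = enn2real (E \<rho>) + e" if "0 < e" for e \<rho>
      using that q enn2real_nonneg[of "E \<rho>"] by (simp add: M_def powr_powr)
    have FM: "AE \<rho> in \<mu>. (\<integral>\<^sup>+\<phi>\<in>{0..2*pi}. ennreal (F (complex_of_real \<rho> * cis \<phi>) powr p) \<partial>lborel) \<le> ennreal (2 * pi * M e \<rho> powr p)"
      if e: "0 < e" for e
      using Efin
    proof eventually_elim
      fix \<rho> assume E: "E \<rho> < \<infinity>"
      define I where "I = (\<integral>\<^sup>+\<phi>\<in>{0..2*pi}. ennreal (F (complex_of_real \<rho> * cis \<phi>) powr p) \<partial>lborel) / ennreal (2 * pi)"
      have "epowr (E \<rho>) (p / q) = I"
        unfolding E_def angular_mean_def I_def[symmetric] epowr_epowr using p q by simp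
      then have "I = ennreal (enn2real (E \<rho>) powr (p / q))"
        using E by (simp add: epowr_def split: if_splits)
      also have "\<dots> \<le> ennreal (M e \<rho> powr p)"
        unfolding M_def powr_powr using e p q by (intro ennreal_leI) (auto intro!: powr_mono2)
      finally have "ennreal (2 * pi) * I \<le> ennreal (2 * pi) * ennreal (M e \<rho> powr p)"
        by (intro mult_left_mono) auto
      also have "ennreal (2 * pi) * I = (\<integral>\<^sup>+\<phi>\<in>{0..2*pi}. ennreal (F (complex_of_real \<rho> * cis \<phi>) powr p) \<partial>lborel)"
        unfolding I_def ennreal_times_divide
        by (subst mult.commute, rule mult_divide_eq_ennreal) auto
      finally show "(\<integral>\<^sup>+\<phi>\<in>{0..2*pi}. ennreal (F (complex_of_real \<rho> * cis \<phi>) powr p) \<partial>lborel) \<le> ennreal (2 * pi * M e \<rho> powr p)"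
        by (simp add: ennreal_mult)
    qed
    have Mint: "(\<integral>\<^sup>+\<rho>. ennreal (M e \<rho> powr q * \<bar>\<rho>\<bar>) \<partial>\<mu>) \<le> Lpq_norm_pow p q w f + ennreal e * emeasure \<mu> UNIV" if e: "0 < e" for e
    proof -
      have "(\<integral>\<^sup>+\<rho>. ennreal (M e \<rho> powr q * \<bar>\<rho>\<bar>) \<partial>\<mu>) \<le> (\<integral>\<^sup>+\<rho>. E \<rho> * ennreal \<rho> + ennreal e \<partial>\<mu>)"
      proof (intro nn_integral_mono_AE, use AE_mu Efin in eventually_elim)
        fix \<rho> assume \<rho>: "0 \<le> \<rho> \<and> \<rho> < 1" and E: "E \<rho> < \<infinity>"
        obtain x where x: "E \<rho> = ennreal x" "0 \<le> x" using E by (cases "E \<rho>") auto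
        have "e * \<rho> \<le> e" using \<rho> e by (simp add: mult_left_le)
        then have "ennreal (M e \<rho> powr q * \<bar>\<rho>\<bar>) \<le> ennreal (x * \<rho> + e)"
          unfolding M_q[OF e] using x \<rho> by (intro ennreal_leI) (simp add: distrib_right)
        then show "ennreal (M e \<rho> powr q * \<bar>\<rho>\<bar>) \<le> E \<rho> * ennreal \<rho> + ennreal e"
          using x \<rho> e by (simp add: ennreal_plus ennreal_mult)
      qed
      also have "\<dots> = Lpq_norm_pow p q w f + ennreal e * emeasure \<mu> UNIV"
        unfolding Lf by (subst nn_integral_add) auto
      finally show ?thesis .
    qed
    have T_fin: "T F z < \<infinity>" if z: "cmod z < 1" for z
    proof (rule T_less_top[where M = "M 1" and p = p])
      have "(\<integral>\<^sup>+\<rho>. ennreal (M 1 \<rho> * \<bar>\<rho>\<bar>) \<partial>\<mu>) \<le> (\<integral>\<^sup>+\<rho>. ennreal 1 + ennreal (M 1 \<rho> powr q * \<bar>\<rho>\<bar>) \<partial>\<mu>)"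
      proof (intro nn_integral_mono_AE, use AE_mu in eventually_elim)
        fix \<rho> :: real assume \<rho>: "0 \<le> \<rho> \<and> \<rho> < 1"
        \<comment> \<open>With the shift 1 the majorant is at least 1, hence below its own q-th
          power, whose weighted integral is finite by \<open>Mint\<close>.\<close>
        have "1 \<le> M 1 \<rho>" using q enn2real_nonneg[of "E \<rho>"] by (simp add: M_def ge_one_powr_ge_zero)
        then have "M 1 \<rho> powr 1 \<le> M 1 \<rho> powr q" using q by (intro powr_mono) auto
        then have "M 1 \<rho> * \<bar>\<rho>\<bar> \<le> 1 + M 1 \<rho> powr q * \<bar>\<rho>\<bar>"
          using \<open>1 \<le> M 1 \<rho>\<close> by (intro add_increasing mult_right_mono) auto
        then show "ennreal (M 1 \<rho> * \<bar>\<rho>\<bar>) \<le> ennreal 1 + ennreal (M 1 \<rho> powr q * \<bar>\<rho>\<bar>)"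
          by (subst ennreal_plus[symmetric], simp, simp, rule ennreal_leI)
      qed
      also have "\<dots> = emeasure \<mu> UNIV + (\<integral>\<^sup>+\<rho>. ennreal (M 1 \<rho> powr q * \<bar>\<rho>\<bar>) \<partial>\<mu>)"
        by (subst nn_integral_add) auto
      also have "\<dots> \<le> emeasure \<mu> UNIV + (Lpq_norm_pow p q w f + ennreal 1 * emeasure \<mu> UNIV)"
        by (intro add_left_mono Mint) simp
      also have "\<dots> < \<infinity>" using Lfin mu.emeasure_finite[of UNIV] by (simp add: less_top[symmetric])
      finally show "(\<integral>\<^sup>+\<rho>. ennreal (M 1 \<rho> * \<bar>\<rho>\<bar>) \<partial>\<mu>) < \<infinity>" .
    qed (use z p F M_pos FM[of 1] in auto)
    have int: "set_integrable lborel (ball 0 1) (P_plus_integrand w f z)" if "z \<in> ball 0 1" for z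
    proof -
      have "integrable lborel (Q g z)"
      proof (rule integrableI_bounded)
        show "(\<integral>\<^sup>+\<zeta>. ennreal (norm (Q g z \<zeta>)) \<partial>lborel) < \<infinity>"
          using T_fin[of z] that by (simp add: nn_integral_norm_Q F_def[abs_def])
        show "Q g z \<in> borel_measurable lborel" unfolding Q_def[abs_def] by measurable
      qed
      then show ?thesis unfolding set_integrable_def indicator_P_plus_integrand g_def[abs_def] .
    qed
    have bound_e: "Lpq_norm_pow p q w (P_plus w f) \<le> ennreal c * (Lpq_norm_pow p q w f + ennreal e * emeasure \<mu> UNIV)"
      if e: "0 < e" for e
    proof -
      let ?B = "\<lambda>r. \<integral>\<^sup>+\<rho>. ennreal (M e \<rho> * kmean (r * \<rho>) * \<bar>\<rho>\<bar> / pi) \<partial>\<mu>"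
      let ?N = "\<lambda>\<rho>. M e \<rho> * \<bar>\<rho>\<bar>"
      have 1: "angular_mean p q (\<lambda>z. cmod (P z)) r * ennreal r \<le> epowr (?B r) q" if r: "0 \<le> r \<and> r < 1" for r
      proof -
        have "(\<integral>\<^sup>+\<theta>\<in>{0..2*pi}. ennreal (cmod (P (complex_of_real r * cis \<theta>)) powr p) \<partial>lborel)
          \<le> (\<integral>\<^sup>+\<theta>\<in>{0..2*pi}. epowr (T F (complex_of_real r * cis \<theta>)) p \<partial>lborel)"
        proof (intro nn_integral_mono mult_right_mono)
          fix \<theta>
          have "ennreal (cmod (P (complex_of_real r * cis \<theta>))) \<le> T F (complex_of_real r * cis \<theta>)"
            unfolding P_def F_def[abs_def] by (rule norm_integral_Q_le)
          then show "ennreal (cmod (P (complex_of_real r * cis \<theta>)) powr p) \<le> epowr (T F (complex_of_real r * cis \<theta>)) p"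
            using p by (subst ennreal_powr_eq_epowr) (auto intro: epowr_mono)
        qed simp
        also have "\<dots> \<le> ennreal (2 * pi) * epowr (?B r) p"
          using r p F M_pos[OF e] FM[OF e] by (intro angular_norm_T_le) auto
        finally have "(\<integral>\<^sup>+\<theta>\<in>{0..2*pi}. ennreal (cmod (P (complex_of_real r * cis \<theta>)) powr p) \<partial>lborel) / ennreal (2 * pi)
            \<le> (ennreal (2 * pi) * epowr (?B r) p) / ennreal (2 * pi)"
          by (rule divide_right_mono_ennreal)
        also have "\<dots> = epowr (?B r) p"
          by (simp add: mult.commute[of "ennreal (2 * pi)"] mult_divide_eq_ennreal)
        finally have "angular_mean p q (\<lambda>z. cmod (P z)) r \<le> epowr (epowr (?B r) p) (q / p)"
          unfolding angular_mean_def using p q by (intro epowr_mono) auto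
        also have "\<dots> = epowr (?B r) q" using p by (simp add: epowr_epowr)
        finally have "angular_mean p q (\<lambda>z. cmod (P z)) r * ennreal r \<le> epowr (?B r) q * 1"
          using r by (intro mult_mono) (auto simp: ennreal_le_1)
        then show ?thesis by simp
      qed
      have 2: "epowr (?B r) q \<le> ennreal ((A / pi) powr q) * epowr (\<integral>\<^sup>+\<rho>. ennreal (?N \<rho> / max (G r) (G \<rho>)) \<partial>\<mu>) q"
        if r: "0 \<le> r \<and> r < 1" for r
      proof -
        have "?B r \<le> (\<integral>\<^sup>+\<rho>. ennreal (A / pi) * ennreal (?N \<rho> / max (G r) (G \<rho>)) \<partial>\<mu>)"
        proof (intro nn_integral_mono_AE, use AE_mu in eventually_elim)
          fix \<rho> :: real assume \<rho>: "0 \<le> \<rho> \<and> \<rho> < 1"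
          have le: "0 \<le> r * \<rho>" "r * \<rho> \<le> r" "r * \<rho> \<le> \<rho>" using r \<rho> by (auto simp: mult_left_le mult_left_le_one_le)
          have "kmean (r * \<rho>) \<le> A / G (r * \<rho>)"
            using kA[of "r * \<rho>"] le r by (simp add: G_eq_H)
          also have "\<dots> \<le> A / max (G r) (G \<rho>)"
            using A r G_pos[of r] G_pos[of "r * \<rho>"] le G_antimono by (intro divide_left_mono) (auto simp: less_max_iff_disj)
          finally have "M e \<rho> * \<bar>\<rho>\<bar> / pi * kmean (r * \<rho>) \<le> M e \<rho> * \<bar>\<rho>\<bar> / pi * (A / max (G r) (G \<rho>))"
            using M_pos[OF e, of \<rho>] by (intro mult_left_mono) auto
          then have "ennreal (M e \<rho> * kmean (r * \<rho>) * \<bar>\<rho>\<bar> / pi) \<le> ennreal (A / pi * (?N \<rho> / max (G r) (G \<rho>)))"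
            by (intro ennreal_leI) (simp add: mult_ac)
          also have "\<dots> = ennreal (A / pi) * ennreal (?N \<rho> / max (G r) (G \<rho>))"
            using A by (intro ennreal_mult') simp
          finally show "ennreal (M e \<rho> * kmean (r * \<rho>) * \<bar>\<rho>\<bar> / pi) \<le> ennreal (A / pi) * ennreal (?N \<rho> / max (G r) (G \<rho>))" .
        qed
        also have "\<dots> = ennreal (A / pi) * (\<integral>\<^sup>+\<rho>. ennreal (?N \<rho> / max (G r) (G \<rho>)) \<partial>\<mu>)"
          by (rule nn_integral_cmult) measurable
        finally have "epowr (?B r) q \<le> epowr (ennreal (A / pi) * (\<integral>\<^sup>+\<rho>. ennreal (?N \<rho> / max (G r) (G \<rho>)) \<partial>\<mu>)) q"
          using q by (intro epowr_mono) auto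
        then show ?thesis using q A by (simp add: epowr_mult epowr_ennreal)
      qed
      have "Lpq_norm_pow p q w (P_plus w f)
          \<le> (\<integral>\<^sup>+r. ennreal ((A / pi) powr q) * epowr (\<integral>\<^sup>+\<rho>. ennreal (?N \<rho> / max (G r) (G \<rho>)) \<partial>\<mu>) q \<partial>\<mu>)"
        unfolding LP by (intro nn_integral_mono_AE, use AE_mu in eventually_elim) (rule order_trans[OF 1 2])
      also have "\<dots> = ennreal ((A / pi) powr q) * (\<integral>\<^sup>+r. epowr (\<integral>\<^sup>+\<rho>. ennreal (?N \<rho> / max (G r) (G \<rho>)) \<partial>\<mu>) q \<partial>\<mu>)"
        by (rule nn_integral_cmult) measurable
      also have "\<dots> \<le> ennreal ((A / pi) powr q) * (ennreal ((q + q / (q - 1)) powr q) * (\<integral>\<^sup>+\<rho>. ennreal (?N \<rho> powr q) \<partial>\<mu>))"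
        using q M_pos[OF e] by (intro mult_left_mono Hardy_operator_bound) (auto simp: less_imp_le)
      also have "\<dots> = ennreal c * (\<integral>\<^sup>+\<rho>. ennreal (?N \<rho> powr q) \<partial>\<mu>)"
        by (simp add: c_def ennreal_mult mult.assoc)
      also have "\<dots> \<le> ennreal c * (\<integral>\<^sup>+\<rho>. ennreal (M e \<rho> powr q * \<bar>\<rho>\<bar>) \<partial>\<mu>)"
      proof (intro mult_left_mono nn_integral_mono_AE, use AE_pos in eventually_elim)
        fix \<rho> :: real assume \<rho>: "0 < \<rho> \<and> \<rho> < 1"
        \<comment> \<open>The factor \<open>r\<close> of the norm was discarded on the output side.
          On the input side it is recovered from the Jacobian, which Hardy's inequality raises to a
          power above 1.\<close>
        have "\<rho> powr q \<le> \<rho> powr 1" using \<rho> q by (intro powr_mono') auto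
        then show "ennreal (?N \<rho> powr q) \<le> ennreal (M e \<rho> powr q * \<bar>\<rho>\<bar>)"
          using \<rho> M_pos[OF e, of \<rho>] by (intro ennreal_leI) (auto simp: powr_mult less_imp_le intro!: mult_left_mono)
      qed simp
      also have "\<dots> \<le> ennreal c * (Lpq_norm_pow p q w f + ennreal e * emeasure \<mu> UNIV)"
        by (intro mult_left_mono Mint e) simp
      finally show ?thesis .
    qed
    have bound: "Lpq_norm_pow p q w (P_plus w f) \<le> ennreal c * Lpq_norm_pow p q w f"
    proof (rule ennreal_le_epsilon)
      fix e :: real assume e: "0 < e"
      \<comment> \<open>With shift \<open>e / m\<close> the surplus is at most \<open>e\<close>; the
        summand 1 keeps the divisor positive.\<close>
      define m where "m = c * measure \<mu> UNIV + 1"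
      have m: "0 < m" using c by (simp add: m_def add_nonneg_pos)
      have "Lpq_norm_pow p q w (P_plus w f) \<le> ennreal c * (Lpq_norm_pow p q w f + ennreal (e / m) * emeasure \<mu> UNIV)"
        using e m by (intro bound_e) simp
      also have "\<dots> = ennreal c * Lpq_norm_pow p q w f + ennreal (c * (e / m * measure \<mu> UNIV))"
        using c e m by (simp add: distrib_left mu.emeasure_eq_measure ennreal_mult[symmetric])
      also have "\<dots> \<le> ennreal c * Lpq_norm_pow p q w f + ennreal e"
      proof (intro add_left_mono ennreal_leI)
        have "c * (e / m * measure \<mu> UNIV) = e * ((c * measure \<mu> UNIV) / m)" by simp
        also have "\<dots> \<le> e * 1" using e m by (intro mult_left_mono) (auto simp: m_def)
        finally show "c * (e / m * measure \<mu> UNIV) \<le> e" by simp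
      qed
      finally show "Lpq_norm_pow p q w (P_plus w f) \<le> ennreal c * Lpq_norm_pow p q w f + ennreal e" .
    qed
    moreover have "ennreal c * Lpq_norm_pow p q w f < \<infinity>" using Lfin by (simp add: ennreal_mult_less_top)
    moreover have "set_borel_measurable lborel (ball 0 1) (P_plus w f)"
      unfolding set_borel_measurable_def Pf by (intro borel_measurable_scaleR borel_measurable_indicator) auto
    ultimately show ?thesis using int unfolding in_Lpq_def by (auto intro: le_less_trans)
  qed
  then show ?thesis unfolding P_plus_bounded_def by (intro exI[of _ c]) blast
qed

end

section \<open>Necessity\<close>

context radial
begin

text \<open>Hardy's lower bound for half of \<open>kmean\<close>, taken at the squared radius
  because both the point and the integration variable will only be known to have modulus at least
  \<open>x\<close>.\<close>

definition S :: "real \<Rightarrow> real" where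
  "S x = (\<Sum>n. a n * (x\<^sup>2) ^ n / real (n + 1))"

lemma summable_S: "0 \<le> y \<Longrightarrow> y < 1 \<Longrightarrow> summable (\<lambda>n. a n * y ^ n / real (n + 1))"
  by (rule summable_comparison_test'[OF summable_a[of y], of 0])
     (use a_pos in \<open>auto simp: divide_le_eq less_imp_le abs_mult ring_distribs\<close>)

text \<open>Going through the coefficient sum provides monotonicity in the radius termwise, so that
  none has to be shown for \<open>kmean\<close> itself.\<close>

lemma kmean_ge_S: "0 \<le> x \<Longrightarrow> x\<^sup>2 \<le> y \<Longrightarrow> y < 1 \<Longrightarrow> 2 * S x \<le> kmean y"
proof -
  assume x: "0 \<le> x" "x\<^sup>2 \<le> y" "y < 1"
  have y: "0 \<le> y" using x(2) zero_le_power2[of x] by linarith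
  have "S x \<le> (\<Sum>n. a n * y ^ n / real (n + 1))" unfolding S_def
  proof (rule suminf_le)
    show "summable (\<lambda>n. a n * (x\<^sup>2) ^ n / real (n + 1))" using x by (intro summable_S) auto
    show "summable (\<lambda>n. a n * y ^ n / real (n + 1))" using x y by (intro summable_S) auto
    show "a n * (x\<^sup>2) ^ n / real (n + 1) \<le> a n * y ^ n / real (n + 1)" for n
      using x a_pos[of n] by (intro divide_right_mono mult_left_mono power_mono) auto
  qed
  then show ?thesis using kmean_ge[OF y x(3)] by simp
qed

text \<open>Test on the indicator of the annulus from \<open>x\<close> to 1. Its image is at least
  \<open>L\<close> on the same annulus, so the norm inequality reads
  \<open>L powr q * m \<le> c * m\<close> with \<open>m\<close> the q-th power of the norm of the
  test function, and \<open>m\<close> cancels.\<close>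

lemma H_mult_S_bounded:
  assumes bd: "P_plus_bounded p q w" and p: "1 < p" and q: "1 < q"
  shows "\<exists>D>0. \<forall>x. 1/2 \<le> x \<longrightarrow> x < 1 \<longrightarrow> H x * S x \<le> D"
proof -
  obtain c :: real where c: "\<And>f. in_Lpq p q w f \<Longrightarrow>
      (\<forall>z\<in>ball 0 1. set_integrable lborel (ball 0 1) (P_plus_integrand w f z))
      \<and> Lpq_norm_pow p q w (P_plus w f) \<le> ennreal c * Lpq_norm_pow p q w f"
    using bd unfolding P_plus_bounded_def by blast
  have "H x * S x \<le> pi * max c 1 powr (1 / q)" if x: "1/2 \<le> x" "x < 1" for x
  proof -
    define f :: "complex \<Rightarrow> complex" where "f \<zeta> = complex_of_real (indicator {\<zeta>. x \<le> cmod \<zeta>} \<zeta>)" for \<zeta>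
    define g :: "complex \<Rightarrow> real" where "g \<zeta> = indicator (ball 0 1 \<inter> {\<zeta>. x \<le> cmod \<zeta>}) \<zeta>" for \<zeta>
    define P where "P z = (\<integral>\<zeta>. Q (\<lambda>\<zeta>. complex_of_real (g \<zeta>)) z \<zeta> \<partial>lborel)" for z
    have [measurable]: "{\<zeta>. x \<le> cmod \<zeta>} \<in> sets borel" by measurable
    have [measurable]: "g \<in> borel_measurable borel" unfolding g_def[abs_def] by (intro borel_measurable_indicator) auto
    have [measurable]: "P \<in> borel_measurable borel"
      unfolding P_def[abs_def] by (rule lborel.borel_measurable_lebesgue_integral) measurable
    have fg: "indicator (ball 0 1) \<zeta> *\<^sub>R f \<zeta> = complex_of_real (g \<zeta>)" for \<zeta>
      by (simp add: f_def g_def indicator_def)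
    have g0: "0 \<le> g \<zeta>" for \<zeta> by (simp add: g_def)
    have g_cis: "g (complex_of_real \<rho> * cis \<theta>) = indicator {x..} \<rho>" if "0 \<le> \<rho> \<and> \<rho> < 1" for \<rho> \<theta>
      using that by (simp add: g_def indicator_def norm_mult)
    have Pf: "P_plus w f = P"
      by (rule ext) (simp only: P_plus_def set_lebesgue_integral_def indicator_P_plus_integrand P_def fg)
    define m where "m = (\<integral>\<^sup>+\<rho>. ennreal (\<bar>\<rho>\<bar> * indicator {x..} \<rho>) \<partial>\<mu>)"
    have Lf: "Lpq_norm_pow p q w f = m"
    proof -
      have "Lpq_norm_pow p q w f = (\<integral>\<^sup>+\<rho>. angular_mean p q g \<rho> * ennreal \<rho> \<partial>\<mu>)"
        by (rule Lpq_norm_pow_eq) (auto simp: f_def g_def indicator_def)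
      also have "\<dots> = m" unfolding m_def
      proof (intro nn_integral_cong_AE, use AE_mu in eventually_elim)
        fix \<rho> :: real assume \<rho>: "0 \<le> \<rho> \<and> \<rho> < 1"
        have "angular_mean p q g \<rho> = indicator {x..} \<rho>"
        proof (cases "x \<le> \<rho>")
          case True
          have "ennreal (2 * pi) / ennreal (2 * pi) = 1" by (rule ennreal_divide_self) auto
          then show ?thesis using True \<rho> unfolding angular_mean_def by (simp add: g_cis epowr_def)
        next
          case False
          then show ?thesis using \<rho> unfolding angular_mean_def by (simp add: g_cis)
        qed
        then show "angular_mean p q g \<rho> * ennreal \<rho> = ennreal (\<bar>\<rho>\<bar> * indicator {x..} \<rho>)"
          using \<rho> by (auto simp: indicator_def)
      qed
      finally show ?thesis .
    qed
    have m_fin: "m < \<infinity>"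
    proof -
      have "m \<le> (\<integral>\<^sup>+\<rho>. 1 \<partial>\<mu>)" unfolding m_def
        by (intro nn_integral_mono_AE eventually_mono[OF AE_mu]) (auto simp: indicator_def ennreal_le_1)
      also have "\<dots> < \<infinity>" using mu.emeasure_finite[of UNIV] by (simp add: less_top[symmetric])
      finally show ?thesis .
    qed
    have Hx: "0 < H x" using x H_pos by simp
    have m_pos: "0 < m"
    proof -
      have "0 < ennreal x * ennreal (H x)" using x Hx by (simp add: ennreal_zero_less_mult_iff)
      also have "\<dots> = (\<integral>\<^sup>+\<rho>. ennreal x * indicator {x..} \<rho> \<partial>\<mu>)"
        using x by (simp add: nn_integral_cmult mu.emeasure_eq_measure H_eq)
      also have "\<dots> \<le> m" unfolding m_def
        by (intro nn_integral_mono) (use x in \<open>auto simp: indicator_def intro!: ennreal_leI\<close>)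
      finally show ?thesis .
    qed
    have f_in: "in_Lpq p q w f"
      unfolding in_Lpq_def Lf set_borel_measurable_def fg using m_fin by auto
    have S0: "0 \<le> S x" unfolding S_def using x a_pos
      by (intro suminf_nonneg summable_S) (auto simp: less_imp_le power_less_one_iff)
    \<comment> \<open>On the annulus the product of the radii is at least the square of
      \<open>x\<close>, so the kernel has mean at least \<open>2 * S x\<close>. The factor
      \<open>x\<close> bounds the Jacobian from below, \<open>1 / pi\<close> comes from the area
      measure, and \<open>H x\<close> is the mass of [x, 1).\<close>
    define L where "L = 2 * S x * x / pi * H x"
    have L0: "0 \<le> L" unfolding L_def using S0 x Hx by auto
    have P_ge: "L \<le> cmod (P (complex_of_real r * cis \<theta>))" if r: "x \<le> r" "r < 1" and \<theta>: "\<theta> \<in> {0..2*pi}" for r \<theta>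
    proof -
      let ?z = "complex_of_real r * cis \<theta>"
      have "?z \<in> ball 0 1" using r x by (simp add: norm_mult)
      then have "set_integrable lborel (ball 0 1) (P_plus_integrand w f ?z)" using c[OF f_in] by blast
      then have int: "integrable lborel (Q (\<lambda>\<zeta>. complex_of_real (g \<zeta>)) ?z)"
        unfolding set_integrable_def indicator_P_plus_integrand fg .
      have "ennreal L = (\<integral>\<^sup>+\<rho>. ennreal (2 * S x * x / pi) * indicator {x..} \<rho> \<partial>\<mu>)"
      proof -
        have "ennreal L = ennreal (2 * S x * x / pi) * ennreal (H x)"
          unfolding L_def using x S0 Hx by (intro ennreal_mult) auto
        then show ?thesis using x by (simp add: nn_integral_cmult mu.emeasure_eq_measure H_eq)
      qed
      also have "\<dots> \<le> (\<integral>\<^sup>+\<rho>. (\<integral>\<^sup>+\<phi>\<in>{0..2*pi}.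
          ennreal (g (complex_of_real \<rho> * cis \<phi>) * cmod (K (complex_of_real (r * \<rho>) * cis (\<phi> - \<theta>))) / pi) \<partial>lborel) * ennreal \<rho> \<partial>\<mu>)"
      proof (intro nn_integral_mono_AE, use AE_mu in eventually_elim)
        fix \<rho> :: real assume \<rho>: "0 \<le> \<rho> \<and> \<rho> < 1"
        show "ennreal (2 * S x * x / pi) * indicator {x..} \<rho> \<le> (\<integral>\<^sup>+\<phi>\<in>{0..2*pi}.
          ennreal (g (complex_of_real \<rho> * cis \<phi>) * cmod (K (complex_of_real (r * \<rho>) * cis (\<phi> - \<theta>))) / pi) \<partial>lborel) * ennreal \<rho>"
        proof (cases "x \<le> \<rho>")
          case True
          have "x * x \<le> r * \<rho>" using True r x by (intro mult_mono) auto
          moreover have "r * \<rho> < 1" using \<rho> r x mult_strict_mono'[of r 1 \<rho> 1] by auto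
          ultimately have rr: "0 \<le> r * \<rho>" "x\<^sup>2 \<le> r * \<rho>" "r * \<rho> < 1" using x r \<rho> by (auto simp: power2_eq_square)
          have "(\<integral>\<^sup>+\<phi>\<in>{0..2*pi}. ennreal (g (complex_of_real \<rho> * cis \<phi>) * cmod (K (complex_of_real (r * \<rho>) * cis (\<phi> - \<theta>))) / pi) \<partial>lborel)
            = (\<integral>\<^sup>+\<phi>. ennreal (1 / pi) * (ennreal (cmod (K (complex_of_real (r * \<rho>) * cis (\<phi> - \<theta>)))) * indicator {0..2*pi} \<phi>) \<partial>lborel)"
            using True \<rho> by (intro nn_integral_cong) (auto simp: g_cis indicator_def ennreal_mult[symmetric])
          also have "\<dots> = ennreal (1 / pi) * ennreal (kmean (r * \<rho>))"
            using nn_integral_K_shift(1)[OF rr(1,3) \<theta>] by (subst nn_integral_cmult) (auto simp del: of_real_mult)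
          finally have e: "(\<integral>\<^sup>+\<phi>\<in>{0..2*pi}. ennreal (g (complex_of_real \<rho> * cis \<phi>) * cmod (K (complex_of_real (r * \<rho>) * cis (\<phi> - \<theta>))) / pi) \<partial>lborel) * ennreal \<rho>
            = ennreal (1 / pi * kmean (r * \<rho>) * \<rho>)"
            using \<rho> kmean_nonneg[of "r * \<rho>"] by (simp only:) (simp add: ennreal_mult[symmetric])
          have "1 / pi * (2 * S x) * x \<le> 1 / pi * kmean (r * \<rho>) * \<rho>"
            using kmean_ge_S[of x "r * \<rho>"] rr x True S0 by (intro mult_mono mult_left_mono) (auto simp: kmean_nonneg)
          then show ?thesis unfolding e using True by (auto intro!: ennreal_leI simp: mult_ac)
        qed simp
      qed
      also have "\<dots> = T g ?z" by (rule T_polar[symmetric]) (auto simp: g0)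
      also have "\<dots> = ennreal (cmod (P ?z))" unfolding P_def by (rule norm_integral_Q_eq[OF int g0, symmetric])
      finally show ?thesis by (simp add: ennreal_le_iff)
    qed
    have "ennreal (L powr q) * m \<le> Lpq_norm_pow p q w (P_plus w f)"
    proof -
      have "ennreal (L powr q) * m = (\<integral>\<^sup>+\<rho>. ennreal (L powr q) * ennreal (\<bar>\<rho>\<bar> * indicator {x..} \<rho>) \<partial>\<mu>)"
        unfolding m_def by (rule nn_integral_cmult[symmetric]) measurable
      also have "\<dots> \<le> (\<integral>\<^sup>+\<rho>. angular_mean p q (\<lambda>z. cmod (P z)) \<rho> * ennreal \<rho> \<partial>\<mu>)"
      proof (intro nn_integral_mono_AE, use AE_mu in eventually_elim)
        fix r :: real assume r: "0 \<le> r \<and> r < 1"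
        have "ennreal (L powr q) \<le> angular_mean p q (\<lambda>z. cmod (P z)) r" if "x \<le> r"
        proof -
          have "ennreal (L powr p) = (\<integral>\<^sup>+\<theta>\<in>{0..2*pi}. ennreal (L powr p) \<partial>lborel) / ennreal (2 * pi)"
            by (simp add: nn_integral_cmult mult_divide_eq_ennreal)
          also have "\<dots> \<le> (\<integral>\<^sup>+\<theta>\<in>{0..2*pi}. ennreal (cmod (P (complex_of_real r * cis \<theta>)) powr p) \<partial>lborel) / ennreal (2 * pi)"
            using P_ge[OF that] r L0 p
            by (intro divide_right_mono_ennreal nn_integral_mono) (auto simp: indicator_def intro!: ennreal_leI powr_mono2)
          finally have "epowr (ennreal (L powr p)) (q / p) \<le> angular_mean p q (\<lambda>z. cmod (P z)) r"
            unfolding angular_mean_def using p q by (intro epowr_mono) auto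
          then show ?thesis using p by (simp add: epowr_ennreal powr_powr)
        qed
        then show "ennreal (L powr q) * ennreal (\<bar>r\<bar> * indicator {x..} r) \<le> angular_mean p q (\<lambda>z. cmod (P z)) r * ennreal r"
          using r by (auto simp: indicator_def intro: mult_right_mono)
      qed
      also have "\<dots> = Lpq_norm_pow p q w (P_plus w f)"
        by (rule Lpq_norm_pow_eq[symmetric]) (auto simp: Pf)
      finally show ?thesis .
    qed
    also have "\<dots> \<le> ennreal c * m" using c[OF f_in] unfolding Lf by blast
    \<comment> \<open>The constant of the boundedness assumption is an arbitrary real; a nonnegative
      one is wanted before returning to real inequalities and taking roots.\<close>
    also have "\<dots> \<le> ennreal (max c 1) * m" by (intro mult_right_mono ennreal_leI) auto
    finally have "ennreal (L powr q) \<le> ennreal (max c 1)"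
      using m_pos m_fin by (cases m) (auto simp: ennreal_mult[symmetric])
    then have "L powr q \<le> max c 1" by (simp add: ennreal_le_iff)
    then have "(L powr q) powr (1 / q) \<le> max c 1 powr (1 / q)" using q by (intro powr_mono2) auto
    then have L: "L \<le> max c 1 powr (1 / q)" using q L0 by (simp add: powr_powr)
    have "H x * S x \<le> pi * L"
      \<comment> \<open>Here \<open>1/2 \<le> x\<close> removes the factor
        \<open>2 * x\<close>.\<close>
      using mult_right_mono[of 1 "2 * x" "H x * S x"] x Hx S0 by (simp add: L_def mult_ac)
    also have "\<dots> \<le> pi * max c 1 powr (1 / q)" using L by simp
    finally show ?thesis .
  qed
  moreover have "0 < pi * max c 1 powr (1 / q)" by simp
  ultimately show ?thesis by blast
qed

end

text \<open>Each dyadic block from M to 2M has M terms of size at least 1/(2M), hence contributes at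
  least 1/2.\<close>

lemma harmonic_block_ge:
  assumes "0 < N"
  shows "real J / 2 \<le> (\<Sum>n\<in>{N..<2 ^ J * N}. 1 / real (n + 1))"
proof (induction J)
  case (Suc J)
  let ?M = "2 ^ J * N"
  have "(\<Sum>n\<in>{?M..<2 * ?M}. 1 / real (2 * ?M)) \<le> (\<Sum>n\<in>{?M..<2 * ?M}. 1 / real (n + 1))"
    using assms by (intro sum_mono divide_left_mono) (auto simp del: of_nat_mult of_nat_add)
  moreover have "(\<Sum>n\<in>{?M..<2 * ?M}. 1 / real (2 * ?M)) = 1 / 2" using assms by simp
  moreover have "(\<Sum>n\<in>{N..<2 ^ Suc J * N}. 1 / real (n + 1)) = (\<Sum>n\<in>{N..<?M}. 1 / real (n + 1)) + (\<Sum>n\<in>{?M..<2 * ?M}. 1 / real (n + 1))"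
    using assms by (subst sum.atLeastLessThan_concat) (auto simp: mult.assoc)
  ultimately show ?case using Suc by simp
qed simp

section \<open>From the test-function bound to \<open>D_check\<close>\<close>

context doubling
begin

text \<open>The hypothesis gives \<open>r ^ n \<le> exp (- 1) \<le> 1/2\<close>, which is what
  \<open>moment_le_H\<close> asks for. Since that bound is for positive radii, \<open>r = 0\<close>
  is treated separately with the total mass.\<close>

lemma moment_le_H_nat:
  "\<exists>c>0. \<forall>r n. 0 \<le> r \<longrightarrow> r < 1 \<longrightarrow> 1 \<le> real n * (1 - r) \<longrightarrow> moment w n \<le> c * H r"
proof -
  obtain c where c: "c > 0" "\<And>u m. 0 < u \<Longrightarrow> u < 1 \<Longrightarrow> u ^ m \<le> 1/2 \<Longrightarrow> moment w m \<le> c * H u"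
    using moment_le_H by blast
  have "moment w n \<le> (c + 1) * H r" if r: "0 \<le> r" "r < 1" and n: "1 \<le> real n * (1 - r)" for r n
  proof (cases "r = 0")
    case True
    have "moment w n \<le> moment w 0" by (rule moment_antimono) simp
    also have "\<dots> = H 0" using measure_mu_UNIV by (simp add: moment_eq G_eq_H)
    also have "\<dots> \<le> (c + 1) * H 0" using c(1) H_pos[of 0] by (simp add: ring_distribs)
    finally show ?thesis using True by simp
  next
    case False
    have "r ^ n \<le> exp (r - 1) ^ n" using r exp_ge_add_one_self[of "r - 1"] by (intro power_mono) auto
    also have "\<dots> = exp (- (real n * (1 - r)))" by (simp add: exp_of_nat_mult[symmetric] algebra_simps)
    also have "\<dots> \<le> exp (- 1)" using n by simp
    also have "\<dots> \<le> 1 / 2" using exp_ge_add_one_self[of 1] by (simp add: exp_minus field_simps)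
    finally have "moment w n \<le> c * H r" using False r by (intro c) auto
    also have "\<dots> \<le> (c + 1) * H r" using H_pos[of r] r by (simp add: ring_distribs)
    finally show ?thesis .
  qed
  then show ?thesis using c(1) by (intro exI[of _ "c + 1"]) auto
qed

lemma D_check_if_bounded:
  assumes bd: "P_plus_bounded p q w" and p: "1 < p" and q: "1 < q"
  shows "D_check w"
proof -
  obtain D where D: "D > 0" "\<And>x. 1/2 \<le> x \<Longrightarrow> x < 1 \<Longrightarrow> H x * S x \<le> D"
    using H_mult_S_bounded[OF assms] by blast
  obtain c where c: "c > 0" "\<And>r n. 0 \<le> r \<Longrightarrow> r < 1 \<Longrightarrow> 1 \<le> real n * (1 - r) \<Longrightarrow> moment w n \<le> c * H r"
    using moment_le_H_nat by blast
  \<comment> \<open>The block below bounds \<open>S x\<close> from below by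
    \<open>J / (8 * c * H r)\<close>; this size of \<open>J\<close> turns the bound \<open>D\<close>
    into a gain of the factor 2.\<close>
  obtain J :: nat where J: "16 * c * D \<le> real J" using real_arch_simple by blast
  \<comment> \<open>Large enough that \<open>(x\<^sup>2) ^ n\<close> stays at least 1/2 on the whole
    block: there \<open>n * (1 - r)\<close> is at most \<open>2 * 2 ^ J\<close>, so
    \<open>2 * n * (1 - x)\<close> is at most 1/2.\<close>
  define k :: real where "k = 2 ^ (J + 3)"
  have k8: "8 \<le> k" unfolding k_def by (simp add: power_add)
  have "2 * H (1 - (1 - r) / k) \<le> H r" if r: "0 \<le> r" "r < 1" for r
  proof -
    define x where "x = 1 - (1 - r) / k"
    have "(1 - r) / k \<le> 1 / 8" using r k8 by (intro frac_le) auto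
    then have x: "1/2 \<le> x" "x < 1" using r k8 by (auto simp: x_def)
    \<comment> \<open>Rounding up at most doubles the value, as \<open>1 / (1 - r)\<close> is at
      least 1. From \<open>N\<close> on, the moments are controlled by \<open>H r\<close>.\<close>
    define N where "N = nat \<lceil>1 / (1 - r)\<rceil>"
    have y1: "1 \<le> 1 / (1 - r)" using r by simp
    have N1: "1 / (1 - r) \<le> real N" unfolding N_def by linarith
    have N2: "real N \<le> 2 / (1 - r)" unfolding N_def using y1 by linarith
    have N0: "0 < N" using order_trans[OF y1 N1] by simp
    have Hr: "0 < H r" "0 < H x" using r x H_pos by auto
    have term_ge: "1 / (4 * c * H r) * (1 / real (n + 1)) \<le> a n * (x\<^sup>2) ^ n / real (n + 1)" if n: "n \<in> {N..<2 ^ J * N}" for n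
    proof -
      have "1 / (1 - r) \<le> real (2 * n + 1)" using n N1 by (simp add: order_trans)
      then have "1 \<le> real (2 * n + 1) * (1 - r)" using r by (simp add: divide_le_eq)
      then have mo: "moment w (2 * n + 1) \<le> c * H r" using r by (intro c(2)) auto
      have an: "1 / (2 * (c * H r)) \<le> a n"
        unfolding a_def using mo moment_pos[of "2 * n + 1"] c(1) Hr by (intro divide_left_mono) auto
      have "real n \<le> real (2 ^ J * N)" using n by (intro of_nat_mono) auto
      also have "\<dots> = 2 ^ J * real N" by simp
      also have "\<dots> \<le> 2 ^ J * (2 / (1 - r))" using N2 by (intro mult_left_mono) auto
      finally have "real n * (1 - r) \<le> 2 ^ J * 2" using r by (simp add: field_simps)
      then have "real (2 * n) * ((1 - r) / k) \<le> 1 / 2"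
        unfolding k_def by (simp add: power_add field_simps)
      then have "1 / 2 \<le> 1 + real (2 * n) * (x - 1)" by (simp add: x_def)
      also have "\<dots> \<le> (1 + (x - 1)) ^ (2 * n)" using x by (intro Bernoulli_inequality) auto
      also have "\<dots> = (x\<^sup>2) ^ n" by (simp add: power_mult)
      finally have "1 / (2 * (c * H r)) * (1 / 2) \<le> a n * (x\<^sup>2) ^ n"
        using an c(1) Hr a_pos[of n] by (intro mult_mono) auto
      then have "1 / (2 * (c * H r)) * (1 / 2) / real (n + 1) \<le> a n * (x\<^sup>2) ^ n / real (n + 1)"
        by (intro divide_right_mono) auto
      then show ?thesis by simp
    qed
    have "1 / (4 * c * H r) * (real J / 2) \<le> 1 / (4 * c * H r) * (\<Sum>n\<in>{N..<2 ^ J * N}. 1 / real (n + 1))"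
      using harmonic_block_ge[OF N0] c(1) Hr by (intro mult_left_mono) auto
    also have "\<dots> \<le> (\<Sum>n\<in>{N..<2 ^ J * N}. a n * (x\<^sup>2) ^ n / real (n + 1))"
      unfolding sum_distrib_left by (intro sum_mono term_ge)
    also have "\<dots> \<le> S x" unfolding S_def
      using x a_pos by (intro sum_le_suminf summable_S) (auto simp: power_less_one_iff less_imp_le)
    finally have "H x * (1 / (4 * c * H r) * (real J / 2)) \<le> H x * S x" using Hr by (intro mult_left_mono) auto
    also have "\<dots> \<le> D" using x by (rule D(2))
    finally have "H x * real J \<le> D * (8 * c * H r)" using c(1) Hr by (simp add: field_simps)
    moreover have "H x * (16 * c * D) \<le> H x * real J" using J Hr by (intro mult_left_mono) auto
    \<comment> \<open>The common factor is positive, so cancelling it leaves the inequality of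
      \<open>D_check\<close> with constants \<open>k\<close> and 2.\<close>
    ultimately have "(8 * c * D) * (2 * H x) \<le> (8 * c * D) * H r" by (simp add: mult_ac)
    then show ?thesis using c(1) D(1) by (simp add: x_def)
  qed
  then show ?thesis unfolding D_check_def using k8 by (intro exI[of _ k] conjI exI[of _ 2]) auto
qed

end

theorem theorem1p3:
  fixes w :: "real \<Rightarrow> real" and p q :: real
  assumes "radial_weight w" and "D_hat w"
    and "1 < p" and "1 < q"
  shows "P_plus_bounded p q w \<longleftrightarrow> D_check w"
proof -
  obtain C where C: "C > 0" "\<And>r. 0 \<le> r \<Longrightarrow> r < 1 \<Longrightarrow> omega_hat w r \<le> C * omega_hat w ((1 + r) / 2)"
    using assms(2) unfolding D_hat_def by auto
  interpret radial w by unfold_locales (rule assms(1))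
  \<comment> \<open>Enlarging the constant is harmless and makes its powers monotone.\<close>
  interpret doubling w "max C 1"
  proof unfold_locales
    fix r :: real assume r: "0 \<le> r" "r < 1"
    have "C * H ((1 + r) / 2) \<le> max C 1 * H ((1 + r) / 2)"
      using r H_pos[of "(1 + r) / 2"] by (intro mult_right_mono) auto
    then show "H r \<le> max C 1 * H ((1 + r) / 2)" using C(2)[OF r] by linarith
  qed simp
  show ?thesis
  proof
    assume "D_check w"
    then obtain A where "A > 0" "\<And>x. 0 \<le> x \<Longrightarrow> x < 1 \<Longrightarrow> kmean x \<le> A / H x"
      using kmean_le_inverse_H by blast
    then show "P_plus_bounded p q w" using assms(3,4) by (rule P_plus_bounded_if_kmean_le)
  qed (rule D_check_if_bounded[OF _ assms(3,4)])
qed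

end
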